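(* Let $(X,G_\bullet)$ be a finite connected graph of finite groups such that the degree $k_x+1$ at each vertex $x$ of $(X,G_\bullet)$ is at least three. Among the normalized (i.e. volume one) length distances on $(X,G_\bullet)$, there exists a unique normalized length distance minimizing the volume entropy. At this minimum, the length of each edge $e\in EX$ is proportional to $\log(k_{i(e)}k_{t(e)})$ (with a proportionality constant independent of $e$), and the minimal volume entropy is $$h_{\min}(X,G_\bullet)=\frac12\sum_{x\in VX}\frac{(k_x+1)\log k_x}{|G_x|}.$$
   Context: Graphs: $VX$ is the set of vertices of $X$ and $EX$ the set of oriented edges; each $e\in EX$ has an initial vertex $i(e)$, a terminal vertex $t(e)$ and a reversed edge $\bar e\neq e$ with $\bar{\bar e}=e$, $i(\bar e)=t(e)$. Loops and multiple edges are allowed. Graph of groups $(X,G_\bullet)$ (in the sense of Bass–Serre): groups $G_x$ ($x\in VX$), groups $G_e=G_{\bar e}$ ($e\in EX$), and monomorphisms $G_e\to G_{i(e)}$; here all groups are finite and $X$ is finite and connected. Let $T$ be a (Bass–Serre) universal covering tree of $(X,G_\bullet)$, with canonical projection $p:T\to X$. The degree of a vertex $x$ of $(X,G_\bullet)$ is $\sum_{e\in EX,\ i(e)=x}|G_x|/|G_e|$ (it equals the valency in $T$ of any lift of $x$), and is denoted $k_x+1$. Length distances: a length distance $d_\ell$ on $(X,G_\bullet)$ is a length distance on the underlying graph $X$: given positive reals $\ell(e)=\ell(\bar e)$ for $e\in EX$, $d_\ell$ is the maximal distance on the geometric realization of $X$ which makes each half-edge of an edge $e$ containing a vertex isometric to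 $[0,\ell(e)/2]$ (so each edge $e$ has length $\ell(e)$). The volume is $\mathrm{vol}_\ell(X,G_\bullet)=\frac12\sum_{e\in EX}\frac{\ell(e)}{|G_e|}$. Volume entropy: $h_{\mathrm{vol}}(X,G_\bullet,d_\ell)=\limsup_{r\to\infty}\frac1r\log\ell(B(x_0,r))$, where $B(x_0,r)$ is the ball of radius $r$ centered at a fixed vertex $x_0$ of $T$ for the lifted length metric on $T$ (each edge of $T$ has the length of its image in $X$), and $\ell(S)$ denotes the sum of lengths of the (maximal pieces of) edges in a connected subset $S\subset T$. *)

theory Defs
  imports "HOL-Analysis.Analysis" "HOL-Algebra.Coset"
begin

section \<open>Graphs\<close>

record ('v, 'e) sgraph =
  verts :: "'v set"
  edges :: "'e set"
  src :: "'e \<Rightarrow> 'v"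
  tgt :: "'e \<Rightarrow> 'v"
  bar :: "'e \<Rightarrow> 'e"

definition serre_graph :: "('v, 'e, 'z) sgraph_scheme \<Rightarrow> bool" where
  "serre_graph X \<longleftrightarrow>
     (\<forall>e\<in>edges X. src X e \<in> verts X \<and> tgt X e \<in> verts X \<and> bar X e \<in> edges X \<and>
        bar X e \<noteq> e \<and> bar X (bar X e) = e \<and> src X (bar X e) = tgt X e)"

fun edge_path :: "('v, 'e, 'z) sgraph_scheme \<Rightarrow> 'v \<Rightarrow> 'e list \<Rightarrow> 'v \<Rightarrow> bool" where
  "edge_path X x [] y \<longleftrightarrow> x \<in> verts X \<and> y = x"
| "edge_path X x (e # es) y \<longleftrightarrow> e \<in> edges X \<and> src X e = x \<and> edge_path X (tgt X e) es y"

definition connected_graph :: "('v, 'e, 'z) sgraph_scheme \<Rightarrow> bool" where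
  "connected_graph X \<longleftrightarrow>
     verts X \<noteq> {} \<and> (\<forall>x\<in>verts X. \<forall>y\<in>verts X. \<exists>es. edge_path X x es y)"


section \<open>Length distances on the geometric realization\<close>

text \<open>
  The realization is the disjoint union of the vertices and of one copy of \<open>[0,1]\<close> for each
  oriented edge, modulo \<open>(e, 0) \<sim> src e\<close>, \<open>(e, 1) \<sim> tgt e\<close> and \<open>(e, s) \<sim> (bar e, 1 - s)\<close>.
  An interior point of an edge is represented by its class, which has two elements.
\<close>

datatype ('v, 'e) point = Vertex 'v | Inner "('e \<times> real) set"

definition edge_point :: "('v, 'e, 'z) sgraph_scheme \<Rightarrow> 'e \<Rightarrow> real \<Rightarrow> ('v, 'e) point" where
  "edge_point X e s =
     (if s = 0 then Vertex (src X e)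
      else if s = 1 then Vertex (tgt X e)
      else Inner {(e, s), (bar X e, 1 - s)})"

definition realization :: "('v, 'e, 'z) sgraph_scheme \<Rightarrow> ('v, 'e) point set" where
  "realization X = Vertex ` verts X \<union> {edge_point X e s |e s. e \<in> edges X \<and> s \<in> {0..1}}"

definition length_function :: "('v, 'e, 'z) sgraph_scheme \<Rightarrow> ('e \<Rightarrow> real) \<Rightarrow> bool" where
  "length_function X l \<longleftrightarrow> (\<forall>e\<in>edges X. l e > 0 \<and> l (bar X e) = l e)"

text \<open>
  Edges are parametrized proportionally to length, so that the half-edge of \<open>e\<close> at its source
  is isometric to \<open>[0, l e / 2]\<close>; the other half-edge of \<open>e\<close> is covered by \<open>bar X e\<close>.
  Values outside the realization are fixed to \<open>0\<close> so that a distance is determined by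
  its values on the realization.
\<close>

definition half_edge_metric ::
  "('v, 'e, 'z) sgraph_scheme \<Rightarrow> ('e \<Rightarrow> real) \<Rightarrow>
   (('v, 'e) point \<Rightarrow> ('v, 'e) point \<Rightarrow> real) \<Rightarrow> bool" where
  "half_edge_metric X l d \<longleftrightarrow>
     Metric_space (realization X) d \<and>
     (\<forall>p q. p \<notin> realization X \<or> q \<notin> realization X \<longrightarrow> d p q = 0) \<and>
     (\<forall>e\<in>edges X. \<forall>s\<in>{0..1/2}. \<forall>t\<in>{0..1/2}.
        d (edge_point X e s) (edge_point X e t) = l e * \<bar>s - t\<bar>)"

text \<open>The order on distances is the pointwise one.\<close>

definition length_dist ::
  "('v, 'e, 'z) sgraph_scheme \<Rightarrow> ('e \<Rightarrow> real) \<Rightarrow>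
   ('v, 'e) point \<Rightarrow> ('v, 'e) point \<Rightarrow> real" where
  "length_dist X l = (GREATEST d. half_edge_metric X l d)"

text \<open>
  The total length of the pieces of edges lying in \<open>S\<close>. The factor \<open>1/2\<close> accounts
  for the two orientations of each edge.
\<close>

definition total_length ::
  "('v, 'e, 'z) sgraph_scheme \<Rightarrow> ('e \<Rightarrow> real) \<Rightarrow> ('v, 'e) point set \<Rightarrow> real" where
  "total_length X l S =
     1/2 * (\<Sum>\<^sub>\<infinity>e\<in>edges X. l e * measure lebesgue {s \<in> {0..1}. edge_point X e s \<in> S})"


section \<open>Graphs of groups\<close>

text \<open>\<open>emb G e\<close> is the monomorphism from the group of \<open>e\<close> to the group of its source.\<close>

record ('v, 'e, 'g, 'h) gog = "('v, 'e) sgraph" +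
  vgrp :: "'v \<Rightarrow> 'g monoid"
  egrp :: "'e \<Rightarrow> 'h monoid"
  emb :: "'e \<Rightarrow> 'h \<Rightarrow> 'g"

definition graph_of_groups :: "('v, 'e, 'g, 'h) gog \<Rightarrow> bool" where
  "graph_of_groups G \<longleftrightarrow>
     serre_graph G \<and>
     (\<forall>x\<in>verts G. group (vgrp G x)) \<and>
     (\<forall>e\<in>edges G. group (egrp G e) \<and> egrp G (bar G e) = egrp G e \<and>
        emb G e \<in> mon (egrp G e) (vgrp G (src G e)))"

definition finite_connected_graph_of_finite_groups :: "('v, 'e, 'g, 'h) gog \<Rightarrow> bool" where
  "finite_connected_graph_of_finite_groups G \<longleftrightarrow>
     graph_of_groups G \<and> finite (verts G) \<and> finite (edges G) \<and> connected_graph G \<and>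
     (\<forall>x\<in>verts G. finite (carrier (vgrp G x))) \<and>
     (\<forall>e\<in>edges G. finite (carrier (egrp G e)))"

definition gog_degree :: "('v, 'e, 'g, 'h) gog \<Rightarrow> 'v \<Rightarrow> real" where
  "gog_degree G x =
     (\<Sum>e | e \<in> edges G \<and> src G e = x. real (order (vgrp G x)) / real (order (egrp G e)))"

definition branching :: "('v, 'e, 'g, 'h) gog \<Rightarrow> 'v \<Rightarrow> real" where
  "branching G x = gog_degree G x - 1"


section \<open>The Bass--Serre universal covering tree\<close>

text \<open>
  Morphisms of the fundamental groupoid of \<open>G\<close> are represented by words in the elements of the
  vertex groups (loops at their vertex) and the oriented edges, with concatenation from left
  to right. \<open>gpath G x w y\<close> says that the word \<open>w\<close> is composable and leads from \<open>x\<close> to \<open>y\<close>.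
\<close>

datatype ('v, 'e, 'g) letter = Elt 'v 'g | Edg 'e

fun gpath :: "('v, 'e, 'g, 'h) gog \<Rightarrow> 'v \<Rightarrow> ('v, 'e, 'g) letter list \<Rightarrow> 'v \<Rightarrow> bool" where
  "gpath G x [] y \<longleftrightarrow> x \<in> verts G \<and> y = x"
| "gpath G x (Elt z g # w) y \<longleftrightarrow> z = x \<and> x \<in> verts G \<and> g \<in> carrier (vgrp G x) \<and> gpath G x w y"
| "gpath G x (Edg e # w) y \<longleftrightarrow> e \<in> edges G \<and> src G e = x \<and> gpath G (tgt G e) w y"

inductive relator ::
  "('v, 'e, 'g, 'h) gog \<Rightarrow> ('v, 'e, 'g) letter list \<Rightarrow> ('v, 'e, 'g) letter list \<Rightarrow> bool"
  for G where
  mult: "relator G [Elt x g, Elt x h] [Elt x (g \<otimes>\<^bsub>vgrp G x\<^esub> h)]"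
| unit: "relator G [Elt x \<one>\<^bsub>vgrp G x\<^esub>] []"
| cancel: "relator G [Edg e, Edg (bar G e)] []"
| slide: "s \<in> carrier (egrp G e) \<Longrightarrow>
    relator G [Elt (src G e) (emb G e s), Edg e] [Edg e, Elt (tgt G e) (emb G (bar G e) s)]"

definition homotopic ::
  "('v, 'e, 'g, 'h) gog \<Rightarrow> 'v \<Rightarrow> 'v \<Rightarrow>
   ('v, 'e, 'g) letter list \<Rightarrow> ('v, 'e, 'g) letter list \<Rightarrow> bool" where
  "homotopic G x y =
     equivclp (\<lambda>w w'. gpath G x w y \<and> gpath G x w' y \<and>
       (\<exists>u r r' v. relator G r r' \<and> w = u @ r @ v \<and> w' = u @ r' @ v))"

text \<open>
  With \<open>\<pi>(a, x)\<close> the homotopy classes of paths from \<open>a\<close> to \<open>x\<close>, the tree based at \<open>a\<close> has vertices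
  \<open>\<pi>(a, x) / G_x\<close> over \<open>x\<close> and edges \<open>\<pi>(a, src e) / emb(G_e)\<close> over \<open>e\<close>. The coset of a path \<open>w\<close> is
  the set of all paths representing one of its elements. The edge given by \<open>w\<close> and \<open>e\<close> goes
  from the vertex of \<open>w\<close> to the vertex of \<open>w e\<close>, and its reverse is given by \<open>w e\<close> and \<open>bar e\<close>.
\<close>

definition vcoset ::
  "('v, 'e, 'g, 'h) gog \<Rightarrow> 'v \<Rightarrow> 'v \<Rightarrow> ('v, 'e, 'g) letter list \<Rightarrow> ('v, 'e, 'g) letter list set" where
  "vcoset G a x w = {w'. \<exists>g\<in>carrier (vgrp G x). homotopic G a x (w @ [Elt x g]) w'}"

definition ecoset ::
  "('v, 'e, 'g, 'h) gog \<Rightarrow> 'v \<Rightarrow> 'e \<Rightarrow> ('v, 'e, 'g) letter list \<Rightarrow> ('v, 'e, 'g) letter list set" where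
  "ecoset G a e w =
     {w'. \<exists>s\<in>carrier (egrp G e). homotopic G a (src G e) (w @ [Elt (src G e) (emb G e s)]) w'}"

text \<open>
  The unions below are over representatives of one coset, all giving the same set.
  The projection to \<open>G\<close> is \<open>fst\<close>, on vertices and on edges.
\<close>

definition universal_cover ::
  "('v, 'e, 'g, 'h) gog \<Rightarrow> 'v \<Rightarrow>
   ('v \<times> ('v, 'e, 'g) letter list set, 'e \<times> ('v, 'e, 'g) letter list set) sgraph" where
  "universal_cover G a =
     \<lparr> verts = {(x, vcoset G a x w) |x w. x \<in> verts G \<and> gpath G a w x},
       edges = {(e, ecoset G a e w) |e w. e \<in> edges G \<and> gpath G a w (src G e)},
       src = (\<lambda>(e, C). (src G e, \<Union>w\<in>C. vcoset G a (src G e) w)),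
       tgt = (\<lambda>(e, C). (tgt G e, \<Union>w\<in>C. vcoset G a (tgt G e) (w @ [Edg e]))),
       bar = (\<lambda>(e, C). (bar G e, \<Union>w\<in>C. ecoset G a (bar G e) (w @ [Edg e]))) \<rparr>"


section \<open>Volume and volume entropy\<close>

definition gog_volume :: "('v, 'e, 'g, 'h) gog \<Rightarrow> ('e \<Rightarrow> real) \<Rightarrow> real" where
  "gog_volume G l = 1/2 * (\<Sum>e\<in>edges G. l e / real (order (egrp G e)))"

text \<open>\<open>a\<close> is the base vertex of the universal cover and \<open>v\<close> the centre of the balls.\<close>

definition ball_length ::
  "('v, 'e, 'g, 'h) gog \<Rightarrow> 'v \<Rightarrow> 'v \<times> ('v, 'e, 'g) letter list set \<Rightarrow> ('e \<Rightarrow> real) \<Rightarrow> real \<Rightarrow> real" where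
  "ball_length G a v l r =
     (let T = universal_cover G a; l' = l \<circ> fst
      in total_length T l' (Metric_space.mcball (realization T) (length_dist T l') (Vertex v) r))"

definition volume_entropy ::
  "('v, 'e, 'g, 'h) gog \<Rightarrow> 'v \<Rightarrow> 'v \<times> ('v, 'e, 'g) letter list set \<Rightarrow> ('e \<Rightarrow> real) \<Rightarrow> ereal" where
  "volume_entropy G a v l = Limsup at_top (\<lambda>r. ereal (ln (ball_length G a v l r) / r))"

definition normalized :: "('v, 'e, 'g, 'h) gog \<Rightarrow> ('e \<Rightarrow> real) \<Rightarrow> bool" where
  "normalized G l \<longleftrightarrow> length_function G l \<and> gog_volume G l = 1"

definition minimizes_entropy ::
  "('v, 'e, 'g, 'h) gog \<Rightarrow> 'v \<Rightarrow> 'v \<times> ('v, 'e, 'g) letter list set \<Rightarrow> ('e \<Rightarrow> real) \<Rightarrow> bool" where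
  "minimizes_entropy G a v l \<longleftrightarrow>
     normalized G l \<and> (\<forall>l'. normalized G l' \<longrightarrow> volume_entropy G a v l \<le> volume_entropy G a v l')"

definition min_entropy ::
  "('v, 'e, 'g, 'h) gog \<Rightarrow> 'v \<Rightarrow> 'v \<times> ('v, 'e, 'g) letter list set \<Rightarrow> ereal" where
  "min_entropy G a v = (INF l\<in>{l. normalized G l}. volume_entropy G a v l)"

end

theory Submission
  imports Defs
begin

text \<open>
  Let \<open>k x + 1\<close> be the degree of \<open>x\<close>. Seen from the chosen centre, every edge of the covering tree
  \<open>T\<close> points away from the centre in exactly one orientation. If such an outward edge lies over \<open>e\<close>, then
  the number of outward edges over \<open>f\<close> that continue it is \<open>arrows e f = |G_x| / |G_f| - [f = bar e]\<close>, where
  \<open>x\<close> is the end of \<open>e\<close> and the start of \<open>f\<close>; summed over \<open>f\<close> this is \<open>k x\<close>. The volume of the ball of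
  radius \<open>r\<close> is comparable to the number of outward edges within distance \<open>r\<close>, so the entropy is the exponent of
  convergence of the series of \<open>exp (- s * h)\<close> over the outward edges, \<open>h\<close> being the distance from the
  centre (\<open>entropy_le\<close>, \<open>summable_level_sum\<close>).

  Lower bound. For \<open>s\<close> above the entropy let \<open>W f\<close> be the part of this series that lies over \<open>f\<close>. Cutting off the
  last edge gives \<open>W f \<ge> exp (- s * l f) * (\<Sum>e. arrows e f * W e)\<close>. The numbers \<open>arrows e f\<close>, divided by
  \<open>|G_e| * k x\<close>, are the flow of the non-backtracking random walk in its stationary measure \<open>1 / |G_e|\<close>. Take
  logarithms, apply Jensen's inequality to this flow and sum up: the terms \<open>ln (|G_e| * W e)\<close> cancel by stationarity,
  and what remains is \<open>s * vol \<ge> 1/2 * (\<Sum>f. ln (k (src f)) / |G_f|)\<close>. The right-hand side is the claimed minimum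
  (\<open>path_entropy_eq\<close>). This is the variational principle: entropy rate divided by mean step length
  bounds the exponential growth from below.

  Equality. If the entropy at volume one equals the bound \<open>h\<close>, the total Jensen defect is at most \<open>2 * (s - h)\<close> and
  tends to \<open>0\<close> as \<open>s\<close> decreases to \<open>h\<close>, so each of its nonnegative terms does. Hence
  \<open>k x * |G_e| * W e * exp (- s * l f) / (|G_f| * W f)\<close> tends to \<open>1\<close> whenever \<open>f\<close> can follow \<open>e\<close>, and
  by \<open>zigzag\<close> also for \<open>e = bar f\<close>. Multiplying the limits for \<open>f\<close> and \<open>bar f\<close> removes the unknown
  \<open>W\<close> and leaves \<open>k (src f) * k (tgt f) * exp (- 2 * h * l f) = 1\<close>
  (\<open>length_of_minimal_entropy\<close>).

  Conversely, for the length determined in this way, the square root of \<open>k\<close> at the end of an edge is an eigenvector of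
  the transfer matrix at \<open>s = h\<close> with eigenvalue one, so the sums over the edges at a given depth stay bounded at
  \<open>s = h\<close>, decay geometrically for \<open>s > h\<close>, and the entropy is at most \<open>h\<close> (\<open>entropy_log_length\<close>).

  Two facts about \<open>T\<close> carry this over to the definitions. The normal form theorem for the fundamental
  groupoid, proved by letting words act on reduced words, shows that \<open>T\<close> is a rooted tree with
  \<open>|G_x| / |G_f|\<close> edges over \<open>f\<close> at a vertex over \<open>x\<close> (\<open>rooted_tree_cover\<close>, \<open>card_edges_over\<close>). And in
  a rooted tree the greatest half-edge metric exists, and its distance from the root is the length of the geodesic
  (\<open>length_dist_root\<close>).
\<close>

section \<open>Auxiliary facts\<close>

lemma length_dist_cong:
  assumes "\<And>e. e \<in> edges X \<Longrightarrow> l e = l' e" shows "length_dist X l = length_dist X l'"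
proof -
  have "half_edge_metric X l = half_edge_metric X l'"
    by (rule ext) (auto simp: half_edge_metric_def assms)
  then show ?thesis by (simp add: length_dist_def)
qed

text \<open>
  Counts cosets: applied to the map that sends an element of a vertex group to its left coset.
\<close>

lemma card_eq_card_image_mult:
  assumes "finite A" "\<And>x. x \<in> A \<Longrightarrow> card {y \<in> A. f y = f x} = n"
  shows "card A = card (f ` A) * n"
proof -
  have "card A = (\<Sum>z\<in>f ` A. card {y \<in> A. f y = z})"
    using sum.image_gen[OF assms(1), of "\<lambda>_. 1::nat" f] by simp
  also have "\<dots> = (\<Sum>z\<in>f ` A. n)" using assms(2) by (intro sum.cong) auto
  finally show ?thesis by simp
qed

text \<open>
  The convexity gap \<open>t - 1 - ln t\<close> controls the distance of \<open>t\<close> from \<open>1\<close>: apply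
  \<open>ln y \<le> y - 1\<close> to \<open>y = sqrt t\<close> and complete the square.
\<close>

lemma sqrt_gap: 
  fixes t :: real assumes "0 < t" shows "(sqrt t - 1)\<^sup>2 \<le> t - 1 - ln t"
proof -
  have "ln t = 2 * ln (sqrt t)" using assms by (simp add: ln_sqrt)
  also have "\<dots> \<le> 2 * (sqrt t - 1)" using ln_le_minus_one[of "sqrt t"] assms by simp
  finally show ?thesis using assms by (simp add: power2_eq_square algebra_simps)
qed

lemma tendsto_1_if_gap_tendsto_0:
  fixes t :: "nat \<Rightarrow> real"
  assumes pos: "\<And>n. 0 < t n" and gap: "(\<lambda>n. t n - 1 - ln (t n)) \<longlonglongrightarrow> 0"
  shows "t \<longlonglongrightarrow> 1"
proof -
  have "(\<lambda>n. (sqrt (t n) - 1)\<^sup>2) \<longlonglongrightarrow> 0"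
    by (rule tendsto_sandwich[OF _ _ tendsto_const gap]) (simp_all add: sqrt_gap pos)
  then have "(\<lambda>n. sqrt ((sqrt (t n) - 1)\<^sup>2)) \<longlonglongrightarrow> sqrt 0" by (rule tendsto_real_sqrt)
  then have "(\<lambda>n. sqrt (t n) - 1) \<longlonglongrightarrow> 0" by (simp add: tendsto_rabs_zero_iff)
  then have "(\<lambda>n. sqrt (t n) - 1 + 1) \<longlonglongrightarrow> 0 + 1" by (intro tendsto_add tendsto_const)
  then have "(\<lambda>n. (sqrt (t n))\<^sup>2) \<longlonglongrightarrow> 1\<^sup>2" by (intro tendsto_power) simp
  then show ?thesis using pos by (simp add: less_imp_le)
qed

lemma ln_mult_mult_exp_div:
  fixes x y z :: real
  assumes "0 < x" "0 < y" "0 < z" shows "ln (x * y * exp t / z) = ln x + ln y + t - ln z"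
  using assms by (simp add: ln_div ln_mult)

section \<open>Rooted trees\<close>

text \<open>
  A tree is given here by a depth function: edges change the depth by one, and every vertex except the root has exactly
  one edge towards the root. This suits the universal cover, where the depth is the length of a normal form, and it makes
  induction along geodesics available without any talk of paths.
\<close>

locale rooted_tree =
  fixes T :: "('v, 'e, 'z) sgraph_scheme" and root :: 'v and depth :: "'v \<Rightarrow> nat"
  assumes serre: "serre_graph T"
    and root_vert: "root \<in> verts T"
    and depth_root: "depth root = 0"
    and depth_edge: "e \<in> edges T \<Longrightarrow>
      depth (tgt T e) = Suc (depth (src T e)) \<or> depth (src T e) = Suc (depth (tgt T e))"
    and descending_edge: "t \<in> verts T \<Longrightarrow> t \<noteq> root \<Longrightarrow>
      \<exists>!e. e \<in> edges T \<and> src T e = t \<and> depth t = Suc (depth (tgt T e))"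
begin

definition outward :: "'e set" where
  "outward = {e \<in> edges T. depth (tgt T e) = Suc (depth (src T e))}"

lemma edge_facts:
  assumes "e \<in> edges T"
  shows "src T e \<in> verts T" "tgt T e \<in> verts T" "bar T e \<in> edges T" "bar T e \<noteq> e"
    "bar T (bar T e) = e" "src T (bar T e) = tgt T e" "tgt T (bar T e) = src T e"
  using serre assms unfolding serre_graph_def by metis+

lemma outward_edge: "e \<in> outward \<Longrightarrow> e \<in> edges T"
  by (simp add: outward_def)

lemma outward_depth: "e \<in> outward \<Longrightarrow> depth (tgt T e) = Suc (depth (src T e))"
  by (simp add: outward_def)

text \<open>
  Each geometric edge has exactly one outward orientation.
\<close>

lemma outward_iff_bar: 
  assumes "e \<in> edges T" shows "bar T e \<in> outward \<longleftrightarrow> e \<notin> outward"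
proof -
  have "bar T e \<in> outward \<longleftrightarrow> depth (src T e) = Suc (depth (tgt T e))"
    using edge_facts(3,6,7)[OF assms] by (simp add: outward_def)
  moreover have "e \<in> outward \<longleftrightarrow> depth (tgt T e) = Suc (depth (src T e))"
    using assms by (simp add: outward_def)
  ultimately show ?thesis using depth_edge[OF assms] by linarith
qed

lemma outward_into_ex:
  assumes "t \<in> verts T" "t \<noteq> root"
  obtains e where "e \<in> outward" "tgt T e = t"
proof -
  from descending_edge[OF assms] obtain e where e: "e \<in> edges T" "src T e = t"
    "depth t = Suc (depth (tgt T e))" by blast
  show ?thesis
    by (rule that[of "bar T e"]) (use e edge_facts[OF e(1)] in \<open>auto simp: outward_def\<close>)
qed

lemma outward_into_unique:
  assumes "e \<in> outward" "f \<in> outward" "tgt T e = tgt T f"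
  shows "e = f"
proof -
  have e: "e \<in> edges T" "f \<in> edges T" using assms by (auto simp: outward_def)
  have "tgt T e \<noteq> root" using assms(1) depth_root by (auto simp: outward_def)
  from descending_edge[OF edge_facts(2)[OF e(1)] this] have "bar T e = bar T f"
    using assms edge_facts[OF e(1)] edge_facts[OF e(2)] by (auto simp: outward_def)
  then show ?thesis using edge_facts(5) e by metis
qed

text \<open>
  Every vertex is reached from the root by outward edges, since the depth decreases along descending edges.
\<close>

lemma tree_induct [consumes 1, case_names root step]:
  assumes "t \<in> verts T" and "P root"
    and "\<And>e. e \<in> outward \<Longrightarrow> P (src T e) \<Longrightarrow> P (tgt T e)"
  shows "P t"
  using assms(1)
proof (induction "depth t" arbitrary: t rule: less_induct)
  case less
  show ?case
  proof (cases "t = root")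
    case False
    from outward_into_ex[OF less.prems this] obtain e where e: "e \<in> outward" "tgt T e = t" .
    then have "P (src T e)"
      using less.hyps[of "src T e"] edge_facts(1)[of e] by (auto simp: outward_def)
    then show ?thesis using assms(3) e by blast
  qed (use assms(2) in simp)
qed

inductive on_geodesic :: "'e \<Rightarrow> 'v \<Rightarrow> bool" where
  last: "e \<in> outward \<Longrightarrow> on_geodesic e (tgt T e)"
| further: "f \<in> outward \<Longrightarrow> on_geodesic e (src T f) \<Longrightarrow> on_geodesic e (tgt T f)"

definition geodesic :: "'v \<Rightarrow> 'e set" where
  "geodesic t = {e. on_geodesic e t}"

lemma on_geodesicD: "on_geodesic e t \<Longrightarrow> e \<in> outward \<and> depth (tgt T e) \<le> depth t"
  by (induction rule: on_geodesic.induct) (auto simp: outward_def)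

lemma geodesic_root: "geodesic root = {}"
proof -
  have False if "on_geodesic e root" for e
    using on_geodesicD[OF that] depth_root outward_depth[of e] by simp
  then show ?thesis by (auto simp: geodesic_def)
qed

lemma geodesic_tgt:
  assumes "e \<in> outward" shows "geodesic (tgt T e) = insert e (geodesic (src T e))"
proof -
  have "f = e \<or> on_geodesic f (src T e)" if "on_geodesic f (tgt T e)" for f
    using that
  proof cases
    case last
    then show ?thesis using outward_into_unique[OF _ assms] by metis
  next
    case (further f')
    then show ?thesis using outward_into_unique[OF _ assms] by metis
  qed
  then show ?thesis
    unfolding geodesic_def using last[OF assms] further[OF assms] by blast
qed

lemma not_geodesic_src: "e \<in> outward \<Longrightarrow> e \<notin> geodesic (src T e)"
  using on_geodesicD[of e "src T e"] by (auto simp: geodesic_def outward_def)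

lemma geodesic_outward: "geodesic t \<subseteq> outward"
  using on_geodesicD by (auto simp: geodesic_def)

lemma finite_geodesic: "t \<in> verts T \<Longrightarrow> finite (geodesic t)"
  by (induction rule: tree_induct) (auto simp: geodesic_root geodesic_tgt)

text \<open>
  The last edge of a geodesic is recovered from its set of edges as the deepest one.
\<close>

lemma geodesic_tgt_inj:
  assumes "e \<in> outward" "f \<in> outward" "geodesic (tgt T e) = geodesic (tgt T f)"
  shows "e = f"
proof (rule ccontr)
  assume "e \<noteq> f"
  have "e \<in> geodesic (tgt T f)" "f \<in> geodesic (tgt T e)"
    using assms geodesic_tgt by (metis insertI1)+
  then have "e \<in> geodesic (src T f)" "f \<in> geodesic (src T e)"
    using assms \<open>e \<noteq> f\<close> geodesic_tgt by (metis insertE)+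
  then have "depth (tgt T e) \<le> depth (src T f)" "depth (tgt T f) \<le> depth (src T e)"
    using on_geodesicD by (auto simp: geodesic_def)
  then show False using assms by (auto simp: outward_def)
qed

end

locale metric_tree = rooted_tree T root depth
  for T :: "('v, 'e, 'z) sgraph_scheme" and root depth +
  fixes l :: "'e \<Rightarrow> real"
  assumes lengths: "length_function T l"
begin

lemma l_pos: "e \<in> edges T \<Longrightarrow> l e > 0"
  and l_bar: "e \<in> edges T \<Longrightarrow> l (bar T e) = l e"
  using lengths by (auto simp: length_function_def)

definition height :: "'v \<Rightarrow> real" where
  "height t = (\<Sum>e\<in>geodesic t. l e)"

lemma height_root: "height root = 0"
  by (simp add: height_def geodesic_root)

lemma height_tgt: "e \<in> outward \<Longrightarrow> height (tgt T e) = height (src T e) + l e"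
  by (simp add: height_def geodesic_tgt not_geodesic_src finite_geodesic edge_facts outward_edge)

text \<open>
  The point at proportion \<open>s\<close> along the outward edge \<open>e\<close> gets the coordinates \<open>l f\<close> on the edges \<open>f\<close> before
  \<open>e\<close> and \<open>s * l e\<close> on \<open>e\<close> itself: for each edge, the length of the part of it that lies between the root and the point.
\<close>

definition edge_coord :: "'e \<Rightarrow> real \<Rightarrow> 'e \<Rightarrow> real" where
  "edge_coord e s = (\<lambda>f. if f = e then s * l e else if f \<in> geodesic (src T e) then l f else 0)"

text \<open>
  An inner point is a class \<open>{(e, s), (bar e, 1 - s)}\<close>; the definite description picks its outward member.
\<close>

definition coord :: "('v, 'e) point \<Rightarrow> 'e \<Rightarrow> real" where
  "coord p = (case p of
     Vertex t \<Rightarrow> (\<lambda>f. if f \<in> geodesic t then l f else 0)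
   | Inner S \<Rightarrow> (let q = (THE q. q \<in> S \<and> fst q \<in> outward) in edge_coord (fst q) (snd q)))"

lemma coord_edge_point:
  assumes "e \<in> outward" shows "coord (edge_point T e s) = edge_coord e s"
proof -
  have "(THE q. q \<in> {(e, s), (bar T e, 1 - s)} \<and> fst q \<in> outward) = (e, s)"
    using assms outward_iff_bar[of e] outward_edge by (intro the_equality) auto
  then have inner: "coord (Inner {(e, s), (bar T e, 1 - s)}) = edge_coord e s"
    by (simp add: coord_def)
  have "coord (Vertex (src T e)) = edge_coord e 0" "coord (Vertex (tgt T e)) = edge_coord e 1"
    using not_geodesic_src[OF assms] geodesic_tgt[OF assms]
    by (simp_all add: coord_def edge_coord_def fun_eq_iff)
  with inner show ?thesis by (simp add: edge_point_def)
qed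

lemma edge_point_bar:
  assumes "e \<in> edges T" shows "edge_point T (bar T e) s = edge_point T e (1 - s)"
  using edge_facts(5-7)[OF assms] by (simp add: edge_point_def insert_commute)

lemma edge_point_realization:
  "e \<in> edges T \<Longrightarrow> 0 \<le> s \<Longrightarrow> s \<le> 1 \<Longrightarrow> edge_point T e s \<in> realization T"
  by (auto simp: realization_def)

text \<open>
  Except for the root, every point lies on a unique outward edge at a positive proportion, so \<open>coord\<close> can be
  computed on all points by \<open>coord_edge_point\<close>.
\<close>

lemma realization_cases:
  assumes "p \<in> realization T"
  obtains (root) "p = Vertex root"
    | (outward) e s where "e \<in> outward" "0 < s" "s \<le> 1" "p = edge_point T e s"
proof -
  note root = that(1) and outward = that(2)
  have vert: thesis if t: "t \<in> verts T" "p = Vertex t" for t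
  proof (cases "t = root")
    case True
    then show ?thesis using t(2) root by simp
  next
    case False
    from outward_into_ex[OF t(1) False] obtain e where e: "e \<in> outward" "tgt T e = t" .
    show ?thesis by (rule outward[of e 1]) (use t e in \<open>auto simp: edge_point_def\<close>)
  qed
  have edge: thesis if e: "e \<in> outward" "0 \<le> s" "s \<le> 1" "p = edge_point T e s" for e s
  proof (cases "s = 0")
    case True
    have "src T e \<in> verts T" using e(1) outward_edge edge_facts(1) by blast
    then show ?thesis using vert[of "src T e"] e True by (simp add: edge_point_def)
  next
    case False
    then show ?thesis using outward[of e s] e by simp
  qed
  from assms consider t where "t \<in> verts T" "p = Vertex t"
    | e s where "e \<in> edges T" "0 \<le> s" "s \<le> 1" "p = edge_point T e s"
    by (auto simp: realization_def)
  then show thesis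
  proof cases
    case (1 t)
    then show thesis by (rule vert)
  next
    case (2 e s)
    show thesis
    proof (cases "e \<in> outward")
      case True
      then show thesis using edge[of e s] 2 by simp
    next
      case False
      then have "bar T e \<in> outward" using 2 outward_iff_bar by simp
      moreover have "edge_point T (bar T e) (1 - s) = p"
        using 2 edge_point_bar[OF 2(1), of "1 - s"] by simp
      ultimately show thesis using edge[of "bar T e" "1 - s"] 2 by simp
    qed
  qed
qed

definition coord_support :: "('v, 'e) point \<Rightarrow> 'e set" where
  "coord_support p = {e. coord p e \<noteq> 0}"

lemma coord_support_root: "coord_support (Vertex root) = {}"
  by (simp add: coord_support_def coord_def geodesic_root)

lemma coord_support_edge_point:
  assumes "e \<in> outward" "0 < s"
  shows "coord_support (edge_point T e s) = geodesic (tgt T e)"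
proof -
  have "edge_coord e s f \<noteq> 0 \<longleftrightarrow> f \<in> insert e (geodesic (src T e))" for f
  proof -
    have "l e > 0" using assms(1) outward_edge l_pos by blast
    moreover have "l f > 0" if "f \<in> geodesic (src T e)"
      using that geodesic_outward outward_edge l_pos by blast
    ultimately show ?thesis using assms(2) by (auto simp: edge_coord_def)
  qed
  then show ?thesis
    unfolding coord_support_def coord_edge_point[OF assms(1)] geodesic_tgt[OF assms(1)] by blast
qed

lemma finite_coord_support: "p \<in> realization T \<Longrightarrow> finite (coord_support p)"
  by (cases p rule: realization_cases)
    (auto simp: coord_support_root coord_support_edge_point finite_geodesic edge_facts outward_edge)

lemma coord_inj:
  assumes "p \<in> realization T" "q \<in> realization T" "coord p = coord q"
  shows "p = q"
proof -
  have S: "coord_support p = coord_support q" using assms(3) by (simp add: coord_support_def)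
  show ?thesis
    using assms(1)
  proof (cases rule: realization_cases)
    case root
    show ?thesis using assms(2)
      by (cases rule: realization_cases)
        (use root S in \<open>auto simp: coord_support_root coord_support_edge_point geodesic_tgt\<close>)
  next
    case (outward e s)
    show ?thesis using assms(2)
    proof (cases rule: realization_cases)
      case root
      then show ?thesis
        using outward S by (auto simp: coord_support_root coord_support_edge_point geodesic_tgt)
    next
      case o2: (outward f t)
      have ef: "e = f"
        using geodesic_tgt_inj S outward o2 by (auto simp: coord_support_edge_point)
      have "edge_coord e s e = edge_coord f t e"
        using assms(3) outward o2 by (simp add: coord_edge_point)
      then have "s = t" using ef l_pos[of e] outward_edge[OF outward(1)] by (simp add: edge_coord_def)
      then show ?thesis using ef outward o2 by simp
    qed
  qed
qed

text \<open>
  The tree metric, realized through the coordinates inside an \<open>l\<^sup>1\<close> space over the edges. The triangle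
  inequality is then inherited, while a definition by shortest paths would require computing meets of geodesics.
\<close>

definition l1_dist :: "('v, 'e) point \<Rightarrow> ('v, 'e) point \<Rightarrow> real" where
  "l1_dist p q = (if p \<in> realization T \<and> q \<in> realization T
     then \<Sum>e\<in>coord_support p \<union> coord_support q. \<bar>coord p e - coord q e\<bar> else 0)"

lemma l1_dist_superset:
  assumes "p \<in> realization T" "q \<in> realization T" "finite U"
    "coord_support p \<subseteq> U" "coord_support q \<subseteq> U"
  shows "l1_dist p q = (\<Sum>e\<in>U. \<bar>coord p e - coord q e\<bar>)"
proof -
  have "(\<Sum>e\<in>coord_support p \<union> coord_support q. \<bar>coord p e - coord q e\<bar>) =
      (\<Sum>e\<in>U. \<bar>coord p e - coord q e\<bar>)"
    by (rule sum.mono_neutral_left) (use assms in \<open>auto simp: coord_support_def\<close>)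
  then show ?thesis using assms by (simp add: l1_dist_def)
qed

lemma Metric_space_l1_dist: "Metric_space (realization T) l1_dist"
proof
  fix x y :: "('v, 'e) point"
  show "0 \<le> l1_dist x y" by (simp add: l1_dist_def sum_nonneg)
  show "l1_dist x y = l1_dist y x"
    by (auto simp: l1_dist_def Un_commute abs_minus_commute intro!: sum.cong)
next
  fix x y assume xy: "x \<in> realization T" "y \<in> realization T"
  show "l1_dist x y = 0 \<longleftrightarrow> x = y"
  proof
    assume "l1_dist x y = 0"
    then have "\<forall>e\<in>coord_support x \<union> coord_support y. coord x e = coord y e"
      using xy finite_coord_support by (simp add: l1_dist_def sum_nonneg_eq_0_iff)
    moreover have "coord x e = coord y e" if "e \<notin> coord_support x \<union> coord_support y" for e
      using that by (simp add: coord_support_def)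
    ultimately have "coord x = coord y" by blast
    then show "x = y" using coord_inj xy by blast
  qed (simp add: l1_dist_def)
next
  fix x y z assume xyz: "x \<in> realization T" "y \<in> realization T" "z \<in> realization T"
  let ?U = "coord_support x \<union> coord_support y \<union> coord_support z"
  have fin: "finite ?U" using finite_coord_support xyz by blast
  have "(\<Sum>e\<in>?U. \<bar>coord x e - coord z e\<bar>) \<le> (\<Sum>e\<in>?U. \<bar>coord x e - coord y e\<bar> + \<bar>coord y e - coord z e\<bar>)"
    by (rule sum_mono) linarith
  then show "l1_dist x z \<le> l1_dist x y + l1_dist y z"
    using l1_dist_superset[OF _ _ fin] xyz by (simp add: sum.distrib le_supI1)
qed

lemma l1_dist_edge:
  assumes "e \<in> outward" "0 \<le> s" "s \<le> 1" "0 \<le> t" "t \<le> 1"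
  shows "l1_dist (edge_point T e s) (edge_point T e t) = l e * \<bar>s - t\<bar>"
proof -
  have e: "e \<in> edges T" using assms outward_edge by blast
  have sub: "coord_support (edge_point T e r) \<subseteq> geodesic (tgt T e)" for r
    using assms(1) by (auto simp: coord_support_def coord_edge_point edge_coord_def geodesic_tgt split: if_splits)
  have fin: "finite (geodesic (tgt T e))" using finite_geodesic edge_facts e by blast
  have "l1_dist (edge_point T e s) (edge_point T e t) =
     (\<Sum>f\<in>geodesic (tgt T e). \<bar>edge_coord e s f - edge_coord e t f\<bar>)"
    using l1_dist_superset[OF _ _ fin sub sub] edge_point_realization e assms
    by (simp add: coord_edge_point)
  also have "\<dots> = (\<Sum>f\<in>{e}. \<bar>edge_coord e s f - edge_coord e t f\<bar>)"
    by (rule sum.mono_neutral_right) (use fin assms in \<open>auto simp: geodesic_tgt edge_coord_def\<close>)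
  also have "\<dots> = l e * \<bar>s - t\<bar>"
    using l_pos[OF e] by (simp add: edge_coord_def abs_mult flip: left_diff_distrib)
  finally show ?thesis .
qed

lemma half_edge_metric_l1_dist: "half_edge_metric T l l1_dist"
  unfolding half_edge_metric_def
proof (intro conjI ballI)
  show "Metric_space (realization T) l1_dist" by (rule Metric_space_l1_dist)
  show "\<forall>p q. p \<notin> realization T \<or> q \<notin> realization T \<longrightarrow> l1_dist p q = 0"
    by (auto simp: l1_dist_def)
  fix e s t assume *: "e \<in> edges T" "s \<in> {0..1/2::real}" "t \<in> {0..1/2::real}"
  show "l1_dist (edge_point T e s) (edge_point T e t) = l e * \<bar>s - t\<bar>"
  proof (cases "e \<in> outward")
    case True
    then show ?thesis using l1_dist_edge * by auto
  next
    case False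
    then have "bar T e \<in> outward" using outward_iff_bar * by blast
    from l1_dist_edge[OF this, of "1 - s" "1 - t"] show ?thesis
      using * l_bar edge_point_bar[OF *(1)] by (simp add: abs_minus_commute)
  qed
qed

definition point_height :: "('v, 'e) point \<Rightarrow> real" where
  "point_height p = l1_dist (Vertex root) p"

lemma root_realization: "Vertex root \<in> realization T"
  by (simp add: realization_def root_vert)

lemma point_height_edge_point:
  assumes "e \<in> outward" "0 \<le> s" "s \<le> 1"
  shows "point_height (edge_point T e s) = height (src T e) + s * l e"
proof -
  have e: "e \<in> edges T" using assms outward_edge by blast
  have sub: "coord_support (edge_point T e s) \<subseteq> insert e (geodesic (src T e))"
    using assms(1) by (auto simp: coord_support_def coord_edge_point edge_coord_def split: if_splits)
  have fin: "finite (geodesic (src T e))" using finite_geodesic edge_facts e by blast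
  have "point_height (edge_point T e s) = (\<Sum>f\<in>insert e (geodesic (src T e)). \<bar>0 - edge_coord e s f\<bar>)"
    unfolding point_height_def
    using l1_dist_superset[OF root_realization _ finite_insert[THEN iffD2, OF fin] _ sub] 
      edge_point_realization e assms geodesic_root
    by (simp add: coord_edge_point coord_support_root) (simp add: coord_def)
  also have "\<dots> = s * l e + (\<Sum>f\<in>geodesic (src T e). \<bar>edge_coord e s f\<bar>)"
    using fin not_geodesic_src[OF assms(1)] l_pos[OF e] assms(2) by (simp add: edge_coord_def)
  also have "(\<Sum>f\<in>geodesic (src T e). \<bar>edge_coord e s f\<bar>) = height (src T e)"
    unfolding height_def
  proof (rule sum.cong)
    fix f assume f: "f \<in> geodesic (src T e)"
    then have "f \<noteq> e" using not_geodesic_src assms by blast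
    moreover have "l f > 0" using f geodesic_outward outward_edge l_pos by blast
    ultimately show "\<bar>edge_coord e s f\<bar> = l f" using f by (simp add: edge_coord_def)
  qed simp
  finally show ?thesis by simp
qed

context
  fixes d assumes d: "half_edge_metric T l d"
begin

interpretation M: Metric_space "realization T" d
  using d by (simp add: half_edge_metric_def)

text \<open>
  Half-edge metrics are prescribed on half-edges only; across the midpoint the triangle inequality still bounds the
  distance from the source by the length travelled.
\<close>

lemma half_edge_metric_edge_le:
  assumes e: "e \<in> edges T" and s: "0 \<le> s" "s \<le> 1"
  shows "d (edge_point T e 0) (edge_point T e s) \<le> s * l e"
proof -
  have half: "d (edge_point T f s) (edge_point T f t) = l f * \<bar>s - t\<bar>"
    if "f \<in> edges T" "s \<in> {0..1/2}" "t \<in> {0..1/2}" for f s t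
    using d that by (simp add: half_edge_metric_def)
  show ?thesis
  proof (cases "s \<le> 1/2")
    case True
    then show ?thesis using half[OF e, of 0 s] s by simp
  next
    case False
    have "d (edge_point T e (1/2)) (edge_point T e s) = l e * \<bar>1/2 - (1 - s)\<bar>"
      using half[OF edge_facts(3)[OF e], of "1/2" "1 - s"] False s
      by (simp add: edge_point_bar[OF e] l_bar[OF e])
    moreover have "d (edge_point T e 0) (edge_point T e (1/2)) = l e * (1/2)"
      using half[OF e, of 0 "1/2"] by simp
    moreover have "d (edge_point T e 0) (edge_point T e s) \<le>
        d (edge_point T e 0) (edge_point T e (1/2)) + d (edge_point T e (1/2)) (edge_point T e s)"
      using edge_point_realization e s by (intro M.triangle) auto
    ultimately show ?thesis using False by (simp add: algebra_simps)
  qed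
qed

lemma half_edge_metric_vertex_le: "t \<in> verts T \<Longrightarrow> d (Vertex root) (Vertex t) \<le> height t"
proof (induction rule: tree_induct)
  case root
  then show ?case using root_realization by (simp add: height_root)
next
  case (step e)
  have e: "e \<in> edges T" using step outward_edge by blast
  have "d (Vertex root) (Vertex (tgt T e)) \<le>
      d (Vertex root) (Vertex (src T e)) + d (Vertex (src T e)) (Vertex (tgt T e))"
    using edge_facts[OF e] root_realization by (intro M.triangle) (auto simp: realization_def)
  also have "d (Vertex (src T e)) (Vertex (tgt T e)) \<le> l e"
    using half_edge_metric_edge_le[OF e, of 1] by (simp add: edge_point_def)
  finally show ?case using step height_tgt by simp
qed

lemma half_edge_metric_root_le:
  assumes "p \<in> realization T"
  shows "d (Vertex root) p \<le> point_height p"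
  using assms
proof (cases rule: realization_cases)
  case root
  then show ?thesis using M.nonneg M.zero root_realization Metric_space_l1_dist
    by (simp add: point_height_def Metric_space.mdist_zero)
next
  case (outward e s)
  have e: "e \<in> edges T" using outward outward_edge by blast
  have "d (Vertex root) p \<le> d (Vertex root) (edge_point T e 0) + d (edge_point T e 0) p"
    using edge_point_realization e root_realization assms by (intro M.triangle) auto
  also have "\<dots> \<le> height (src T e) + s * l e"
    using half_edge_metric_vertex_le[OF edge_facts(1)[OF e]] half_edge_metric_edge_le[OF e, of s] outward
    by (simp add: edge_point_def)
  finally show ?thesis using point_height_edge_point outward by simp
qed

lemma half_edge_metric_le:
  assumes "p \<in> realization T" "q \<in> realization T"
  shows "d p q \<le> point_height p + point_height q"
proof -
  have "d p q \<le> d p (Vertex root) + d (Vertex root) q"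
    using assms root_realization by (intro M.triangle)
  then show ?thesis using half_edge_metric_root_le assms M.commute
    by (smt (verit, best))
qed

end

text \<open>
  A pointwise supremum of metrics with the same prescribed values on half-edges is again such a metric, once it is
  finite. Its finiteness comes from comparing with the paths through the root, so the supremum is the greatest
  half-edge metric; its distance to the root is pinned down between \<open>l1_dist\<close> and those paths.
\<close>

definition sup_dist :: "('v, 'e) point \<Rightarrow> ('v, 'e) point \<Rightarrow> real" where
  "sup_dist p q = (SUP d\<in>{d. half_edge_metric T l d}. d p q)"

lemma bdd_above_half_edge_metrics: "bdd_above ((\<lambda>d. d p q) ` {d. half_edge_metric T l d})"
proof (cases "p \<in> realization T \<and> q \<in> realization T")
  case True
  then show ?thesis using half_edge_metric_le by (intro bdd_aboveI2) auto
next
  case False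
  then show ?thesis by (intro bdd_aboveI2[where M = 0]) (auto simp: half_edge_metric_def)
qed

lemma le_sup_dist: "half_edge_metric T l d \<Longrightarrow> d p q \<le> sup_dist p q"
  unfolding sup_dist_def by (rule cSUP_upper) (auto simp: bdd_above_half_edge_metrics)

lemma sup_dist_le: "(\<And>d. half_edge_metric T l d \<Longrightarrow> d p q \<le> c) \<Longrightarrow> sup_dist p q \<le> c"
  unfolding sup_dist_def by (rule cSUP_least) (use half_edge_metric_l1_dist in auto)

lemma sup_dist_const: 
  "(\<And>d. half_edge_metric T l d \<Longrightarrow> d p q = c) \<Longrightarrow> sup_dist p q = c"
  by (metis half_edge_metric_l1_dist le_sup_dist sup_dist_le order_antisym order_refl)

lemma half_edge_metric_sup_dist: "half_edge_metric T l sup_dist"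
  unfolding half_edge_metric_def
proof (intro conjI ballI)
  have hm: "Metric_space (realization T) d" if "half_edge_metric T l d" for d
    using that by (simp add: half_edge_metric_def)
  show "Metric_space (realization T) sup_dist"
  proof
    fix x y :: "('v, 'e) point"
    show "0 \<le> sup_dist x y"
      using le_sup_dist[OF half_edge_metric_l1_dist, of x y] Metric_space.nonneg[OF Metric_space_l1_dist, of x y] by linarith
    show "sup_dist x y = sup_dist y x"
      unfolding sup_dist_def
      by (rule SUP_cong[OF refl]) (rule Metric_space.commute[OF hm], simp)
  next
    fix x y assume xy: "x \<in> realization T" "y \<in> realization T"
    show "sup_dist x y = 0 \<longleftrightarrow> x = y"
    proof
      assume "sup_dist x y = 0"
      then have "l1_dist x y = 0"
        using le_sup_dist[OF half_edge_metric_l1_dist, of x y] Metric_space.nonneg[OF Metric_space_l1_dist, of x y] by linarith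
      then show "x = y" using Metric_space.zero[OF Metric_space_l1_dist xy] by simp
    next
      assume "x = y"
      then show "sup_dist x y = 0"
      proof (intro sup_dist_const)
        fix d assume "half_edge_metric T l d"
        from Metric_space.zero[OF hm[OF this] xy] show "d x y = 0" using \<open>x = y\<close> by blast
      qed
    qed
  next
    fix x y z assume xyz: "x \<in> realization T" "y \<in> realization T" "z \<in> realization T"
    show "sup_dist x z \<le> sup_dist x y + sup_dist y z"
    proof (rule sup_dist_le)
      fix d assume d: "half_edge_metric T l d"
      have "d x z \<le> d x y + d y z" using Metric_space.triangle[OF hm[OF d] xyz] .
      then show "d x z \<le> sup_dist x y + sup_dist y z"
        using le_sup_dist[OF d, of x y] le_sup_dist[OF d, of y z] by linarith
    qed
  qed
  show "\<forall>p q. p \<notin> realization T \<or> q \<notin> realization T \<longrightarrow> sup_dist p q = 0"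
    by (auto intro!: sup_dist_const simp: half_edge_metric_def)
  fix e s t assume "e \<in> edges T" "s \<in> {0..1/2::real}" "t \<in> {0..1/2::real}"
  then show "sup_dist (edge_point T e s) (edge_point T e t) = l e * \<bar>s - t\<bar>"
    by (intro sup_dist_const) (auto simp: half_edge_metric_def)
qed

lemma length_dist_eq_sup_dist: "length_dist T l = sup_dist"
  unfolding length_dist_def
  by (rule Greatest_equality) (auto simp: half_edge_metric_sup_dist le_fun_def le_sup_dist)

lemma length_dist_root:
  assumes "p \<in> realization T" shows "length_dist T l (Vertex root) p = point_height p"
  unfolding length_dist_eq_sup_dist
  by (intro order_antisym sup_dist_le)
    (use le_sup_dist[OF half_edge_metric_l1_dist] half_edge_metric_root_le[OF _ assms] in
      \<open>auto simp: point_height_def\<close>)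

definition root_ball :: "real \<Rightarrow> ('v, 'e) point set" where
  "root_ball r = Metric_space.mcball (realization T) (length_dist T l) (Vertex root) r"

lemma root_ball_eq: "root_ball r = {p \<in> realization T. point_height p \<le> r}"
proof -
  interpret Metric_space "realization T" "length_dist T l"
    using half_edge_metric_sup_dist by (simp add: half_edge_metric_def length_dist_eq_sup_dist)
  show ?thesis unfolding root_ball_def using length_dist_root root_realization
    by (auto simp: mcball_def)
qed

definition ball_fraction :: "real \<Rightarrow> 'e \<Rightarrow> real" where
  "ball_fraction r e = measure lebesgue {s \<in> {0..1}. edge_point T e s \<in> root_ball r}"

lemma edge_in_ball:
  assumes "e \<in> outward" "0 \<le> s" "s \<le> 1"
  shows "edge_point T e s \<in> root_ball r \<longleftrightarrow> height (src T e) + s * l e \<le> r"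
  using assms edge_point_realization[of e s] outward_edge by (auto simp: root_ball_eq point_height_edge_point)

end

section \<open>Volume of balls in a tree\<close>

locale bounded_metric_tree = metric_tree T root depth l
  for T :: "('v, 'e, 'z) sgraph_scheme" and root depth l +
  fixes lmin lmax :: real
  assumes lmin_pos: "0 < lmin"
    and lmin_le: "e \<in> edges T \<Longrightarrow> lmin \<le> l e"
    and le_lmax: "e \<in> edges T \<Longrightarrow> l e \<le> lmax"
    and locally_finite: "t \<in> verts T \<Longrightarrow> finite {e \<in> edges T. src T e = t}"
begin

lemma finite_outward_depth_le: "finite {e \<in> outward. depth (tgt T e) \<le> n}"
proof (induction n)
  case 0
  then show ?case using outward_depth by (auto intro: finite_subset[of _ "{}"])
next
  case (Suc n)
  let ?S = "insert root (tgt T ` {e \<in> outward. depth (tgt T e) \<le> n})"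
  have "{e \<in> outward. depth (tgt T e) \<le> Suc n} \<subseteq> (\<Union>t\<in>?S. {e \<in> edges T. src T e = t})"
  proof
    fix e assume "e \<in> {e \<in> outward. depth (tgt T e) \<le> Suc n}"
    then have e: "e \<in> outward" "depth (src T e) \<le> n" using outward_depth[of e] by auto
    have "src T e \<in> ?S"
    proof (cases "src T e = root")
      case False
      then obtain f where "f \<in> outward" "tgt T f = src T e"
        using outward_into_ex edge_facts(1) outward_edge e(1) by metis
      then show ?thesis using e by (auto intro!: image_eqI[of _ _ f])
    qed simp
    then show "e \<in> (\<Union>t\<in>?S. {e \<in> edges T. src T e = t})" using e outward_edge by auto
  qed
  moreover have "finite (\<Union>t\<in>?S. {e \<in> edges T. src T e = t})"
    using Suc locally_finite root_vert edge_facts(2) outward_edge by auto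
  ultimately show ?case by (rule finite_subset)
qed

lemma depth_le_height: "t \<in> verts T \<Longrightarrow> lmin * depth t \<le> height t"
proof (induction rule: tree_induct)
  case root
  then show ?case by (simp add: depth_root height_root)
next
  case (step e)
  then show ?case
    using lmin_le[of e] outward_edge[of e] outward_depth[of e] height_tgt[of e]
    by (simp add: algebra_simps)
qed

text \<open>
  The set whose cardinality measures the volume of balls up to bounded factors.
\<close>

definition near :: "real \<Rightarrow> 'e set" where
  "near r = {e \<in> outward. height (tgt T e) \<le> r}"

lemma finite_near: "finite (near r)"
proof -
  have "depth (tgt T e) \<le> nat \<lfloor>r / lmin\<rfloor>" if "e \<in> near r" for e
  proof -
    have "tgt T e \<in> verts T" "height (tgt T e) \<le> r"
      using that edge_facts(2) outward_edge unfolding near_def by blast+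
    with depth_le_height[of "tgt T e"] have "lmin * depth (tgt T e) \<le> r" by linarith
    then have "real (depth (tgt T e)) \<le> r / lmin"
      using lmin_pos by (simp only: pos_le_divide_eq mult.commute)
    then show ?thesis by (rule le_nat_floor)
  qed
  then have "near r \<subseteq> {e \<in> outward. depth (tgt T e) \<le> nat \<lfloor>r / lmin\<rfloor>}"
    unfolding near_def by blast
  then show ?thesis by (rule finite_subset[OF _ finite_outward_depth_le])
qed

lemma near_src_le: "{e. e \<in> outward \<and> height (src T e) \<le> r} \<subseteq> near (r + lmax)"
proof
  fix e assume "e \<in> {e. e \<in> outward \<and> height (src T e) \<le> r}"
  then have "e \<in> outward" "height (src T e) \<le> r" by auto
  with height_tgt[of e] le_lmax[of e] outward_edge[of e] show "e \<in> near (r + lmax)"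
    by (simp add: near_def)
qed

text \<open>
  Along an outward edge the points of the ball form an initial segment, along its reverse a final one.
\<close>

lemma ball_fraction_outward:
  assumes "e \<in> outward"
  shows "ball_fraction r e = max 0 (min 1 ((r - height (src T e)) / l e))" (is "_ = max 0 (min 1 ?c)")
    and "ball_fraction r (bar T e) = max 0 (min 1 ((r - height (src T e)) / l e))"
proof -
  have e: "e \<in> edges T" using assms outward_edge by blast
  have iff: "edge_point T e s \<in> root_ball r \<longleftrightarrow> s \<le> ?c" if "0 \<le> s" "s \<le> 1" for s
    using edge_in_ball[OF assms that] l_pos[OF e] by (simp add: field_simps)
  have "{s \<in> {0..1}. edge_point T e s \<in> root_ball r} = {0..min 1 ?c}" 
    using iff by auto
  then show "ball_fraction r e = max 0 (min 1 ?c)"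
    by (simp add: ball_fraction_def max_def)
  have "{s \<in> {0..1}. edge_point T (bar T e) s \<in> root_ball r} = {max 0 (1 - ?c)..1}"
    using iff[of "1 - s" for s] by (auto simp: edge_point_bar[OF e])
  then show "ball_fraction r (bar T e) = max 0 (min 1 ?c)"
    by (simp add: ball_fraction_def max_def min_def)
qed

text \<open>
  Both orientations of an edge contribute equally, which absorbs the factor \<open>1/2\<close> in \<open>total_length\<close>; the infinite
  sum has only finitely many nonzero terms.
\<close>

lemma total_length_root_ball:
  "total_length T l (root_ball r) =
     (\<Sum>e | e \<in> outward \<and> height (src T e) \<le> r. l e * max 0 (min 1 ((r - height (src T e)) / l e)))"
proof -
  let ?E = "{e. e \<in> outward \<and> height (src T e) \<le> r}"
  let ?g = "\<lambda>e. l e * ball_fraction r e"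
  have fin: "finite ?E" by (rule finite_subset[OF near_src_le finite_near])
  have zero: "?g e = 0" if "e \<in> edges T - (?E \<union> bar T ` ?E)" for e
  proof (cases "e \<in> outward")
    case True
    then have "height (src T e) > r" using that by auto
    then have "(r - height (src T e)) / l e < 0" using l_pos[of e] that by (simp add: divide_neg_pos)
    then show ?thesis using ball_fraction_outward(1)[OF True, of r] by simp
  next
    case False
    have "e \<in> edges T" using that by blast
    with False have b: "bar T e \<in> outward" "bar T (bar T e) = e"
      using outward_iff_bar edge_facts(5) by blast+
    have "bar T e \<notin> ?E"
    proof
      assume "bar T e \<in> ?E"
      then have "bar T (bar T e) \<in> bar T ` ?E" by (rule imageI)
      then show False using that b(2) by simp
    qed
    then have "height (src T (bar T e)) > r" using b by auto
    then have "(r - height (src T (bar T e))) / l (bar T e) < 0"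
      using l_pos[of "bar T e"] b(1) outward_edge by (simp add: divide_neg_pos)
    then show ?thesis using ball_fraction_outward(2)[OF b(1), of r] b(2) by simp
  qed
  have "(\<Sum>\<^sub>\<infinity>e\<in>edges T. ?g e) = (\<Sum>\<^sub>\<infinity>e\<in>?E \<union> bar T ` ?E. ?g e)"
    by (rule infsum_cong_neutral) (use zero outward_edge edge_facts(3) in auto)
  also have "\<dots> = (\<Sum>e\<in>?E \<union> bar T ` ?E. ?g e)"
    using fin by (intro infsum_finite) simp
  also have "\<dots> = sum ?g ?E + sum ?g (bar T ` ?E)"
    using fin outward_iff_bar outward_edge by (intro sum.union_disjoint) auto
  also have "sum ?g (bar T ` ?E) = sum (?g \<circ> bar T) ?E"
    by (intro sum.reindex) (metis (mono_tags, lifting) inj_onI edge_facts(5) mem_Collect_eq outward_edge)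
  also have "sum (?g \<circ> bar T) ?E = sum ?g ?E"
    using ball_fraction_outward l_bar outward_edge by (intro sum.cong) auto
  finally have "total_length T l (root_ball r) = sum ?g ?E"
    by (simp add: total_length_def ball_fraction_def)
  also have "\<dots> = (\<Sum>e\<in>?E. l e * max 0 (min 1 ((r - height (src T e)) / l e)))"
    using ball_fraction_outward(1) by (intro sum.cong) auto
  finally show ?thesis .
qed

lemma ball_length_le: "total_length T l (root_ball r) \<le> lmax * card (near (r + lmax))"
proof -
  let ?E = "{e. e \<in> outward \<and> height (src T e) \<le> r}"
  have nn: "0 < l e" "l e \<le> lmax" if "e \<in> near s" for e s
    using that l_pos le_lmax outward_edge by (auto simp: near_def)
  have "total_length T l (root_ball r) \<le> (\<Sum>e\<in>?E. lmax)"
    unfolding total_length_root_ball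
  proof (rule sum_mono)
    fix e assume "e \<in> ?E"
    then have e: "0 < l e" "l e \<le> lmax" using nn near_src_le by blast+
    have "l e * max 0 (min 1 ((r - height (src T e)) / l e)) \<le> l e * 1"
      using e by (intro mult_left_mono) auto
    then show "l e * max 0 (min 1 ((r - height (src T e)) / l e)) \<le> lmax" using e by linarith
  qed
  also have "\<dots> \<le> (\<Sum>e\<in>near (r + lmax). lmax)"
  proof (rule sum_mono2[OF finite_near near_src_le])
    fix e assume "e \<in> near (r + lmax) - ?E"
    then show "0 \<le> lmax" using nn[of e "r + lmax"] by simp
  qed
  finally show ?thesis by (simp add: mult.commute)
qed

lemma ball_length_ge: "lmin * card (near r) \<le> total_length T l (root_ball r)"
proof -
  let ?E = "{e. e \<in> outward \<and> height (src T e) \<le> r}"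
  have nn: "0 < l e" "lmin \<le> l e" if "e \<in> outward" for e
    using that l_pos lmin_le outward_edge by auto
  have sub: "near r \<subseteq> ?E"
  proof
    fix e assume "e \<in> near r"
    then have "e \<in> outward" "height (src T e) + l e \<le> r" using height_tgt by (auto simp: near_def)
    with nn(1)[of e] show "e \<in> ?E" by simp
  qed
  have "(\<Sum>e\<in>near r. lmin) \<le> (\<Sum>e\<in>near r. l e * max 0 (min 1 ((r - height (src T e)) / l e)))"
  proof (rule sum_mono)
    fix e assume "e \<in> near r"
    then have e: "e \<in> outward" "height (src T e) + l e \<le> r" using height_tgt by (auto simp: near_def)
    have "1 \<le> (r - height (src T e)) / l e" using nn(1)[OF e(1)] e(2) by (simp add: le_divide_eq)
    then have "max 0 (min 1 ((r - height (src T e)) / l e)) = 1" by (simp add: max_def min_def)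
    then show "lmin \<le> l e * max 0 (min 1 ((r - height (src T e)) / l e))"
      using nn(2)[OF e(1)] by (simp only: mult_1_right)
  qed
  also have "\<dots> \<le> (\<Sum>e\<in>?E. l e * max 0 (min 1 ((r - height (src T e)) / l e)))"
  proof (rule sum_mono2)
    show "finite ?E" by (rule finite_subset[OF near_src_le finite_near])
    show "near r \<subseteq> ?E" by (rule sub)
    fix e assume "e \<in> ?E - near r"
    then have "0 < l e" using nn(1) by blast
    then show "0 \<le> l e * max 0 (min 1 ((r - height (src T e)) / l e))" by simp
  qed
  also have "\<dots> = total_length T l (root_ball r)" by (rule total_length_root_ball[symmetric])
  also have "(\<Sum>e\<in>near r. lmin) = lmin * card (near r)" by (simp only: sum_constant mult.commute)
  finally show ?thesis .
qed

end

section \<open>Normal forms in the fundamental groupoid\<close>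

locale graph_of_groups_nf =
  fixes G :: "('v, 'e, 'g, 'h) gog"
  assumes gog: "graph_of_groups G"
begin

lemma edge_simps:
  assumes "e \<in> edges G"
  shows "src G e \<in> verts G" "tgt G e \<in> verts G" "bar G e \<in> edges G" "bar G e \<noteq> e"
    "bar G (bar G e) = e" "src G (bar G e) = tgt G e" "tgt G (bar G e) = src G e"
    "egrp G (bar G e) = egrp G e" "group (egrp G e)"
  using gog assms unfolding graph_of_groups_def serre_graph_def by metis+

lemma vertex_group: "x \<in> verts G \<Longrightarrow> group (vgrp G x)"
  using gog by (simp add: graph_of_groups_def)

lemma emb_hom:
  assumes "e \<in> edges G"
  shows "group_hom (egrp G e) (vgrp G (src G e)) (emb G e)"
    and "inj_on (emb G e) (carrier (egrp G e))"
proof -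
  have "emb G e \<in> mon (egrp G e) (vgrp G (src G e))"
    using gog assms by (simp add: graph_of_groups_def)
  then show "group_hom (egrp G e) (vgrp G (src G e)) (emb G e)"
    "inj_on (emb G e) (carrier (egrp G e))"
    using assms edge_simps(1,9) vertex_group
    by (auto simp: mon_def group_hom_def group_hom_axioms_def)
qed

abbreviation vmult ("_ \<cdot>\<^bsub>_\<^esub> _" [70, 0, 71] 70) where "g \<cdot>\<^bsub>x\<^esub> h \<equiv> g \<otimes>\<^bsub>vgrp G x\<^esub> h"
abbreviation vone where "vone x \<equiv> \<one>\<^bsub>vgrp G x\<^esub>"
abbreviation Vc where "Vc x \<equiv> carrier (vgrp G x)"
abbreviation Ec where "Ec e \<equiv> carrier (egrp G e)"

lemma emb_facts:
  assumes "e \<in> edges G"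
  shows "s \<in> Ec e \<Longrightarrow> emb G e s \<in> Vc (src G e)"
    and "s \<in> Ec e \<Longrightarrow> t \<in> Ec e \<Longrightarrow> emb G e (s \<otimes>\<^bsub>egrp G e\<^esub> t) = emb G e s \<cdot>\<^bsub>src G e\<^esub> emb G e t"
proof -
  interpret h: group_hom "egrp G e" "vgrp G (src G e)" "emb G e" using emb_hom assms by blast
  show "s \<in> Ec e \<Longrightarrow> emb G e s \<in> Vc (src G e)" by simp
  show "s \<in> Ec e \<Longrightarrow> t \<in> Ec e \<Longrightarrow> emb G e (s \<otimes>\<^bsub>egrp G e\<^esub> t) = emb G e s \<cdot>\<^bsub>src G e\<^esub> emb G e t" by simp
qed

definition edge_coset :: "'e \<Rightarrow> 'g \<Rightarrow> 'g set" where
  "edge_coset e g = (\<lambda>s. g \<cdot>\<^bsub>src G e\<^esub> emb G e s) ` Ec e"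

text \<open>
  The representative of the left coset of \<open>g\<close> modulo the edge group. It has to be \<open>1\<close> on the edge group itself, so that
  backtracking in a reduced word can be read off from a representative equal to \<open>1\<close>.
\<close>

definition rep :: "'e \<Rightarrow> 'g \<Rightarrow> 'g" where
  "rep e g = (if vone (src G e) \<in> edge_coset e g then vone (src G e)
     else (SOME r. r \<in> edge_coset e g))"

text \<open>
  The unique factorization \<open>g = rep e g * emb e s\<close>, with \<open>s = rest e g\<close>.
\<close>

definition rest :: "'e \<Rightarrow> 'g \<Rightarrow> 'h" where
  "rest e g = (SOME s. s \<in> Ec e \<and> g = rep e g \<cdot>\<^bsub>src G e\<^esub> emb G e s)"

context
  fixes e assumes e: "e \<in> edges G"
begin

interpretation h: group_hom "egrp G e" "vgrp G (src G e)" "emb G e" using emb_hom e by blast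

lemma edge_coset_mult:
  assumes "g \<in> Vc (src G e)" "s \<in> Ec e"
  shows "edge_coset e (g \<cdot>\<^bsub>src G e\<^esub> emb G e s) = edge_coset e g"
proof -
  have "(g \<cdot>\<^bsub>src G e\<^esub> emb G e s) \<cdot>\<^bsub>src G e\<^esub> emb G e t \<in> edge_coset e g" if "t \<in> Ec e" for t
    using assms that by (auto simp: edge_coset_def h.H.m_assoc intro!: image_eqI[of _ _ "s \<otimes>\<^bsub>egrp G e\<^esub> t"])
  moreover have "g \<cdot>\<^bsub>src G e\<^esub> emb G e t \<in> edge_coset e (g \<cdot>\<^bsub>src G e\<^esub> emb G e s)" if "t \<in> Ec e" for t
    unfolding edge_coset_def
  proof (rule image_eqI[of _ _ "inv\<^bsub>egrp G e\<^esub> s \<otimes>\<^bsub>egrp G e\<^esub> t"])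
    have "emb G e s \<cdot>\<^bsub>src G e\<^esub> emb G e (inv\<^bsub>egrp G e\<^esub> s \<otimes>\<^bsub>egrp G e\<^esub> t) = emb G e t"
      using assms that by (metis h.G.inv_closed h.G.m_closed h.G.m_assoc h.G.r_inv h.G.l_one h.hom_mult)
    then show "g \<cdot>\<^bsub>src G e\<^esub> emb G e t =
        g \<cdot>\<^bsub>src G e\<^esub> emb G e s \<cdot>\<^bsub>src G e\<^esub> emb G e (inv\<^bsub>egrp G e\<^esub> s \<otimes>\<^bsub>egrp G e\<^esub> t)"
      using assms that by (simp add: h.H.m_assoc)
  qed (use assms that in simp)
  ultimately show ?thesis unfolding edge_coset_def[of e g] edge_coset_def[of e "_ \<otimes>\<^bsub>_\<^esub> _"] by blast
qed

lemma rep_in_coset: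
  assumes "g \<in> Vc (src G e)" shows "rep e g \<in> edge_coset e g"
proof -
  have "g \<cdot>\<^bsub>src G e\<^esub> emb G e \<one>\<^bsub>egrp G e\<^esub> \<in> edge_coset e g"
    unfolding edge_coset_def by (rule imageI) simp
  then show ?thesis unfolding rep_def by (auto intro: someI)
qed

lemma rep_closed: "g \<in> Vc (src G e) \<Longrightarrow> rep e g \<in> Vc (src G e)"
  using rep_in_coset[of g] by (auto simp: edge_coset_def)

lemma rep_mult:
  "g \<in> Vc (src G e) \<Longrightarrow> s \<in> Ec e \<Longrightarrow> rep e (g \<cdot>\<^bsub>src G e\<^esub> emb G e s) = rep e g"
  by (simp add: rep_def edge_coset_mult)

lemma rep_rest:
  assumes "g \<in> Vc (src G e)"
  shows "rest e g \<in> Ec e" "g = rep e g \<cdot>\<^bsub>src G e\<^esub> emb G e (rest e g)"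
proof -
  obtain s where s: "s \<in> Ec e" "rep e g = g \<cdot>\<^bsub>src G e\<^esub> emb G e s"
    using rep_in_coset[OF assms] by (auto simp: edge_coset_def)
  have "rep e g \<cdot>\<^bsub>src G e\<^esub> emb G e (inv\<^bsub>egrp G e\<^esub> s) = g"
    using s assms by (simp add: h.H.m_assoc)
  then have "\<exists>s. s \<in> Ec e \<and> g = rep e g \<cdot>\<^bsub>src G e\<^esub> emb G e s"
    using s by (metis h.G.inv_closed)
  from someI_ex[OF this] show "rest e g \<in> Ec e" "g = rep e g \<cdot>\<^bsub>src G e\<^esub> emb G e (rest e g)"
    unfolding rest_def by auto
qed

lemma rep_rep: "g \<in> Vc (src G e) \<Longrightarrow> rep e (rep e g) = rep e g"
  using rep_rest[of g] rep_closed[of g] rep_mult by metis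

lemma rep_rest_unique:
  assumes "r \<in> Vc (src G e)" "rep e r = r" "s \<in> Ec e"
  shows "rep e (r \<cdot>\<^bsub>src G e\<^esub> emb G e s) = r" "rest e (r \<cdot>\<^bsub>src G e\<^esub> emb G e s) = s"
proof -
  let ?g = "r \<cdot>\<^bsub>src G e\<^esub> emb G e s"
  show r: "rep e ?g = r" using rep_mult assms by simp
  have g: "?g \<in> Vc (src G e)" using assms by simp
  have "r \<cdot>\<^bsub>src G e\<^esub> emb G e s = r \<cdot>\<^bsub>src G e\<^esub> emb G e (rest e ?g)"
    using rep_rest(2)[OF g] r by simp
  then have "emb G e s = emb G e (rest e ?g)"
    using assms rep_rest(1)[OF g] by simp
  then show "rest e ?g = s"
    using emb_hom(2)[OF e] assms rep_rest(1)[OF g] by (simp add: inj_on_eq_iff)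
qed

lemma rep_one: "rep e (vone (src G e)) = vone (src G e)"
proof -
  have "vone (src G e) = vone (src G e) \<cdot>\<^bsub>src G e\<^esub> emb G e \<one>\<^bsub>egrp G e\<^esub>" by simp
  then have "vone (src G e) \<in> edge_coset e (vone (src G e))"
    unfolding edge_coset_def by (rule image_eqI) simp
  then show ?thesis by (simp add: rep_def)
qed

lemma rep_rest_emb:
  assumes "s \<in> Ec e"
  shows "rep e (emb G e s) = vone (src G e)" "rest e (emb G e s) = s"
  using rep_rest_unique[OF h.H.one_closed rep_one assms] assms by simp_all

lemma rest_mult:
  assumes "g \<in> Vc (src G e)" "s \<in> Ec e"
  shows "rest e (g \<cdot>\<^bsub>src G e\<^esub> emb G e s) = rest e g \<otimes>\<^bsub>egrp G e\<^esub> s"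
proof -
  note r = rep_rest[OF assms(1)] rep_closed[OF assms(1)]
  have "g \<cdot>\<^bsub>src G e\<^esub> emb G e s =
      (rep e g \<cdot>\<^bsub>src G e\<^esub> emb G e (rest e g)) \<cdot>\<^bsub>src G e\<^esub> emb G e s"
    by (rule arg_cong[OF r(2), of "\<lambda>z. z \<cdot>\<^bsub>src G e\<^esub> emb G e s"])
  also have "\<dots> = rep e g \<cdot>\<^bsub>src G e\<^esub> emb G e (rest e g \<otimes>\<^bsub>egrp G e\<^esub> s)"
    using r(1,3) assms by (simp add: h.H.m_assoc)
  finally have *: "g \<cdot>\<^bsub>src G e\<^esub> emb G e s =
    rep e g \<cdot>\<^bsub>src G e\<^esub> emb G e (rest e g \<otimes>\<^bsub>egrp G e\<^esub> s)" .
  show ?thesis unfolding *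
    by (rule rep_rest_unique(2)[OF r(3) rep_rep[OF assms(1)] h.G.m_closed[OF r(1) assms(2)]])
qed

lemma rep_eq_iff:
  assumes "g \<in> Vc (src G e)" "h \<in> Vc (src G e)"
  shows "rep e g = rep e h \<longleftrightarrow> (\<exists>s\<in>Ec e. h = g \<cdot>\<^bsub>src G e\<^esub> emb G e s)"
proof
  assume eq: "rep e g = rep e h"
  let ?s = "inv\<^bsub>egrp G e\<^esub> rest e g \<otimes>\<^bsub>egrp G e\<^esub> rest e h"
  note r = rep_rest(1)[OF assms(1)] rep_rest(1)[OF assms(2)] rep_closed[OF assms(1)]
  have s: "?s \<in> Ec e" using r by simp
  have "rest e g \<otimes>\<^bsub>egrp G e\<^esub> ?s = rest e h" using r by (simp flip: h.G.m_assoc)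
  then have *: "emb G e (rest e g) \<cdot>\<^bsub>src G e\<^esub> emb G e ?s = emb G e (rest e h)"
    using r s h.hom_mult by metis
  have "g \<cdot>\<^bsub>src G e\<^esub> emb G e ?s = rep e g \<cdot>\<^bsub>src G e\<^esub> emb G e (rest e g) \<cdot>\<^bsub>src G e\<^esub> emb G e ?s"
    by (rule arg_cong[OF rep_rest(2)[OF assms(1)], of "\<lambda>z. z \<cdot>\<^bsub>src G e\<^esub> emb G e ?s"])
  also have "\<dots> = rep e g \<cdot>\<^bsub>src G e\<^esub> emb G e (rest e h)"
    unfolding *[symmetric] by (rule h.H.m_assoc) (use r s in simp_all)
  also have "\<dots> = h" unfolding eq by (rule rep_rest(2)[OF assms(2), symmetric])
  finally show "\<exists>s\<in>Ec e. h = g \<cdot>\<^bsub>src G e\<^esub> emb G e s" using s by metis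
next
  assume "\<exists>s\<in>Ec e. h = g \<cdot>\<^bsub>src G e\<^esub> emb G e s"
  then show "rep e g = rep e h" using rep_mult assms by auto
qed

end

text \<open>
  A syllable \<open>(r, e)\<close> after the trail \<open>ps\<close> cancels if it returns along the last edge with trivial representative. The
  head of the list is the last syllable of the word.
\<close>

fun backtracks :: "'g \<Rightarrow> 'e \<Rightarrow> ('g \<times> 'e) list \<Rightarrow> bool" where
  "backtracks r e [] \<longleftrightarrow> False"
| "backtracks r e ((r', f) # ps) \<longleftrightarrow> r = vone (src G e) \<and> e = bar G f"

text \<open>
  The action of letters on normal forms. A state \<open>(ps, g)\<close> stands for the word
  \<open>r_1 e_1 r_2 e_2 ... r_n e_n g\<close> with coset representatives \<open>r_i\<close>, listed from the end. An edge letter splits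
  \<open>g\<close> into a representative and an element of the edge group, moves the latter across the edge, and cancels if the
  result would backtrack. Letting the groupoid act on normal forms is the argument of van der Waerden for their
  uniqueness.
\<close>

fun act :: "('g \<times> 'e) list \<times> 'g \<Rightarrow> ('v, 'e, 'g) letter \<Rightarrow> ('g \<times> 'e) list \<times> 'g" where
  "act (ps, g) (Elt x h) = (ps, g \<cdot>\<^bsub>x\<^esub> h)"
| "act (ps, g) (Edg e) = (if backtracks (rep e g) e ps
     then (tl ps, fst (hd ps) \<cdot>\<^bsub>tgt G e\<^esub> emb G (bar G e) (rest e g))
     else ((rep e g, e) # ps, emb G (bar G e) (rest e g)))"

fun nf :: "'v \<Rightarrow> ('g \<times> 'e) list \<Rightarrow> 'v \<Rightarrow> bool" where
  "nf b [] x \<longleftrightarrow> x = b \<and> b \<in> verts G"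
| "nf b ((r, e) # ps) x \<longleftrightarrow> e \<in> edges G \<and> tgt G e = x \<and> r \<in> Vc (src G e) \<and> rep e r = r \<and>
     nf b ps (src G e) \<and> \<not> backtracks r e ps"

definition valid :: "'v \<Rightarrow> ('g \<times> 'e) list \<times> 'g \<Rightarrow> 'v \<Rightarrow> bool" where
  "valid b st x \<longleftrightarrow> nf b (fst st) x \<and> snd st \<in> Vc x"

lemma nf_verts: "nf b ps x \<Longrightarrow> x \<in> verts G"
  by (cases "(b, ps, x)" rule: nf.cases) (auto simp: edge_simps)

lemma valid_act_Elt: "valid b st x \<Longrightarrow> h \<in> Vc x \<Longrightarrow> valid b (act st (Elt x h)) x"
  using monoid.m_closed[OF group.is_monoid[OF vertex_group[OF nf_verts]], of b "fst st" x "snd st" h]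
  by (cases st) (simp add: valid_def)

lemma backtracksE:
  assumes "backtracks r e ps" "nf b ps (src G e)" "e \<in> edges G"
  obtains r' f qs where "ps = (r', f) # qs" "r = vone (src G e)" "e = bar G f" "f = bar G e"
    "f \<in> edges G" "src G f = tgt G e" "r' \<in> Vc (src G f)" "rep f r' = r'" "nf b qs (src G f)"
    "\<not> backtracks r' f qs"
proof -
  from assms(1) obtain r' f qs where ps: "ps = (r', f) # qs" "r = vone (src G e)" "e = bar G f"
    by (cases "(r, e, ps)" rule: backtracks.cases) auto
  have n: "f \<in> edges G" "r' \<in> Vc (src G f)" "rep f r' = r'" "nf b qs (src G f)"
    "\<not> backtracks r' f qs"
    using assms(2) unfolding ps(1) nf.simps by blast+
  have "f = bar G e" using edge_simps(5)[OF n(1)] ps(3) by simp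
  then have "src G f = tgt G e" using edge_simps(6)[OF assms(3)] by simp
  show ?thesis by (rule that) fact+
qed

lemma act_backtracks:
  assumes "backtracks (rep e g) e ps" "ps = (r', f) # qs"
  shows "act (ps, g) (Edg e) = (qs, r' \<cdot>\<^bsub>tgt G e\<^esub> emb G (bar G e) (rest e g))"
proof -
  have "act (ps, g) (Edg e) = (tl ps, fst (hd ps) \<cdot>\<^bsub>tgt G e\<^esub> emb G (bar G e) (rest e g))"
    using assms(1) by simp
  then show ?thesis by (simp add: assms(2))
qed

lemma valid_act_Edg:
  assumes "valid b st (src G e)" "e \<in> edges G"
  shows "valid b (act st (Edg e)) (tgt G e)"
proof (cases st)
  case (Pair ps g)
  have g: "g \<in> Vc (src G e)" and n: "nf b ps (src G e)" using assms Pair by (auto simp: valid_def)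
  have em: "emb G (bar G e) (rest e g) \<in> Vc (tgt G e)"
    using emb_facts(1)[OF edge_simps(3)[OF assms(2)]] rep_rest(1)[OF assms(2) g] edge_simps[OF assms(2)] by simp
  show ?thesis
  proof (cases "backtracks (rep e g) e ps")
    case True
    obtain r' f qs where *: "ps = (r', f) # qs" "src G f = tgt G e" "r' \<in> Vc (src G f)" "nf b qs (src G f)"
      using backtracksE[OF True n assms(2)] by metis
    have "group (vgrp G (tgt G e))" using vertex_group edge_simps assms by blast
    then have "r' \<cdot>\<^bsub>tgt G e\<^esub> emb G (bar G e) (rest e g) \<in> Vc (tgt G e)"
      using * em by (simp add: group.is_monoid monoid.m_closed)
    then show ?thesis using *(2,4) unfolding Pair act_backtracks[OF True *(1)] valid_def by simp
  next
    case False
    then show ?thesis using em Pair n assms(2) rep_closed[OF assms(2) g] rep_rep[OF assms(2) g]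
      by (simp add: valid_def)
  qed
qed

text \<open>
  Undoing a push is a cancellation; undoing a cancellation is a push, because the state was reduced before.
\<close>

lemma act_cancel:
  assumes "valid b st (src G e)" "e \<in> edges G"
  shows "act (act st (Edg e)) (Edg (bar G e)) = st"
proof (cases st)
  case (Pair ps g)
  have g: "g \<in> Vc (src G e)" and n: "nf b ps (src G e)" using assms Pair by (auto simp: valid_def)
  note r = rep_rest[OF assms(2) g]
  note E = edge_simps[OF assms(2)]
  show ?thesis
  proof (cases "backtracks (rep e g) e ps")
    case True
    obtain r' f qs where *: "ps = (r', f) # qs" "rep e g = vone (src G e)" "e = bar G f" "f = bar G e"
      "f \<in> edges G" "src G f = tgt G e" "r' \<in> Vc (src G f)" "rep f r' = r'" "\<not> backtracks r' f qs"
      using backtracksE[OF True n assms(2)] by metis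
    have s: "rest e g \<in> Ec f" unfolding *(4) E(8) by (rule r(1))
    have grp: "group (vgrp G (src G e))" using vertex_group E(1) by blast
    have "g = vone (src G e) \<cdot>\<^bsub>src G e\<^esub> emb G e (rest e g)" using r(2) unfolding *(2) .
    then have g': "g = emb G e (rest e g)"
      using emb_facts(1)[OF assms(2) r(1)] grp by (simp add: group.is_monoid)
    have "act (act st (Edg e)) (Edg f) = ((r', f) # qs, emb G (bar G f) (rest e g))"
      unfolding Pair act_backtracks[OF True *(1)] *(4)[symmetric] *(6)[symmetric]
      by (simp add: *(9) rep_rest_unique[OF *(5,7,8) s])
    then show ?thesis unfolding Pair *(1) *(4)[symmetric] *(3)[symmetric] g'[symmetric] .
  next
    case False
    have s: "rest e g \<in> Ec (bar G e)" unfolding E(8) by (rule r(1))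
    have "act (act st (Edg e)) (Edg (bar G e)) = (ps, rep e g \<cdot>\<^bsub>src G e\<^esub> emb G e (rest e g))"
      using False by (simp add: Pair E(5-7) rep_rest_emb[OF E(3) s, unfolded E(6)])
    then show ?thesis unfolding Pair r(2)[symmetric] .
  qed
qed

definition run :: "('g \<times> 'e) list \<times> 'g \<Rightarrow> ('v, 'e, 'g) letter list \<Rightarrow> ('g \<times> 'e) list \<times> 'g" where
  "run st w = foldl act st w"

lemma run_simps [simp]: "run st [] = st" "run st (a # w) = run (act st a) w"
  "run st (u @ w) = run (run st u) w"
  by (simp_all add: run_def)

lemma gpath_verts: "gpath G x w y \<Longrightarrow> x \<in> verts G \<and> y \<in> verts G"
proof (induction w arbitrary: x)
  case (Cons l w)
  then show ?case by (cases l) (use edge_simps(1) in auto)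
qed simp

lemma gpath_append: "gpath G x (u @ w) y \<longleftrightarrow> (\<exists>z. gpath G x u z \<and> gpath G z w y)"
proof (induction u arbitrary: x)
  case (Cons l u)
  then show ?case by (cases l) auto
qed (auto dest: gpath_verts)

lemma valid_run: "valid b st x \<Longrightarrow> gpath G x w y \<Longrightarrow> valid b (run st w) y"
proof (induction w arbitrary: st x)
  case (Cons l w)
  show ?case
  proof (cases l)
    case (Elt z g)
    then have "z = x" "g \<in> Vc x" "gpath G x w y" using Cons.prems(2) by auto
    then show ?thesis using Cons.IH[OF valid_act_Elt[OF Cons.prems(1)]] Elt by simp
  next
    case (Edg e)
    then have e: "e \<in> edges G" "src G e = x" "gpath G (tgt G e) w y" using Cons by simp_all
    then have "valid b (act st (Edg e)) (tgt G e)" using Cons.prems valid_act_Edg by blast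
    then show ?thesis using Cons.IH e Edg by simp
  qed
qed simp

text \<open>
  All defining relations act trivially, so homotopic words act in the same way (\<open>run_homotopic\<close>).
\<close>

lemma run_relator:
  assumes "relator G r r'" "gpath G x r y" "valid b st x"
  shows "run st r = run st r'"
  using assms(1)
proof cases
  case (mult z g h)
  obtain ps a where st: "st = (ps, a)" by (cases st)
  have "group (vgrp G x)" using assms gpath_verts vertex_group by blast
  then show ?thesis using mult(1,2) assms(2,3) st
    by (auto simp: valid_def group.is_monoid monoid.m_assoc)
next
  case (unit z)
  obtain ps a where st: "st = (ps, a)" by (cases st)
  have "group (vgrp G x)" using assms gpath_verts vertex_group by blast
  then show ?thesis using unit(1,2) assms(2,3) st by (auto simp: valid_def group.is_monoid)
next
  case (cancel e)
  then show ?thesis using act_cancel[of b st e] assms(2,3) by auto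
next
  case (slide s e)
  obtain ps a where st: "st = (ps, a)" by (cases st)
  have e: "e \<in> edges G" "src G e = x" using slide(1) assms(2) by auto
  have a: "a \<in> Vc (src G e)" "nf b ps (src G e)" using assms st e by (auto simp: valid_def)
  note E = edge_simps[OF e(1)]
  have g: "monoid (vgrp G (tgt G e))" using vertex_group E group.is_monoid by blast
  have f: "emb G (bar G e) s \<in> Vc (tgt G e)" "emb G (bar G e) (rest e a) \<in> Vc (tgt G e)"
    "emb G (bar G e) (rest e a \<otimes>\<^bsub>egrp G e\<^esub> s) =
       emb G (bar G e) (rest e a) \<cdot>\<^bsub>tgt G e\<^esub> emb G (bar G e) s"
    using emb_facts(1,2)[OF E(3)] E slide(3) rep_rest(1)[OF e(1) a(1)] by simp_all
  have *: "rep e (a \<cdot>\<^bsub>x\<^esub> emb G e s) = rep e a" "rest e (a \<cdot>\<^bsub>x\<^esub> emb G e s) = rest e a \<otimes>\<^bsub>egrp G e\<^esub> s"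
    using rep_mult[OF e(1) a(1) slide(3)] rest_mult[OF e(1) a(1) slide(3)] e by simp_all
  show ?thesis
  proof (cases "backtracks (rep e a) e ps")
    case True
    obtain c f' qs where ps: "ps = (c, f') # qs" "c \<in> Vc (tgt G e)"
      using backtracksE[OF True a(2) e(1)] by metis
    have True': "backtracks (rep e (a \<cdot>\<^bsub>x\<^esub> emb G e s)) e ps" unfolding *(1) by (rule True)
    have "run st r = act (ps, a \<cdot>\<^bsub>x\<^esub> emb G e s) (Edg e)" using slide(1) st e(2) by simp
    also have "\<dots> = (qs, c \<cdot>\<^bsub>tgt G e\<^esub> emb G (bar G e) (rest e a \<otimes>\<^bsub>egrp G e\<^esub> s))"
      unfolding act_backtracks[OF True' ps(1)] *(2) by (rule refl)
    also have "\<dots> = act (act (ps, a) (Edg e)) (Elt (tgt G e) (emb G (bar G e) s))"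
      unfolding act_backtracks[OF True ps(1)] f(3) using ps(2) f(1,2) g by (simp add: monoid.m_assoc)
    finally show ?thesis using slide(2) st by simp
  next
    case False
    then show ?thesis using slide(1,2) st e * f by simp
  qed
qed

lemma homotopic_refl [simp]: "homotopic G x y w w"
  by (simp add: homotopic_def)

lemma homotopic_sym: "homotopic G x y w w' \<Longrightarrow> homotopic G x y w' w"
  unfolding homotopic_def by (rule equivclp_sym)

lemma homotopic_trans [trans]:
  "homotopic G x y w w' \<Longrightarrow> homotopic G x y w' w'' \<Longrightarrow> homotopic G x y w w''"
  unfolding homotopic_def by (rule equivclp_trans)

lemma homotopic_relator:
  assumes "relator G r r'" "gpath G x (u @ r @ v) y" "gpath G x (u @ r' @ v) y"
  shows "homotopic G x y (u @ r @ v) (u @ r' @ v)"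
  unfolding homotopic_def by (rule r_into_equivclp) (use assms in blast)

lemma homotopic_induct [consumes 1, case_names refl sym trans relator]:
  assumes "homotopic G x y w w'"
    and "\<And>w. P w w" "\<And>w w'. P w w' \<Longrightarrow> P w' w" "\<And>w w' w''. P w w' \<Longrightarrow> P w' w'' \<Longrightarrow> P w w''"
    and "\<And>u r r' v. relator G r r' \<Longrightarrow> gpath G x (u @ r @ v) y \<Longrightarrow> gpath G x (u @ r' @ v) y \<Longrightarrow>
      P (u @ r @ v) (u @ r' @ v)"
  shows "P w w'"
  using assms(1) unfolding homotopic_def
proof (induction rule: equivclp_induct)
  case base
  show ?case by (rule assms(2))
next
  case (step y z)
  then show ?case using assms(3-5) by blast
qed

lemma homotopic_gpath: "homotopic G x y w w' \<Longrightarrow> gpath G x w y \<longleftrightarrow> gpath G x w' y"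
  by (induction rule: homotopic_induct) auto

lemma homotopic_append:
  assumes "homotopic G x y w w'" "gpath G z u x" "gpath G y v t"
  shows "homotopic G z t (u @ w @ v) (u @ w' @ v)"
  using assms(1)
proof (induction rule: homotopic_induct)
  case (relator u' r r' v')
  then have "gpath G z ((u @ u') @ r @ (v' @ v)) t" "gpath G z ((u @ u') @ r' @ (v' @ v)) t"
    using assms unfolding append_assoc gpath_append by blast+
  from homotopic_relator[OF relator(1) this] show ?case by simp
qed (auto intro: homotopic_sym homotopic_trans)

lemma run_homotopic:
  assumes "homotopic G x y w w'" "valid b st x"
  shows "run st w = run st w'"
  using assms(1)
proof (induction rule: homotopic_induct)
  case (relator u r r' v)
  then obtain z z' where "gpath G x u z" "gpath G z r z'" by (auto simp: gpath_append)
  then have "run (run st u) r = run (run st u) r'"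
    using run_relator[OF relator(1) _ valid_run[OF assms(2)]] by blast
  then show ?case by simp
qed auto

lemma homotopic_append_left:
  "homotopic G x y w w' \<Longrightarrow> gpath G z u x \<Longrightarrow> homotopic G z y (u @ w) (u @ w')"
  if "y \<in> verts G" for y
  using homotopic_append[of x y w w' z u "[]" y] that by simp

lemma homotopic_append_right:
  "homotopic G x y w w' \<Longrightarrow> gpath G y v z \<Longrightarrow> homotopic G x z (w @ v) (w' @ v)"
  if "x \<in> verts G" for x
  using homotopic_append[of x y w w' x "[]" v z] that by simp

lemma homotopic_rewrite:
  assumes "relator G r r'" "gpath G x u z" "gpath G z r z'" "gpath G z r' z'" "gpath G z' v y"
  shows "homotopic G x y (u @ r @ v) (u @ r' @ v)"
  by (rule homotopic_relator) (use assms in \<open>auto simp: gpath_append\<close>)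

fun path_word :: "('g \<times> 'e) list \<Rightarrow> ('v, 'e, 'g) letter list" where
  "path_word [] = []"
| "path_word ((r, e) # ps) = path_word ps @ [Elt (src G e) r, Edg e]"

lemma gpath_path_word: "nf b ps x \<Longrightarrow> gpath G b (path_word ps) x"
proof (induction ps arbitrary: x)
  case (Cons p ps)
  obtain r e where p: "p = (r, e)" by (cases p)
  then have "gpath G b (path_word ps) (src G e)" "e \<in> edges G" "r \<in> Vc (src G e)" "tgt G e = x"
    using Cons by auto
  then show ?case using p edge_simps(1,2) by (auto simp: gpath_append)
qed simp

lemma act_word_Elt:
  assumes "valid b (ps, g) x" "h \<in> Vc x"
  shows "homotopic G b x (path_word ps @ [Elt x g, Elt x h]) (path_word ps @ [Elt x (g \<cdot>\<^bsub>x\<^esub> h)])"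
proof -
  have n: "nf b ps x" "g \<in> Vc x" using assms by (auto simp: valid_def)
  have "group (vgrp G x)" using vertex_group nf_verts n by blast
  then have "g \<cdot>\<^bsub>x\<^esub> h \<in> Vc x" using n assms by (simp add: group.is_monoid monoid.m_closed)
  then show ?thesis
    using homotopic_rewrite[OF relator.mult gpath_path_word[OF n(1)], of x g h x "[]" x] n assms nf_verts
    by auto
qed

text \<open>
  Each step of the action is itself a homotopy: split off the element of the edge group, slide it across the
  edge, and cancel if possible. Hence a word is homotopic to the word of its normal form (\<open>homotopic_run_word\<close>).
\<close>

lemma act_word_Edg:
  assumes v: "valid b (ps, g) (src G e)" and e: "e \<in> edges G" and st: "act (ps, g) (Edg e) = (qs, k)"
  shows "homotopic G b (tgt G e) (path_word ps @ [Elt (src G e) g, Edg e]) (path_word qs @ [Elt (tgt G e) k])"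
proof -
  let ?x = "src G e" and ?y = "tgt G e"
  note E = edge_simps[OF e]
  have n: "nf b ps ?x" "g \<in> Vc ?x" using v by (auto simp: valid_def)
  note P = gpath_path_word[OF n(1)]
  define r s where "r = rep e g" and "s = rest e g"
  define j where "j = emb G (bar G e) s"
  have rs: "r \<in> Vc ?x" "s \<in> Ec e" "g = r \<cdot>\<^bsub>?x\<^esub> emb G e s" "emb G e s \<in> Vc ?x" "j \<in> Vc ?y"
    using rep_closed[OF e n(2)] rep_rest[OF e n(2)] emb_facts(1)[OF e] emb_facts(1)[OF E(3)] E
    by (simp_all add: r_def s_def j_def)
  have "homotopic G b ?y (path_word ps @ [Elt ?x r, Elt ?x (emb G e s)] @ [Edg e])
      (path_word ps @ [Elt ?x (r \<cdot>\<^bsub>?x\<^esub> emb G e s)] @ [Edg e])"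
    by (rule homotopic_rewrite[OF relator.mult P]) (use rs n e E in simp_all)
  from homotopic_sym[OF this]
  have "homotopic G b ?y (path_word ps @ [Elt ?x g, Edg e])
      ((path_word ps @ [Elt ?x r]) @ [Elt ?x (emb G e s), Edg e] @ [])"
    by (simp flip: rs(3))
  also have "homotopic G b ?y \<dots> ((path_word ps @ [Elt ?x r]) @ [Edg e, Elt ?y (emb G (bar G e) s)] @ [])"
    by (rule homotopic_rewrite[OF relator.slide]) (use rs P e E in \<open>auto simp: gpath_append j_def\<close>)
  finally have push: "homotopic G b ?y (path_word ps @ [Elt ?x g, Edg e])
      (path_word ps @ [Elt ?x r, Edg e, Elt ?y j])" by (simp add: j_def)
  show ?thesis
  proof (cases "backtracks r e ps")
    case False
    then have "(qs, k) = ((r, e) # ps, j)" using st by (simp add: r_def s_def j_def)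
    then show ?thesis using push by simp
  next
    case True
    obtain c f ps' where *: "ps = (c, f) # ps'" "r = vone ?x" "e = bar G f" "f = bar G e"
      "f \<in> edges G" "src G f = ?y" "c \<in> Vc (src G f)" "nf b ps' (src G f)"
      using backtracksE[OF True n(1) e] by metis
    have "(qs, k) = (ps', c \<cdot>\<^bsub>?y\<^esub> j)"
      using act_backtracks[OF True[unfolded r_def] *(1)] st by (simp add: s_def j_def)
    then have qk: "qs = ps'" "k = c \<cdot>\<^bsub>?y\<^esub> j" by auto
    note P' = gpath_path_word[OF *(8), unfolded *(6)]
    have c: "c \<in> Vc ?y" using *(6,7) by simp
    have pw: "path_word ps = path_word ps' @ [Elt ?y c, Edg f]" using *(1,6) by simp
    note push
    also have "path_word ps @ [Elt ?x r, Edg e, Elt ?y j] = path_word ps @ [Elt ?x (vone ?x)] @ [Edg e, Elt ?y j]"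
      using *(2) by simp
    also have "homotopic G b ?y \<dots> (path_word ps @ [] @ [Edg e, Elt ?y j])"
      by (rule homotopic_rewrite[OF relator.unit P]) (use rs *(2) e E in auto)
    also have "path_word ps @ [] @ [Edg e, Elt ?y j] =
       (path_word ps' @ [Elt ?y c]) @ [Edg f, Edg (bar G f)] @ [Elt ?y j]"
      using pw *(3) by simp
    also have "homotopic G b ?y \<dots> ((path_word ps' @ [Elt ?y c]) @ [] @ [Elt ?y j])"
      by (rule homotopic_rewrite[OF relator.cancel, of _ _ ?y])
        (use rs *(5,6) P' c E edge_simps(1-7)[OF *(5)] in \<open>auto simp: gpath_append\<close>)
    also have "(path_word ps' @ [Elt ?y c]) @ [] @ [Elt ?y j] = path_word ps' @ [Elt ?y c, Elt ?y j]"
      by simp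
    also have "homotopic G b ?y \<dots> (path_word ps' @ [Elt ?y (c \<cdot>\<^bsub>?y\<^esub> j)])"
      by (rule act_word_Elt) (use *(6,8) c rs in \<open>auto simp: valid_def\<close>)
    finally show ?thesis using qk by simp
  qed
qed

lemma homotopic_run_word:
  assumes "gpath G b w x" "valid b (ps, g) x" "run ([], vone b) w = (ps, g)"
  shows "homotopic G b x w (path_word ps @ [Elt x g])"
  using assms
proof (induction w arbitrary: x ps g rule: rev_induct)
  case Nil
  then have b: "b = x" "b \<in> verts G" and pg: "ps = []" "g = vone b" by auto
  have "homotopic G b b ([] @ [Elt b (vone b)] @ []) ([] @ [] @ [])"
    by (rule homotopic_rewrite[OF relator.unit])
      (use b vertex_group[of b] in \<open>auto simp: group.is_monoid\<close>)
  then show ?case using b pg by (simp add: homotopic_sym)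
next
  case (snoc l w)
  then obtain z where z: "gpath G b w z" "gpath G z [l] x" by (auto simp: gpath_append)
  obtain qs k where run: "run ([], vone b) w = (qs, k)" by (cases "run ([], vone b) w")
  have bv: "b \<in> verts G" using z gpath_verts by blast
  have "valid b ([], vone b) b" using bv vertex_group[of b] by (simp add: valid_def group.is_monoid)
  from valid_run[OF this z(1)] have v: "valid b (qs, k) z" by (simp add: run)
  have "homotopic G b x (w @ [l]) ((path_word qs @ [Elt z k]) @ [l])"
    by (rule homotopic_append_right[OF bv snoc.IH[OF z(1) v run] z(2)])
  also have "homotopic G b x \<dots> (path_word ps @ [Elt x g])"
  proof (cases l)
    case (Elt y h)
    then have "y = z" "x = z" "h \<in> Vc z" using z(2) by auto
    moreover have "act (qs, k) l = (ps, g)" using snoc.prems(3) run by simp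
    ultimately show ?thesis using act_word_Elt[OF v] Elt by auto
  next
    case (Edg e)
    then have "e \<in> edges G" "src G e = z" "tgt G e = x" using z(2) by auto
    moreover have "act (qs, k) (Edg e) = (ps, g)" using snoc.prems(3) run Edg by simp
    ultimately show ?thesis using act_word_Edg[of b qs k e ps g] v Edg by simp
  qed
  finally show ?case .
qed

fun letter_inv :: "('v, 'e, 'g) letter \<Rightarrow> ('v, 'e, 'g) letter" where
  "letter_inv (Elt x g) = Elt x (inv\<^bsub>vgrp G x\<^esub> g)"
| "letter_inv (Edg e) = Edg (bar G e)"

definition word_inv :: "('v, 'e, 'g) letter list \<Rightarrow> ('v, 'e, 'g) letter list" where
  "word_inv w = rev (map letter_inv w)"

lemma gpath_letter_inv: "gpath G x [l] y \<Longrightarrow> gpath G y [letter_inv l] x"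
  by (cases l) (auto simp: edge_simps vertex_group group.inv_closed)

lemma gpath_word_inv: "gpath G x w y \<Longrightarrow> gpath G y (word_inv w) x"
proof (induction w arbitrary: x)
  case Nil
  then show ?case by (simp add: word_inv_def)
next
  case (Cons l w)
  from Cons.prems have "gpath G x ([l] @ w) y" by simp
  then obtain z where "gpath G x [l] z" "gpath G z w y" unfolding gpath_append by blast
  then have "gpath G y (word_inv w @ [letter_inv l]) x"
    unfolding gpath_append using Cons.IH gpath_letter_inv by blast
  then show ?case by (simp add: word_inv_def)
qed

lemma letter_inv_letter_inv: "gpath G x [l] y \<Longrightarrow> letter_inv (letter_inv l) = l"
  by (cases l) (auto simp: edge_simps vertex_group group.inv_inv)

lemma word_inv_word_inv: "gpath G x w y \<Longrightarrow> word_inv (word_inv w) = w"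
proof (induction w arbitrary: x)
  case (Cons l w)
  from Cons.prems have "gpath G x ([l] @ w) y" by simp
  then obtain z where "gpath G x [l] z" "gpath G z w y" unfolding gpath_append by blast
  then show ?case using Cons.IH letter_inv_letter_inv by (auto simp: word_inv_def rev_map)
qed (simp add: word_inv_def)

lemma letter_inv_cancel:
  assumes "gpath G x [l] y" shows "homotopic G x x [l, letter_inv l] []"
proof (cases l)
  case (Elt z g)
  then have g: "z = x" "x \<in> verts G" "g \<in> Vc x" using assms by auto
  have i: "inv\<^bsub>vgrp G x\<^esub> g \<in> Vc x" "g \<cdot>\<^bsub>x\<^esub> inv\<^bsub>vgrp G x\<^esub> g = vone x" "vone x \<in> Vc x"
    using g vertex_group[OF g(2)] by (simp_all add: group.r_inv group.is_monoid)
  have "homotopic G x x ([] @ [Elt x g, Elt x (inv\<^bsub>vgrp G x\<^esub> g)] @ [])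
      ([] @ [Elt x (g \<cdot>\<^bsub>x\<^esub> inv\<^bsub>vgrp G x\<^esub> g)] @ [])"
    by (rule homotopic_rewrite[OF relator.mult]) (use g i in auto)
  also have "\<dots> = [] @ [Elt x (vone x)] @ []" using i by simp
  also have "homotopic G x x \<dots> ([] @ [] @ [])"
    by (rule homotopic_rewrite[OF relator.unit]) (use g i in auto)
  finally show ?thesis using Elt g by simp
next
  case (Edg e)
  then have "e \<in> edges G" "src G e = x" using assms by auto
  then have "homotopic G x x ([] @ [Edg e, Edg (bar G e)] @ []) ([] @ [] @ [])"
    by (intro homotopic_rewrite[OF relator.cancel]) (auto simp: edge_simps)
  then show ?thesis using Edg by simp
qed

lemma word_inv_cancel: "gpath G x w y \<Longrightarrow> homotopic G x x (w @ word_inv w) []"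
proof (induction w arbitrary: x)
  case (Cons l w)
  from Cons.prems have "gpath G x ([l] @ w) y" by simp
  then obtain z where z: "gpath G x [l] z" "gpath G z w y" unfolding gpath_append by blast
  have "homotopic G x x ([l] @ (w @ word_inv w) @ [letter_inv l]) ([l] @ [] @ [letter_inv l])"
    by (rule homotopic_append[OF Cons.IH[OF z(2)] z(1) gpath_letter_inv[OF z(1)]])
  also have "homotopic G x x ([l] @ [] @ [letter_inv l]) []"
    using letter_inv_cancel[OF z(1)] by simp
  finally show ?case by (simp add: word_inv_def)
qed (simp add: word_inv_def)

lemma word_inv_cancel': "gpath G x w y \<Longrightarrow> homotopic G y y (word_inv w @ w) []"
  using word_inv_cancel[OF gpath_word_inv] word_inv_word_inv by metis

end

section \<open>The universal cover as a rooted tree\<close>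

text \<open>
  The tree is based at \<open>a\<close>, while balls are centred at the vertex of an arbitrary path \<open>w0\<close> from \<open>a\<close> to \<open>b\<close>. Translating
  words by the inverse of \<open>w0\<close> moves this vertex to the empty normal form, so depth is measured from it.
\<close>

locale pointed_cover = graph_of_groups_nf G
  for G :: "('v, 'e, 'g, 'h) gog" +
  fixes a b :: 'v and w0 :: "('v, 'e, 'g) letter list"
  assumes base_path: "gpath G a w0 b"
begin

abbreviation T where "T \<equiv> universal_cover G a"

definition normal_form :: "('v, 'e, 'g) letter list \<Rightarrow> ('g \<times> 'e) list \<times> 'g" where
  "normal_form w = run ([], vone b) (word_inv w0 @ w)"

lemma base_verts: "a \<in> verts G" "b \<in> verts G"
  using gpath_verts[OF base_path] by auto

lemma valid_initial: "valid b ([], vone b) b"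
  using base_verts vertex_group[of b] by (simp add: valid_def group.is_monoid)

lemma gpath_translate: "gpath G a w x \<Longrightarrow> gpath G b (word_inv w0 @ w) x"
  using gpath_word_inv[OF base_path] by (auto simp: gpath_append)

lemma valid_normal_form: "gpath G a w x \<Longrightarrow> valid b (normal_form w) x"
  unfolding normal_form_def using valid_run[OF valid_initial gpath_translate] .

lemma normal_form_append: "normal_form (w @ u) = run (normal_form w) u"
  by (simp add: normal_form_def)

lemma normal_form_base: "normal_form w0 = ([], vone b)"
  using run_homotopic[OF word_inv_cancel'[OF base_path] valid_initial] by (simp add: normal_form_def)

lemma normal_form_homotopic:
  assumes "homotopic G a x w w'" shows "normal_form w = normal_form w'"
proof -
  have "homotopic G b x (word_inv w0 @ w) (word_inv w0 @ w') \<or> w = w'"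
  proof (cases "x \<in> verts G")
    case True
    then show ?thesis using homotopic_append_left[OF True assms gpath_word_inv[OF base_path]] by simp
  next
    case False
    have "w = w'" using assms
      by (induction rule: homotopic_induct) (use False gpath_verts in blast)+
    then show ?thesis ..
  qed
  then show ?thesis unfolding normal_form_def using run_homotopic[OF _ valid_initial] by blast
qed

text \<open>
  Normal forms separate homotopy classes: translating back by \<open>w0\<close>, a word is homotopic to a word that depends only on
  its normal form.
\<close>

lemma homotopic_normal_form:
  assumes "gpath G a w x" "gpath G a w' x" "normal_form w = normal_form w'"
  shows "homotopic G a x w w'"
proof -
  obtain ps g where nf: "normal_form w = (ps, g)" by (cases "normal_form w")
  have x: "x \<in> verts G" using assms gpath_verts by blast
  have main: "homotopic G a x u (w0 @ path_word ps @ [Elt x g])"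
    if u: "gpath G a u x" "normal_form u = (ps, g)" for u
  proof -
    have "homotopic G a x ((w0 @ word_inv w0) @ u) ([] @ u)"
      by (rule homotopic_append_right[OF base_verts(1) word_inv_cancel[OF base_path] u(1)])
    from homotopic_sym[OF this] have "homotopic G a x u (w0 @ word_inv w0 @ u)" by simp
    also have "homotopic G a x \<dots> (w0 @ path_word ps @ [Elt x g])"
    proof (rule homotopic_append_left[OF x _ base_path])
      show "homotopic G b x (word_inv w0 @ u) (path_word ps @ [Elt x g])"
        using homotopic_run_word[OF gpath_translate[OF u(1)]] valid_normal_form[OF u(1)] u(2)
        by (simp add: normal_form_def)
    qed
    finally show ?thesis .
  qed
  show ?thesis
    using main[OF assms(1) nf] main[OF assms(2)] assms(3) nf
    by (metis homotopic_sym homotopic_trans)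
qed

text \<open>
  The vertex of the cover determined by a word depends only on the trail of the word, since the final group element ranges
  over its coset; the latter is the residue.
\<close>

definition trail :: "('v, 'e, 'g) letter list \<Rightarrow> ('g \<times> 'e) list" where
  "trail w = fst (normal_form w)"

definition residue :: "('v, 'e, 'g) letter list \<Rightarrow> 'g" where
  "residue w = snd (normal_form w)"

lemma normal_form_eq: "normal_form w = (trail w, residue w)"
  by (simp add: trail_def residue_def)

lemma residue_closed: "gpath G a w x \<Longrightarrow> residue w \<in> Vc x"
  and nf_trail: "gpath G a w x \<Longrightarrow> nf b (trail w) x"
  using valid_normal_form by (simp_all add: residue_def trail_def valid_def)

lemma trail_Elt: "trail (w @ [Elt x g]) = trail w"
  and residue_Elt: "residue (w @ [Elt x g]) = residue w \<cdot>\<^bsub>x\<^esub> g"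
  by (simp_all add: trail_def residue_def normal_form_append) (simp_all add: normal_form_eq)

lemma gpath_Elt: "gpath G a w x \<Longrightarrow> g \<in> Vc x \<Longrightarrow> gpath G a (w @ [Elt x g]) x"
  by (auto simp: gpath_append dest: gpath_verts)

lemma gpath_Edg: "gpath G a w (src G e) \<Longrightarrow> e \<in> edges G \<Longrightarrow> gpath G a (w @ [Edg e]) (tgt G e)"
  by (auto simp: gpath_append edge_simps)

lemma vcoset_eq:
  assumes w: "gpath G a w x"
  shows "vcoset G a x w = {w'. gpath G a w' x \<and> trail w' = trail w}"
proof (intro Set.set_eqI iffI)
  fix w' assume "w' \<in> vcoset G a x w"
  then obtain g where g: "g \<in> Vc x" "homotopic G a x (w @ [Elt x g]) w'" by (auto simp: vcoset_def)
  then show "w' \<in> {w'. gpath G a w' x \<and> trail w' = trail w}"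
    using normal_form_homotopic[OF g(2)] homotopic_gpath[OF g(2)] gpath_Elt[OF w g(1)] trail_Elt[of w x g]
    by (simp add: trail_def)
next
  fix w' assume "w' \<in> {w'. gpath G a w' x \<and> trail w' = trail w}"
  then have w': "gpath G a w' x" "trail w' = trail w" by auto
  interpret group "vgrp G x" using vertex_group gpath_verts w by blast
  define g where "g = inv\<^bsub>vgrp G x\<^esub> residue w \<cdot>\<^bsub>x\<^esub> residue w'"
  note r = residue_closed[OF w] residue_closed[OF w'(1)]
  have g: "g \<in> Vc x" using r by (simp add: g_def)
  have "residue w \<cdot>\<^bsub>x\<^esub> g = residue w'" unfolding g_def using r by (simp flip: m_assoc)
  then have "normal_form (w @ [Elt x g]) = normal_form w'"
    using w' by (simp add: normal_form_eq trail_Elt residue_Elt)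
  then show "w' \<in> vcoset G a x w"
    using homotopic_normal_form[OF gpath_Elt[OF w g] w'(1)] g by (auto simp: vcoset_def)
qed

lemma ecoset_eq:
  assumes e: "e \<in> edges G" and w: "gpath G a w (src G e)"
  shows "ecoset G a e w =
    {w'. gpath G a w' (src G e) \<and> trail w' = trail w \<and> rep e (residue w') = rep e (residue w)}"
proof (intro Set.set_eqI iffI)
  fix w' assume "w' \<in> ecoset G a e w"
  then obtain s where s: "s \<in> Ec e" "homotopic G a (src G e) (w @ [Elt (src G e) (emb G e s)]) w'"
    by (auto simp: ecoset_def)
  note nf = normal_form_homotopic[OF s(2)]
  have "residue w' = residue w \<cdot>\<^bsub>src G e\<^esub> emb G e s" "trail w' = trail w"
    using nf residue_Elt[of w "src G e"] trail_Elt[of w "src G e"] by (simp_all add: normal_form_eq)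
  then show "w' \<in> {w'. gpath G a w' (src G e) \<and> trail w' = trail w \<and> rep e (residue w') = rep e (residue w)}"
    using homotopic_gpath[OF s(2)] gpath_Elt[OF w emb_facts(1)[OF e s(1)]]
      rep_mult[OF e residue_closed[OF w] s(1)] by simp
next
  fix w' assume "w' \<in> {w'. gpath G a w' (src G e) \<and> trail w' = trail w \<and> rep e (residue w') = rep e (residue w)}"
  then have w': "gpath G a w' (src G e)" "trail w' = trail w" "rep e (residue w) = rep e (residue w')" by auto
  obtain s where s: "s \<in> Ec e" "residue w' = residue w \<cdot>\<^bsub>src G e\<^esub> emb G e s"
    using w'(3) rep_eq_iff[OF e residue_closed[OF w] residue_closed[OF w'(1)]] by blast
  then have "normal_form (w @ [Elt (src G e) (emb G e s)]) = normal_form w'"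
    using w' by (simp add: normal_form_eq trail_Elt residue_Elt)
  then show "w' \<in> ecoset G a e w"
    using homotopic_normal_form[OF gpath_Elt[OF w emb_facts(1)[OF e s(1)]] w'(1)] s(1)
    by (auto simp: ecoset_def)
qed

text \<open>
  Following an edge of the cover either shortens or lengthens the trail by one syllable. In both cases the coset of the new
  residue modulo the reversed edge is the information needed to return.
\<close>

lemma Edg_cases:
  assumes w: "gpath G a w (src G e)" and e: "e \<in> edges G"
  obtains (retreat) r ps where "trail w = (r, bar G e) # ps" "rep e (residue w) = vone (src G e)"
      "trail (w @ [Edg e]) = ps" "rep (bar G e) (residue (w @ [Edg e])) = r"
  | (advance) "trail (w @ [Edg e]) = (rep e (residue w), e) # trail w"
      "rep (bar G e) (residue (w @ [Edg e])) = vone (tgt G e)"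
      "\<not> backtracks (rep e (residue w)) e (trail w)"
proof (cases "backtracks (rep e (residue w)) e (trail w)")
  case True
  note E = edge_simps[OF e]
  obtain r f qs where *: "trail w = (r, f) # qs" "rep e (residue w) = vone (src G e)" "f = bar G e"
    "f \<in> edges G" "src G f = tgt G e" "r \<in> Vc (src G f)" "rep f r = r"
    using backtracksE[OF True nf_trail[OF w] e] by metis
  have act: "normal_form (w @ [Edg e]) = (qs, r \<cdot>\<^bsub>tgt G e\<^esub> emb G (bar G e) (rest e (residue w)))"
    using act_backtracks[OF True *(1)] by (simp add: normal_form_append) (simp add: normal_form_eq)
  have s: "rest e (residue w) \<in> Ec f" unfolding *(3) E(8) by (rule rep_rest(1)[OF e residue_closed[OF w]])
  have "rep f (r \<cdot>\<^bsub>src G f\<^esub> emb G f (rest e (residue w))) = r"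
    by (rule rep_rest_unique(1)[OF *(4,6,7) s])
  then show thesis
    using retreat[of r qs] *(1,2) act unfolding trail_def[of "w @ _"] residue_def[of "w @ _"]
    by (simp add: *(3)[symmetric] *(5))
next
  case False
  note E = edge_simps[OF e]
  have act: "normal_form (w @ [Edg e]) =
      ((rep e (residue w), e) # trail w, emb G (bar G e) (rest e (residue w)))"
    using False by (simp add: normal_form_append) (simp add: normal_form_eq)
  have "rest e (residue w) \<in> Ec (bar G e)" unfolding E(8) by (rule rep_rest(1)[OF e residue_closed[OF w]])
  from rep_rest_emb(1)[OF E(3) this] show thesis
    by (intro advance) (use False act E in \<open>simp_all add: trail_def residue_def\<close>)
qed

lemma trail_Edg_cong:
  assumes "gpath G a w (src G e)" "gpath G a w' (src G e)" "e \<in> edges G"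
    "trail w = trail w'" "rep e (residue w) = rep e (residue w')"
  shows "trail (w @ [Edg e]) = trail (w' @ [Edg e])"
    "rep (bar G e) (residue (w @ [Edg e])) = rep (bar G e) (residue (w' @ [Edg e]))"
proof -
  have B: "backtracks (rep e (residue u)) e (trail u)" if "trail u = (r, bar G e) # ps" 
    "rep e (residue u) = vone (src G e)" for u r ps
    using that edge_simps(5)[OF assms(3)] by simp
  show "trail (w @ [Edg e]) = trail (w' @ [Edg e])"
    by (rule Edg_cases[OF assms(1,3)]; rule Edg_cases[OF assms(2,3)])
      (use assms(4,5) B in auto)
  show "rep (bar G e) (residue (w @ [Edg e])) = rep (bar G e) (residue (w' @ [Edg e]))"
    by (rule Edg_cases[OF assms(1,3)]; rule Edg_cases[OF assms(2,3)])
      (use assms(4,5) B in auto)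
qed

lemma normal_form_Edg_bar:
  assumes "gpath G a w (src G e)" "e \<in> edges G"
  shows "normal_form (w @ [Edg e, Edg (bar G e)]) = normal_form w"
  using act_cancel[OF valid_normal_form[OF assms(1)] assms(2)] by (simp add: normal_form_append)

definition cover_vert where "cover_vert x w = (x, vcoset G a x w)"
definition cover_edge where "cover_edge e w = (e, ecoset G a e w)"

lemma cover_vert_eq_iff:
  "gpath G a w x \<Longrightarrow> gpath G a w' x' \<Longrightarrow>
    cover_vert x w = cover_vert x' w' \<longleftrightarrow> x = x' \<and> trail w = trail w'"
  unfolding cover_vert_def by (auto simp: vcoset_eq)

lemma cover_edge_eq_iff:
  "e \<in> edges G \<Longrightarrow> e' \<in> edges G \<Longrightarrow> gpath G a w (src G e) \<Longrightarrow> gpath G a w' (src G e') \<Longrightarrow>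
    cover_edge e w = cover_edge e' w' \<longleftrightarrow>
      e = e' \<and> trail w = trail w' \<and> rep e (residue w) = rep e (residue w')"
  unfolding cover_edge_def by (auto simp: ecoset_eq)

lemma verts_cover: "verts T = {cover_vert x w | x w. gpath G a w x}"
  unfolding universal_cover_def cover_vert_def using gpath_verts by fastforce

lemma edges_cover: "edges T = {cover_edge e w | e w. e \<in> edges G \<and> gpath G a w (src G e)}"
  by (simp add: universal_cover_def cover_edge_def)

context
  fixes e w assumes e: "e \<in> edges G" and w: "gpath G a w (src G e)"
begin

lemma src_cover: "src T (cover_edge e w) = cover_vert (src G e) w"
proof -
  have "vcoset G a (src G e) w' = vcoset G a (src G e) w" if "w' \<in> ecoset G a e w" for w'
    using that w by (auto simp: ecoset_eq[OF e w] vcoset_eq)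
  moreover have "w \<in> ecoset G a e w" using w by (simp add: ecoset_eq[OF e w])
  ultimately have "(\<Union>w'\<in>ecoset G a e w. vcoset G a (src G e) w') = vcoset G a (src G e) w" by blast
  then show ?thesis by (simp add: universal_cover_def cover_edge_def cover_vert_def)
qed

lemma tgt_cover: "tgt T (cover_edge e w) = cover_vert (tgt G e) (w @ [Edg e])"
proof -
  have "vcoset G a (tgt G e) (w' @ [Edg e]) = vcoset G a (tgt G e) (w @ [Edg e])"
    if "w' \<in> ecoset G a e w" for w'
  proof -
    have w': "gpath G a w' (src G e)" "trail w' = trail w" "rep e (residue w') = rep e (residue w)"
      using that by (auto simp: ecoset_eq[OF e w])
    show ?thesis
      using trail_Edg_cong(1)[OF w'(1) w e w'(2,3)] gpath_Edg[OF _ e] w w'(1) by (simp add: vcoset_eq)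
  qed
  moreover have "w \<in> ecoset G a e w" using w by (simp add: ecoset_eq[OF e w])
  ultimately have "(\<Union>w'\<in>ecoset G a e w. vcoset G a (tgt G e) (w' @ [Edg e])) =
    vcoset G a (tgt G e) (w @ [Edg e])" by blast
  then show ?thesis by (simp add: universal_cover_def cover_edge_def cover_vert_def)
qed

lemma bar_cover: "bar T (cover_edge e w) = cover_edge (bar G e) (w @ [Edg e])"
proof -
  note E = edge_simps[OF e]
  have g: "gpath G a (u @ [Edg e]) (src G (bar G e))" if "gpath G a u (src G e)" for u
    using gpath_Edg[OF that e] E by simp
  have "ecoset G a (bar G e) (w' @ [Edg e]) = ecoset G a (bar G e) (w @ [Edg e])"
    if "w' \<in> ecoset G a e w" for w'
  proof -
    have w': "gpath G a w' (src G e)" "trail w' = trail w" "rep e (residue w') = rep e (residue w)"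
      using that by (auto simp: ecoset_eq[OF e w])
    show ?thesis
      using trail_Edg_cong[OF w'(1) w e w'(2,3)] g[OF w] g[OF w'(1)]
      by (simp add: ecoset_eq[OF E(3)])
  qed
  moreover have "w \<in> ecoset G a e w" using w by (simp add: ecoset_eq[OF e w])
  ultimately have "(\<Union>w'\<in>ecoset G a e w. ecoset G a (bar G e) (w' @ [Edg e])) =
    ecoset G a (bar G e) (w @ [Edg e])" by blast
  then show ?thesis by (simp add: universal_cover_def cover_edge_def)
qed

end

lemma bar_bar_cover:
  assumes e: "e \<in> edges G" and w: "gpath G a w (src G e)"
  shows "bar T (bar T (cover_edge e w)) = cover_edge e w"
proof -
  note E = edge_simps[OF e]
  have g: "gpath G a (w @ [Edg e]) (src G (bar G e))" using gpath_Edg[OF w e] E by simp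
  have g2: "gpath G a (w @ [Edg e, Edg (bar G e)]) (src G e)"
    using gpath_Edg[OF g E(3)] E by simp
  have nf: "trail (w @ [Edg e, Edg (bar G e)]) = trail w" "residue (w @ [Edg e, Edg (bar G e)]) = residue w"
    using normal_form_Edg_bar[OF w e] by (simp_all add: trail_def residue_def)
  have "bar T (bar T (cover_edge e w)) = cover_edge e (w @ [Edg e, Edg (bar G e)])"
    unfolding bar_cover[OF e w] bar_cover[OF E(3) g] using E(5) by simp
  also have "\<dots> = cover_edge e w"
    using cover_edge_eq_iff[OF e e g2 w] nf by simp
  finally show ?thesis .
qed

text \<open>
  The chosen element is immaterial, because all words in a coset have the same trail.
\<close>

definition cover_depth :: "'v \<times> ('v, 'e, 'g) letter list set \<Rightarrow> nat" where
  "cover_depth t = length (trail (SOME w. w \<in> snd t))"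

lemma cover_depth:
  assumes "gpath G a w x" shows "cover_depth (cover_vert x w) = length (trail w)"
proof -
  have "w \<in> vcoset G a x w" using assms by (simp add: vcoset_eq)
  then have "(SOME w'. w' \<in> vcoset G a x w) \<in> vcoset G a x w" by (rule someI)
  then show ?thesis using assms by (simp add: cover_depth_def cover_vert_def vcoset_eq)
qed

lemma trail_base: "trail w0 = []"
  by (simp add: trail_def normal_form_base)

lemma cover_edge_depth:
  assumes "gpath G a w (src G e)" "e \<in> edges G"
  shows "cover_depth (src T (cover_edge e w)) = length (trail w)"
    "cover_depth (tgt T (cover_edge e w)) = length (trail (w @ [Edg e]))"
  using assms by (simp_all add: src_cover tgt_cover cover_depth gpath_Edg)

text \<open>
  Every vertex of the cover is represented by a word with trivial residue; from it, the edge over the reverse of the last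
  edge of the trail is the one that leads back.
\<close>

lemma neutral_representative:
  assumes w: "gpath G a w x"
  obtains w' where "gpath G a w' x" "trail w' = trail w" "residue w' = vone x"
proof -
  interpret group "vgrp G x" using vertex_group gpath_verts w by blast
  have r: "residue w \<in> Vc x" using residue_closed w .
  show ?thesis
    by (rule that[of "w @ [Elt x (inv\<^bsub>vgrp G x\<^esub> residue w)]"])
      (use r w in \<open>simp_all add: gpath_Elt trail_Elt residue_Elt\<close>)
qed

lemma fst_cover [simp]: "fst (cover_vert x w) = x" "fst (cover_edge e w) = e"
  by (simp_all add: cover_vert_def cover_edge_def)

lemma cover_vertI: "gpath G a w x \<Longrightarrow> cover_vert x w \<in> verts T"
  by (auto simp: verts_cover)

lemma cover_edgeI: "e \<in> edges G \<Longrightarrow> gpath G a w (src G e) \<Longrightarrow> cover_edge e w \<in> edges T"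
  by (auto simp: edges_cover)

lemma serre_graph_cover: "serre_graph T"
  unfolding serre_graph_def
proof
  fix E assume "E \<in> edges T"
  then obtain e w where E: "E = cover_edge e w" "e \<in> edges G" "gpath G a w (src G e)"
    by (auto simp: edges_cover)
  note S = edge_simps[OF E(2)]
  have g: "gpath G a (w @ [Edg e]) (src G (bar G e))" using gpath_Edg[OF E(3,2)] S by simp
  have "src T E \<in> verts T" "tgt T E \<in> verts T" "bar T E \<in> edges T"
    using E g S gpath_Edg[OF E(3,2)]
    by (simp_all add: src_cover tgt_cover bar_cover cover_vertI cover_edgeI)
  moreover have "fst (bar T E) \<noteq> fst E" using E S by (simp add: bar_cover)
  moreover have "src T (bar T E) = tgt T E"
    using E g S by (simp add: bar_cover src_cover tgt_cover)
  ultimately show "src T E \<in> verts T \<and> tgt T E \<in> verts T \<and> bar T E \<in> edges T \<and>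
      bar T E \<noteq> E \<and> bar T (bar T E) = E \<and> src T (bar T E) = tgt T E"
    using E bar_bar_cover by auto
qed

text \<open>
  The depth is the length of the trail. Leaving a vertex, the trail gets shorter only along the reverse of its last edge
  with residue in the edge group, which singles out one edge of the cover.
\<close>

lemma rooted_tree_cover: "rooted_tree T (cover_vert b w0) cover_depth"
proof
  show "serre_graph T" by (rule serre_graph_cover)
  show "cover_vert b w0 \<in> verts T" using base_path by (rule cover_vertI)
  show "cover_depth (cover_vert b w0) = 0" by (simp add: cover_depth base_path trail_base)
next
  fix E assume "E \<in> edges T"
  then obtain e w where E: "E = cover_edge e w" "e \<in> edges G" "gpath G a w (src G e)"
    by (auto simp: edges_cover)
  show "cover_depth (tgt T E) = Suc (cover_depth (src T E)) \<or>
      cover_depth (src T E) = Suc (cover_depth (tgt T E))"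
    unfolding E(1) cover_edge_depth[OF E(3,2)] by (rule Edg_cases[OF E(3,2)]) simp_all
next
  fix t assume t: "t \<in> verts T" "t \<noteq> cover_vert b w0"
  then obtain x w where w: "t = cover_vert x w" "gpath G a w x" by (auto simp: verts_cover)
  have "trail w \<noteq> []"
  proof
    assume "trail w = []"
    moreover from this have "x = b" using nf_trail[OF w(2)] by simp
    ultimately show False using t(2) w base_path by (simp add: cover_vert_eq_iff trail_base)
  qed
  then obtain r f ps where trail: "trail w = (r, f) # ps" by (cases "trail w") auto
  then have f: "f \<in> edges G" "tgt G f = x" using nf_trail[OF w(2)] by auto
  note F = edge_simps[OF f(1)]
  obtain w1 where w1: "gpath G a w1 x" "trail w1 = trail w" "residue w1 = vone x"
    using neutral_representative[OF w(2)] by blast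
  have src1: "gpath G a w1 (src G (bar G f))" using w1 f F by simp
  have one: "rep (bar G f) (residue w1) = vone (src G (bar G f))"
    using rep_one[OF F(3)] w1 f F by simp
  show "\<exists>!E. E \<in> edges T \<and> src T E = t \<and> cover_depth t = Suc (cover_depth (tgt T E))"
  proof (rule ex1I[of _ "cover_edge (bar G f) w1"], intro conjI)
    show "cover_edge (bar G f) w1 \<in> edges T" using src1 F(3) by (intro cover_edgeI)
    show "src T (cover_edge (bar G f) w1) = t"
      using src1 F f w w1 by (simp add: src_cover cover_vert_eq_iff)
    show "cover_depth t = Suc (cover_depth (tgt T (cover_edge (bar G f) w1)))"
      unfolding cover_edge_depth[OF src1 F(3)]
    proof -
      have B: "backtracks (rep (bar G f) (residue w1)) (bar G f) (trail w1)"
        using one trail w1(2) by simp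
      have d: "cover_depth t = length (trail w1)" using w w1 by (simp add: cover_depth)
      show "cover_depth t = Suc (length (trail (w1 @ [Edg (bar G f)])))"
        by (rule Edg_cases[OF src1 F(3)]) (use B d in simp_all)
    qed
  next
    fix E assume E: "E \<in> edges T \<and> src T E = t \<and> cover_depth t = Suc (cover_depth (tgt T E))"
    then obtain e w' where E': "E = cover_edge e w'" "e \<in> edges G" "gpath G a w' (src G e)"
      by (auto simp: edges_cover)
    have "cover_vert (src G e) w' = cover_vert x w" using E E' w by (simp add: src_cover)
    then have tr: "src G e = x" "trail w' = trail w" using E' w by (simp_all add: cover_vert_eq_iff)
    have d: "length (trail w) = Suc (length (trail (w' @ [Edg e])))"
      using E cover_edge_depth(2)[OF E'(3,2)] w by (simp add: E'(1) cover_depth)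
    have ef: "e = bar G f \<and> rep e (residue w') = vone (src G e)"
      by (rule Edg_cases[OF E'(3,2)]) (use d tr trail edge_simps(5)[OF E'(2)] in auto)
    then have "rep e (residue w') = rep e (residue w1)" using one by metis
    then show "E = cover_edge (bar G f) w1"
      using E' tr w1(2) src1 F(3) ef by (simp add: cover_edge_eq_iff)
  qed
qed

lemma projection_cover:
  assumes "E \<in> edges T"
  shows "fst E \<in> edges G" "fst (src T E) = src G (fst E)" "fst (tgt T E) = tgt G (fst E)"
    "fst (bar T E) = bar G (fst E)"
proof -
  obtain e w where E: "E = cover_edge e w" "e \<in> edges G" "gpath G a w (src G e)"
    using assms by (auto simp: edges_cover)
  then show "fst E \<in> edges G" "fst (src T E) = src G (fst E)" "fst (tgt T E) = tgt G (fst E)"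
    "fst (bar T E) = bar G (fst E)"
    by (simp_all add: src_cover tgt_cover bar_cover)
qed

text \<open>
  The edges over \<open>f\<close> at the vertex of \<open>w\<close> are those of the words \<open>w g\<close> with \<open>g\<close> in the vertex group, and two of these
  words give the same edge if and only if they agree modulo the edge group on the right.
\<close>

lemma card_edges_over:
  assumes t: "t \<in> verts T" and f: "f \<in> edges G" "src G f = fst t"
    and fin: "finite (Vc (fst t))" "finite (Ec f)"
  shows "finite {E \<in> edges T. src T E = t \<and> fst E = f}"
    and "card {E \<in> edges T. src T E = t \<and> fst E = f} * order (egrp G f) = order (vgrp G (fst t))"
proof -
  obtain x w where w: "t = cover_vert x w" "gpath G a w x" using t by (auto simp: verts_cover)
  have x: "src G f = x" "fst t = x" using f w by simp_all
  interpret group "vgrp G x" using vertex_group gpath_verts w by blast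
  interpret h: group_hom "egrp G f" "vgrp G x" "emb G f" using emb_hom(1)[OF f(1)] x by simp
  let ?h = "residue w"
  have h: "?h \<in> Vc x" using residue_closed w by blast
  define \<Phi> where "\<Phi> g = cover_edge f (w @ [Elt x g])" for g
  have gp: "gpath G a (w @ [Elt x g]) (src G f)" if "g \<in> Vc x" for g
    using gpath_Elt[OF w(2) that] x by simp
  have eq: "{E \<in> edges T. src T E = t \<and> fst E = f} = \<Phi> ` Vc x"
  proof (intro subset_antisym subsetI)
    fix E assume "E \<in> {E \<in> edges T. src T E = t \<and> fst E = f}"
    then obtain w' where w': "E = cover_edge f w'" "gpath G a w' x" "src T E = t"
      using x by (auto simp: edges_cover)
    have "cover_vert x w' = cover_vert x w" using w' w x f by (simp add: src_cover)
    then have tr: "trail w' = trail w" using w w' by (simp add: cover_vert_eq_iff)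
    have r: "residue w' \<in> Vc x" using residue_closed w'(2) by blast
    let ?g = "inv\<^bsub>vgrp G x\<^esub> ?h \<cdot>\<^bsub>x\<^esub> residue w'"
    have g: "?g \<in> Vc x" using h r by simp
    have "?h \<cdot>\<^bsub>x\<^esub> ?g = residue w'" using h r by (simp flip: m_assoc)
    then have "E = \<Phi> ?g"
      unfolding w'(1) \<Phi>_def using w'(2) gp[OF g] f(1) x tr
      by (simp add: cover_edge_eq_iff trail_Elt residue_Elt)
    then show "E \<in> \<Phi> ` Vc x" using g by blast
  next
    fix E assume "E \<in> \<Phi> ` Vc x"
    then obtain g where g: "g \<in> Vc x" "E = cover_edge f (w @ [Elt x g])" by (auto simp: \<Phi>_def)
    have "src T E = t"
      using g w x f(1) gp[OF g(1)] by (simp add: src_cover cover_vert_eq_iff trail_Elt)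
    moreover have "E \<in> edges T" unfolding g(2) using gp[OF g(1)] f(1) by (intro cover_edgeI)
    ultimately show "E \<in> {E \<in> edges T. src T E = t \<and> fst E = f}"
      using g by simp
  qed
  have finV: "finite (Vc x)" using fin x by simp
  show "finite {E \<in> edges T. src T E = t \<and> fst E = f}" unfolding eq using finV by simp
  have "card (Vc x) = card (\<Phi> ` Vc x) * card (Ec f)"
  proof (rule card_eq_card_image_mult[OF finV])
    fix g assume g: "g \<in> Vc x"
    have "\<Phi> g' = \<Phi> g \<longleftrightarrow> g' \<in> (\<lambda>s. g \<cdot>\<^bsub>x\<^esub> emb G f s) ` Ec f" if g': "g' \<in> Vc x" for g'
    proof -
      have "\<Phi> g' = \<Phi> g \<longleftrightarrow> rep f (?h \<cdot>\<^bsub>x\<^esub> g) = rep f (?h \<cdot>\<^bsub>x\<^esub> g')"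
        unfolding \<Phi>_def using gp[OF g] gp[OF g'] f(1) by (auto simp: cover_edge_eq_iff trail_Elt residue_Elt)
      also have "\<dots> \<longleftrightarrow> (\<exists>s\<in>Ec f. ?h \<cdot>\<^bsub>x\<^esub> g' = ?h \<cdot>\<^bsub>x\<^esub> g \<cdot>\<^bsub>x\<^esub> emb G f s)"
        using rep_eq_iff[OF f(1)] x h g g' by simp
      also have "\<dots> \<longleftrightarrow> (\<exists>s\<in>Ec f. g' = g \<cdot>\<^bsub>x\<^esub> emb G f s)"
        using h g g' by (simp add: m_assoc)
      finally show ?thesis by blast
    qed
    then have "{g' \<in> Vc x. \<Phi> g' = \<Phi> g} = (\<lambda>s. g \<cdot>\<^bsub>x\<^esub> emb G f s) ` Ec f"
      using g by auto
    moreover have "inj_on (\<lambda>s. g \<cdot>\<^bsub>x\<^esub> emb G f s) (Ec f)"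
      using emb_hom(2)[OF f(1)] g by (auto simp: inj_on_def)
    ultimately show "card {g' \<in> Vc x. \<Phi> g' = \<Phi> g} = card (Ec f)" by (simp add: card_image)
  qed
  then show "card {E \<in> edges T. src T E = t \<and> fst E = f} * order (egrp G f) = order (vgrp G (fst t))"
    unfolding eq order_def x by simp
qed

end

section \<open>Counting edges of the cover by depth\<close>

locale weighted_cover = pointed_cover G a b w0
  for G :: "('v, 'e, 'g, 'h) gog" and a b :: 'v and w0 +
  fixes l :: "'e \<Rightarrow> real"
  assumes finite_gog: "finite_connected_graph_of_finite_groups G"
    and degree_ge_3: "x \<in> verts G \<Longrightarrow> gog_degree G x \<ge> 3"
    and length_function: "length_function G l"
begin

abbreviation vord :: "'v \<Rightarrow> real" where "vord x \<equiv> real (order (vgrp G x))"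
abbreviation eord :: "'e \<Rightarrow> real" where "eord e \<equiv> real (order (egrp G e))"

lemma finiteness: "finite (verts G)" "finite (edges G)"
    "x \<in> verts G \<Longrightarrow> finite (Vc x)" "e \<in> edges G \<Longrightarrow> finite (Ec e)"
  using finite_gog by (auto simp: finite_connected_graph_of_finite_groups_def)

lemma edges_nonempty: "edges G \<noteq> {}"
proof
  assume "edges G = {}"
  then have "gog_degree G b = 0" by (simp add: gog_degree_def)
  then show False using degree_ge_3[OF base_verts(2)] by simp
qed

lemma length_pos: "e \<in> edges G \<Longrightarrow> 0 < l e"
  and length_bar: "e \<in> edges G \<Longrightarrow> l (bar G e) = l e"
  using length_function by (auto simp: length_function_def)

sublocale tree: bounded_metric_tree T "cover_vert b w0" cover_depth "l \<circ> fst"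
  "Min (l ` edges G)" "Max (l ` edges G)"
proof (intro bounded_metric_tree.intro metric_tree.intro)
  show "rooted_tree T (cover_vert b w0) cover_depth" by (rule rooted_tree_cover)
  show "metric_tree_axioms T (l \<circ> fst)"
    by unfold_locales (simp add: length_function_def projection_cover length_pos length_bar)
  show "bounded_metric_tree_axioms T (l \<circ> fst) (Min (l ` edges G)) (Max (l ` edges G))"
  proof
    show "0 < Min (l ` edges G)" using finiteness edges_nonempty length_pos by simp
    fix E assume "E \<in> edges T"
    then show "Min (l ` edges G) \<le> (l \<circ> fst) E" "(l \<circ> fst) E \<le> Max (l ` edges G)"
      using finiteness projection_cover by simp_all
  next
    fix t assume t: "t \<in> verts T"
    have "finite {E \<in> edges T. src T E = t \<and> fst E = f}" if f: "f \<in> edges G" "src G f = fst t" for f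
      using card_edges_over(1)[OF t f] finiteness(3,4) edge_simps(1) f by metis
    then have "finite (\<Union>f\<in>{f \<in> edges G. src G f = fst t}. {E \<in> edges T. src T E = t \<and> fst E = f})"
      using finiteness(2) by auto
    moreover have "{E \<in> edges T. src T E = t} \<subseteq>
        (\<Union>f\<in>{f \<in> edges G. src G f = fst t}. {E \<in> edges T. src T E = t \<and> fst E = f})"
      using projection_cover by fastforce
    ultimately show "finite {E \<in> edges T. src T E = t}" by (rule finite_subset[rotated])
  qed
qed

abbreviation outward where "outward \<equiv> tree.outward"
abbreviation end_height where "end_height E \<equiv> tree.height (tgt T E)"

text \<open>
  The number of outward edges over \<open>f\<close> that continue an outward edge over \<open>e\<close>: one of the
  \<open>|G_x| / |G_f|\<close> edges is lost if \<open>f\<close> is the reverse of \<open>e\<close>, since it leads back.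
\<close>

definition arrows :: "'e \<Rightarrow> 'e \<Rightarrow> real" where
  "arrows e f = vord (src G f) / eord f - (if f = bar G e then 1 else 0)"

lemma order_pos: "x \<in> verts G \<Longrightarrow> 0 < vord x" "e \<in> edges G \<Longrightarrow> 0 < eord e"
  using finiteness(3,4) monoid.one_closed[OF group.is_monoid[OF vertex_group]]
    monoid.one_closed[OF group.is_monoid[OF edge_simps(9)]]
  unfolding order_def of_nat_0_less_iff card_gt_0_iff by blast+

lemma card_over:
  assumes t: "t \<in> verts T" and f: "f \<in> edges G" "src G f = fst t"
  shows "finite {E \<in> edges T. src T E = t \<and> fst E = f}"
    "real (card {E \<in> edges T. src T E = t \<and> fst E = f}) = vord (src G f) / eord f"
proof -
  have fin: "finite (Vc (fst t))" "finite (Ec f)"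
    unfolding f(2)[symmetric] using finiteness(3)[OF edge_simps(1)[OF f(1)]] finiteness(4)[OF f(1)] .
  show "finite {E \<in> edges T. src T E = t \<and> fst E = f}" using card_edges_over(1)[OF t f fin] .
  have "real (card {E \<in> edges T. src T E = t \<and> fst E = f}) * eord f = vord (src G f)"
    unfolding f(2) card_edges_over(2)[OF t f fin, symmetric] by simp
  then show "real (card {E \<in> edges T. src T E = t \<and> fst E = f}) = vord (src G f) / eord f"
    using order_pos(2)[OF f(1)] by (simp add: eq_divide_eq)
qed

lemma card_children:
  assumes E: "E \<in> outward" and f: "f \<in> edges G" "src G f = tgt G (fst E)"
  shows "real (card {E' \<in> outward. src T E' = tgt T E \<and> fst E' = f}) = arrows (fst E) f"
proof -
  let ?A = "{E' \<in> edges T. src T E' = tgt T E \<and> fst E' = f}"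
  let ?C = "{E' \<in> outward. src T E' = tgt T E \<and> fst E' = f}"
  have Ee: "E \<in> edges T" using E tree.outward_edge by blast
  note F = tree.edge_facts[OF Ee]
  have f': "src G f = fst (tgt T E)" using f projection_cover[OF Ee] by simp
  note A = card_over[OF F(2) f(1) f']
  have inward: "E' = bar T E" if "E' \<in> ?A" "E' \<notin> outward" for E'
  proof -
    have "bar T E' \<in> outward" using that tree.outward_iff_bar by blast
    moreover have "tgt T (bar T E') = tgt T E" using that tree.edge_facts(7) by simp
    ultimately have "bar T E' = E" using tree.outward_into_unique E by blast
    moreover have "bar T (bar T E') = E'" using that tree.edge_facts(5) by blast
    ultimately show ?thesis by simp
  qed
  have bar: "bar T E \<notin> outward" using tree.outward_iff_bar[OF Ee] E by simp
  show ?thesis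
  proof (cases "f = bar G (fst E)")
    case True
    have "bar T E \<in> ?A" using F True projection_cover[OF Ee] by simp
    then have "?A = insert (bar T E) ?C" using inward tree.outward_edge by blast
    moreover have "bar T E \<notin> ?C" using bar by blast
    moreover have "finite ?C"
      by (rule finite_subset[OF _ A(1)]) (use tree.outward_edge in blast)
    ultimately have "card ?A = Suc (card ?C)" by simp
    then show ?thesis using A(2) True by (simp add: arrows_def)
  next
    case False
    then have "fst (bar T E) \<noteq> f" using projection_cover[OF Ee] by simp
    then have "?A = ?C" using inward tree.outward_edge by blast
    then show ?thesis using A(2) False by (simp add: arrows_def)
  qed
qed

definition level :: "nat \<Rightarrow> 'e \<Rightarrow> ('e \<times> ('v, 'e, 'g) letter list set) set" where
  "level n f = {E \<in> outward. cover_depth (tgt T E) = n \<and> fst E = f}"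

definition level_sum :: "real \<Rightarrow> nat \<Rightarrow> 'e \<Rightarrow> real" where
  "level_sum s n f = (\<Sum>E\<in>level n f. exp (- s * end_height E))"

lemma finite_level: "finite (level n f)"
  by (rule finite_subset[OF _ tree.finite_outward_depth_le[of n]]) (auto simp: level_def)

lemma level_sum_nonneg: "0 \<le> level_sum s n f"
  by (simp add: level_sum_def sum_nonneg)

lemma level_sum_0: "level_sum s 0 f = 0"
  unfolding level_sum_def by (rule sum.neutral) (use tree.outward_depth in \<open>auto simp: level_def\<close>)

lemma level_sum_1_pos:
  assumes f: "f \<in> edges G" "src G f = b" shows "0 < level_sum s 1 f"
proof -
  let ?A = "{E \<in> edges T. src T E = cover_vert b w0 \<and> fst E = f}"
  have "0 < real (card ?A)"
    using card_over(2)[OF tree.root_vert f(1)] f order_pos edge_simps(1)[OF f(1)] by simp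
  then obtain E where E: "E \<in> ?A" by (auto simp: card_gt_0_iff)
  then have "cover_depth (tgt T E) = 1"
    using tree.depth_edge[of E] tree.depth_root by auto
  then have "E \<in> level 1 f" using E tree.depth_root by (simp add: level_def tree.outward_def)
  then show ?thesis unfolding level_sum_def using finite_level by (intro sum_pos) auto
qed

text \<open>
  Group the outward edges of the next level by their predecessors. At level \<open>0\<close> there are no outward edges, so the
  recursion starts at level \<open>1\<close>.
\<close>

lemma level_sum_Suc:
  assumes f: "f \<in> edges G" and n: "0 < n"
  shows "level_sum s (Suc n) f =
    exp (- s * l f) * (\<Sum>e | e \<in> edges G \<and> tgt G e = src G f. arrows e f * level_sum s n e)"
proof -
  let ?I = "{e \<in> edges G. tgt G e = src G f}"
  let ?P = "{E \<in> outward. cover_depth (tgt T E) = n \<and> tgt G (fst E) = src G f}"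
  \<comment> \<open>The predecessor of an outward edge on its geodesic.\<close>
  define par where "par E' = (THE E. E \<in> outward \<and> tgt T E = src T E')" for E'
  have par: "par E' = E" if "E \<in> outward" "tgt T E = src T E'" for E E'
    unfolding par_def using that tree.outward_into_unique by (intro the_equality) auto
  have finP: "finite ?P"
    by (rule finite_subset[OF _ tree.finite_outward_depth_le[of n]]) auto
  have ex: "\<exists>E\<in>?P. tgt T E = src T E'" if E': "E' \<in> level (Suc n) f" for E'
  proof -
    have e': "E' \<in> edges T" using E' tree.outward_edge by (auto simp: level_def)
    have d: "cover_depth (src T E') = n"
      using E' tree.outward_depth[of E'] by (simp add: level_def)
    then have "src T E' \<noteq> cover_vert b w0" using n tree.depth_root by auto
    then obtain E where E: "E \<in> outward" "tgt T E = src T E'"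
      using tree.outward_into_ex tree.edge_facts(1)[OF e'] by metis
    have "tgt G (fst E) = src G f"
      using projection_cover(3)[OF tree.outward_edge[OF E(1)]] projection_cover(2)[OF e'] E(2) E'
      by (simp add: level_def)
    then show ?thesis using E d by (intro bexI[of _ E]) simp_all
  qed
  have children: "{E' \<in> level (Suc n) f. par E' = E} = {E' \<in> outward. src T E' = tgt T E \<and> fst E' = f}"
    if "E \<in> ?P" for E
  proof (intro subset_antisym subsetI)
    fix E' assume "E' \<in> {E' \<in> level (Suc n) f. par E' = E}"
    then have E': "E' \<in> level (Suc n) f" "par E' = E" by auto
    from ex[OF E'(1)] obtain E1 where "E1 \<in> ?P" "tgt T E1 = src T E'" by blast
    moreover from this have "E1 = E" using par[of E1 E'] E'(2) by blast
    ultimately show "E' \<in> {E' \<in> outward. src T E' = tgt T E \<and> fst E' = f}"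
      using E'(1) by (simp add: level_def)
  next
    fix E' assume "E' \<in> {E' \<in> outward. src T E' = tgt T E \<and> fst E' = f}"
    then show "E' \<in> {E' \<in> level (Suc n) f. par E' = E}"
      using that par[of E E'] tree.outward_depth[of E'] by (simp add: level_def)
  qed
  have "level_sum s (Suc n) f =
      (\<Sum>E\<in>?P. \<Sum>E'\<in>{E' \<in> level (Suc n) f. par E' = E}. exp (- s * end_height E'))"
    unfolding level_sum_def
  proof (rule sum.group[symmetric, OF finite_level finP])
    show "par ` level (Suc n) f \<subseteq> ?P"
    proof (rule image_subsetI)
      fix E' assume "E' \<in> level (Suc n) f"
      from ex[OF this] obtain E where "E \<in> ?P" "tgt T E = src T E'" by blast
      moreover from this have "par E' = E" using par by blast
      ultimately show "par E' \<in> ?P" by simp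
    qed
  qed
  also have "\<dots> = (\<Sum>E\<in>?P. arrows (fst E) f * exp (- s * l f) * exp (- s * end_height E))"
  proof (rule sum.cong[OF refl])
    fix E assume E: "E \<in> ?P"
    have "(\<Sum>E'\<in>{E' \<in> level (Suc n) f. par E' = E}. exp (- s * end_height E')) =
        (\<Sum>E'\<in>{E' \<in> outward. src T E' = tgt T E \<and> fst E' = f}. exp (- s * l f) * exp (- s * end_height E))"
      unfolding children[OF E] 
      by (intro sum.cong) (auto simp: tree.height_tgt algebra_simps simp flip: exp_add)
    also have "\<dots> = real (card {E' \<in> outward. src T E' = tgt T E \<and> fst E' = f}) *
        (exp (- s * l f) * exp (- s * end_height E))" by simp
    also have "\<dots> = arrows (fst E) f * exp (- s * l f) * exp (- s * end_height E)"
      using card_children[of E f] E f by simp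
    finally show "(\<Sum>E'\<in>{E' \<in> level (Suc n) f. par E' = E}. exp (- s * end_height E')) =
      arrows (fst E) f * exp (- s * l f) * exp (- s * end_height E)" .
  qed
  also have "\<dots> = (\<Sum>e\<in>?I. \<Sum>E\<in>{E \<in> ?P. fst E = e}.
      arrows (fst E) f * exp (- s * l f) * exp (- s * end_height E))"
    using finiteness(2) projection_cover(1) tree.outward_edge
    by (intro sum.group[symmetric, OF finP]) auto
  also have "\<dots> = (\<Sum>e\<in>?I. exp (- s * l f) * (arrows e f * level_sum s n e))"
  proof (rule sum.cong[OF refl])
    fix e assume "e \<in> ?I"
    then have "{E \<in> ?P. fst E = e} = level n e" by (auto simp: level_def)
    then have "(\<Sum>E\<in>{E \<in> ?P. fst E = e}. arrows (fst E) f * exp (- s * l f) * exp (- s * end_height E))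
       = (\<Sum>E\<in>level n e. arrows e f * exp (- s * l f) * exp (- s * end_height E))"
      by (intro sum.cong) auto
    then show "(\<Sum>E\<in>{E \<in> ?P. fst E = e}. arrows (fst E) f * exp (- s * l f) * exp (- s * end_height E))
       = exp (- s * l f) * (arrows e f * level_sum s n e)"
      by (simp add: level_sum_def sum_distrib_left mult_ac)
  qed
  finally show ?thesis by (simp add: sum_distrib_left)
qed

section \<open>Entropy as an exponent of convergence\<close>

abbreviation ball :: "real \<Rightarrow> real" where
  "ball r \<equiv> ball_length G a (cover_vert b w0) l r"

abbreviation entropy :: ereal where
  "entropy \<equiv> volume_entropy G a (cover_vert b w0) l"

abbreviation lmin where "lmin \<equiv> Min (l ` edges G)"
abbreviation lmax where "lmax \<equiv> Max (l ` edges G)"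

lemma ball_bounds:
  "lmin * card (tree.near r) \<le> ball r" "ball r \<le> lmax * card (tree.near (r + lmax))"
  using tree.ball_length_ge[of r] tree.ball_length_le[of r]
  by (simp_all add: ball_length_def Let_def tree.root_ball_def)

lemma lmax_pos: "0 < lmax"
proof -
  obtain e where e: "e \<in> edges G" using edges_nonempty by blast
  then have "l e \<le> lmax" using finiteness(2) by simp
  then show ?thesis using length_pos[OF e] by linarith
qed

lemma sum_outward_le_level_sums:
  assumes "finite F" "F \<subseteq> outward" "\<And>E. E \<in> F \<Longrightarrow> cover_depth (tgt T E) < m"
  shows "(\<Sum>E\<in>F. exp (- s * end_height E)) \<le> (\<Sum>f\<in>edges G. \<Sum>n<m. level_sum s n f)"
proof -
  let ?U = "\<Union>(f, n)\<in>edges G \<times> {..<m}. level n f"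
  have "(\<Sum>E\<in>F. exp (- s * end_height E)) \<le> (\<Sum>E\<in>?U. exp (- s * end_height E))"
  proof (rule sum_mono2)
    show "finite ?U" using finiteness(2) finite_level by auto
    show "F \<subseteq> ?U"
    proof
      fix E assume E: "E \<in> F"
      then have o: "E \<in> outward" using assms(2) by blast
      have "fst E \<in> edges G" using projection_cover(1)[OF tree.outward_edge[OF o]] .
      moreover have "E \<in> level (cover_depth (tgt T E)) (fst E)" using o by (simp add: level_def)
      ultimately show "E \<in> ?U"
        using assms(3)[OF E] by (intro UN_I[of "(fst E, cover_depth (tgt T E))"]) simp_all
    qed
  qed simp
  also have "\<dots> = (\<Sum>p\<in>edges G \<times> {..<m}. case p of (f, n) \<Rightarrow> level_sum s n f)"
    unfolding level_sum_def case_prod_unfold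
    by (rule sum.UNION_disjoint) (use finiteness(2) finite_level in \<open>auto simp: level_def\<close>)
  also have "\<dots> = (\<Sum>f\<in>edges G. \<Sum>n<m. level_sum s n f)"
    by (simp add: sum.cartesian_product)
  finally show ?thesis .
qed

text \<open>
  If the series converges with sum \<open>M\<close>, there are at most \<open>M * exp (s * r)\<close> edges within distance \<open>r\<close>.
\<close>

lemma entropy_le:
  assumes s: "0 < s" and summable: "\<And>f. f \<in> edges G \<Longrightarrow> summable (\<lambda>n. level_sum s n f)"
  shows "entropy \<le> ereal s"
proof -
  define M where "M = (\<Sum>f\<in>edges G. \<Sum>n. level_sum s n f)"
  define C where "C = max 1 (lmax * M * exp (s * lmax))"
  have near: "card (tree.near r) \<le> M * exp (s * r)" for r
  proof -
    obtain m where m: "\<And>E. E \<in> tree.near r \<Longrightarrow> cover_depth (tgt T E) < m"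
      using finite_nat_set_iff_bounded[of "(\<lambda>E. cover_depth (tgt T E)) ` tree.near r"] tree.finite_near
      by auto
    have "card (tree.near r) * exp (- s * r) = (\<Sum>E\<in>tree.near r. exp (- s * r))" by simp
    also have "\<dots> \<le> (\<Sum>E\<in>tree.near r. exp (- s * end_height E))"
      using s by (intro sum_mono) (auto simp: tree.near_def)
    also have "\<dots> \<le> (\<Sum>f\<in>edges G. \<Sum>n<m. level_sum s n f)"
      by (rule sum_outward_le_level_sums[OF tree.finite_near _ m]) (auto simp: tree.near_def)
    also have "\<dots> \<le> M"
      unfolding M_def by (intro sum_mono sum_le_suminf summable) (auto simp: level_sum_nonneg)
    finally show ?thesis by (simp add: exp_minus divide_simps)
  qed
  have ball: "ball r \<le> C * exp (s * r)" for r
  proof -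
    have "ball r \<le> lmax * card (tree.near (r + lmax))" by (rule ball_bounds)
    also have "\<dots> \<le> lmax * (M * exp (s * (r + lmax)))"
      using near lmax_pos by (intro mult_left_mono) auto
    also have "\<dots> = (lmax * M * exp (s * lmax)) * exp (s * r)"
      by (simp add: distrib_left exp_add)
    also have "\<dots> \<le> C * exp (s * r)" by (intro mult_right_mono) (auto simp: C_def)
    finally show ?thesis .
  qed
  have "entropy \<le> Limsup at_top (\<lambda>r. ereal (ln C / r + s))"
    unfolding volume_entropy_def
  proof (rule Limsup_mono, rule eventually_mono[OF eventually_gt_at_top[of 0]])
    fix r :: real assume r: "0 < r"
    have C: "1 \<le> C" by (simp add: C_def)
    have b0: "0 \<le> ball r" using ball_bounds(1)[of r] tree.lmin_pos
      by (meson less_imp_le mult_nonneg_nonneg of_nat_0_le_iff order_trans)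
    have "ln (ball r) \<le> ln C + s * r"
    proof (cases "ball r = 0")
      case True
      then show ?thesis using C s r by simp
    next
      case False
      then have "ln (ball r) \<le> ln (C * exp (s * r))" using ball[of r] b0 by simp
      then show ?thesis using C by (simp add: ln_mult)
    qed
    then show "ereal (ln (ball r) / r) \<le> ereal (ln C / r + s)"
      using r by (simp add: field_simps)
  qed
  also have "\<dots> = ereal s"
  proof (rule lim_imp_Limsup)
    have "((\<lambda>r. ln C / r + s) \<longlongrightarrow> 0 + s) at_top"
      by (intro tendsto_add tendsto_const tendsto_divide_0[OF tendsto_const] filterlim_at_top_imp_at_infinity filterlim_ident)
    then show "((\<lambda>r. ereal (ln C / r + s)) \<longlongrightarrow> ereal s) at_top" by simp
  qed simp
  finally show ?thesis .
qed

text \<open>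
  If the balls grow at most like \<open>exp (s' * r)\<close> with \<open>s' < s\<close>, group the edges by the integer part of their distance and
  compare with a geometric series.
\<close>

lemma summable_level_sum:
  assumes s: "entropy < ereal s" and f: "f \<in> edges G"
  shows "summable (\<lambda>n. level_sum s n f)"
proof -
  obtain s' where s': "entropy < ereal s'" "s' < s" using ereal_dense2[OF s] by auto
  have "\<forall>\<^sub>F r in at_top. ereal (ln (ball r) / r) < ereal s'"
    using s'(1) unfolding volume_entropy_def by (rule Limsup_lessD)
  then have "\<forall>\<^sub>F r in at_top. 0 < r \<and> ereal (ln (ball r) / r) < ereal s'"
    by (intro eventually_conj eventually_gt_at_top)
  then obtain R where R: "\<And>r. R \<le> r \<Longrightarrow> 0 < r \<and> ln (ball r) / r < s'"
    by (auto simp: eventually_at_top_linorder)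
  have near: "card (tree.near r) \<le> exp (s' * r) / lmin" if "R \<le> r" for r
  proof -
    have "ln (ball r) < s' * r" using R[OF that] by (simp add: divide_simps)
    then have "ball r \<le> exp (s' * r)"
      by (metis exp_ge_zero exp_le_cancel_iff exp_ln_iff less_imp_le linorder_not_le order_trans)
    then have "lmin * card (tree.near r) \<le> exp (s' * r)" using ball_bounds(1)[of r] by linarith
    then show ?thesis using tree.lmin_pos by (simp add: field_simps)
  qed
  \<comment> \<open>Bounds the terms of edges at distance between \<open>j\<close> and \<open>j + 1\<close>; the absolute value covers both signs of \<open>s\<close>.\<close>
  define c where "c j = exp (\<bar>s\<bar> - s * real j) * card (tree.near (real j + 1))" for j
  have c_nonneg: "0 \<le> c j" for j by (simp add: c_def)
  have summable_c: "summable c"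
  proof (rule summable_comparison_test')
    show "summable (\<lambda>j. exp (\<bar>s\<bar> + s') / lmin * exp (s' - s) ^ j)"
      using s'(2) by (intro summable_mult summable_geometric) simp
    fix j assume j: "nat \<lceil>R\<rceil> \<le> j"
    then have "R \<le> real j + 1" by linarith
    from near[OF this] have "c j \<le> exp (\<bar>s\<bar> - s * real j) * (exp (s' * (real j + 1)) / lmin)"
      unfolding c_def by (intro mult_left_mono) auto
    also have "\<dots> = exp (\<bar>s\<bar> + s') / lmin * exp (s' - s) ^ j"
      by (simp add: exp_of_nat_mult[symmetric] algebra_simps flip: exp_add)
    finally show "norm (c j) \<le> exp (\<bar>s\<bar> + s') / lmin * exp (s' - s) ^ j"
      using c_nonneg by simp
  qed
  show ?thesis
  proof (rule summableI_nonneg_bounded)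
    show "0 \<le> level_sum s n f" for n by (rule level_sum_nonneg)
    fix n
    let ?F = "\<Union>i<n. level i f"
    have out: "?F \<subseteq> outward" by (auto simp: level_def)
    have fin: "finite ?F" using finite_level by auto
    let ?j = "\<lambda>E. nat \<lfloor>end_height E\<rfloor>"
    have height: "0 \<le> end_height E" if "E \<in> outward" for E
    proof -
      have "lmin * cover_depth (tgt T E) \<le> end_height E"
        using tree.depth_le_height tree.edge_facts(2) tree.outward_edge that by blast
      then show ?thesis using tree.lmin_pos by (meson less_imp_le mult_nonneg_nonneg of_nat_0_le_iff order_trans)
    qed
    obtain J where J: "\<And>E. E \<in> ?F \<Longrightarrow> ?j E < J"
      using finite_nat_set_iff_bounded[of "?j ` ?F"] fin by auto
    have "(\<Sum>i<n. level_sum s i f) = (\<Sum>E\<in>?F. exp (- s * end_height E))"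
      unfolding level_sum_def
      by (rule sum.UNION_disjoint[symmetric]) (use finite_level in \<open>auto simp: level_def\<close>)
    also have "\<dots> = (\<Sum>j<J. \<Sum>E\<in>{E \<in> ?F. ?j E = j}. exp (- s * end_height E))"
      by (rule sum.group[symmetric, OF fin]) (use J in auto)
    also have "\<dots> \<le> (\<Sum>j<J. c j)"
    proof (rule sum_mono)
      fix j
      let ?G = "{E \<in> ?F. ?j E = j}"
      have *: "real j \<le> end_height E \<and> end_height E \<le> real j + 1" if "E \<in> ?G" for E
      proof -
        have "E \<in> outward" using that out by blast
        then have "0 \<le> end_height E" by (rule height)
        moreover have "nat \<lfloor>end_height E\<rfloor> = j" using that by simp
        ultimately show ?thesis by linarith
      qed
      have "(\<Sum>E\<in>?G. exp (- s * end_height E)) \<le> (\<Sum>E\<in>?G. exp (\<bar>s\<bar> - s * real j))"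
      proof (rule sum_mono)
        fix E assume "E \<in> ?G"
        from *[OF this] have "0 \<le> end_height E - real j" "end_height E - real j \<le> 1" by linarith+
        then have "\<bar>s\<bar> * (end_height E - real j) \<le> \<bar>s\<bar> * 1"
          and "- s * (end_height E - real j) \<le> \<bar>s\<bar> * (end_height E - real j)"
          by (intro mult_left_mono mult_right_mono; simp)+
        then have "- s * (end_height E - real j) \<le> \<bar>s\<bar>" by linarith
        then show "exp (- s * end_height E) \<le> exp (\<bar>s\<bar> - s * real j)" by (simp add: algebra_simps)
      qed
      also have "\<dots> = exp (\<bar>s\<bar> - s * real j) * card ?G" by simp
      also have "\<dots> \<le> c j"
      proof -
        have "?G \<subseteq> tree.near (real j + 1)" unfolding tree.near_def using * out by blast
        then show ?thesis unfolding c_def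
          using card_mono[OF tree.finite_near] by (intro mult_left_mono) auto
      qed
      finally show "(\<Sum>E\<in>?G. exp (- s * end_height E)) \<le> c j" .
    qed
    also have "\<dots> \<le> suminf c" using summable_c c_nonneg by (intro sum_le_suminf) auto
    finally show "(\<Sum>i<n. level_sum s i f) \<le> suminf c" .
  qed
qed

section \<open>The lower bound and its equality case\<close>

abbreviation k where "k \<equiv> branching G"

lemma k_ge_2: "x \<in> verts G \<Longrightarrow> 2 \<le> k x"
  using degree_ge_3[of x] by (simp add: branching_def)

lemma eord_le_vord: "e \<in> edges G \<Longrightarrow> eord e \<le> vord (src G e)"
  unfolding order_def of_nat_le_iff
  by (rule card_inj_on_le[OF emb_hom(2)]) (auto simp: emb_facts finiteness edge_simps)

lemma arrows_nonneg: "f \<in> edges G \<Longrightarrow> 0 \<le> arrows e f"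
proof -
  assume f: "f \<in> edges G"
  have "1 \<le> vord (src G f) / eord f"
    using eord_le_vord[OF f] order_pos(2)[OF f] by (simp add: le_divide_eq)
  moreover have "(if f = bar G e then 1 else 0) \<le> (1::real)" by simp
  ultimately show ?thesis unfolding arrows_def by linarith
qed

lemma arrows_off_diagonal_pos:
  "f \<in> edges G \<Longrightarrow> f \<noteq> bar G e \<Longrightarrow> 0 < arrows e f"
  using order_pos edge_simps(1) by (simp add: arrows_def)

text \<open>
  The only edge that may be unable to follow \<open>bar f\<close> is \<open>f\<close>. As the degree is at least three, there is always a detour of
  three arrows between \<open>bar f\<close> and \<open>f\<close> at their common vertex. This is what excludes lines and circles, where
  the non-backtracking walk never turns around.
\<close>

lemma zigzag:
  assumes f: "f \<in> edges G"
  obtains f1 f2 where "f1 \<in> edges G" "f2 \<in> edges G" "src G f1 = src G f" "src G f2 = src G f"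
    "0 < arrows (bar G f) f1" "0 < arrows (bar G f2) f1" "0 < arrows (bar G f2) f"
proof (cases "0 < arrows (bar G f) f")
  case True
  then show thesis using that[of f f] f by simp
next
  case False
  let ?x = "src G f"
  let ?O = "{g \<in> edges G. src G g = ?x}"
  have bb: "bar G (bar G g) = g" if "g \<in> edges G" for g using edge_simps(5) that .
  have off: "0 < arrows (bar G g) h" if "g \<in> edges G" "h \<in> edges G" "h \<noteq> g" for g h
    using arrows_off_diagonal_pos[of h "bar G g"] bb that by simp
  have "vord ?x / eord f \<le> 1" using False bb[OF f] by (simp add: arrows_def)
  moreover have "3 \<le> vord ?x / eord f + (\<Sum>g\<in>?O - {f}. vord ?x / eord g)"
  proof -
    have "gog_degree G ?x = (\<Sum>g\<in>?O. vord ?x / eord g)" by (simp add: gog_degree_def)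
    also have "\<dots> = vord ?x / eord f + (\<Sum>g\<in>?O - {f}. vord ?x / eord g)"
      using finiteness(2) f by (intro sum.remove) auto
    finally show ?thesis using degree_ge_3[OF edge_simps(1)[OF f]] by simp
  qed
  \<comment> \<open>If \<open>f\<close> cannot follow \<open>bar f\<close>, it carries weight one, and the other edges at the vertex share a weight of at least two:
    either there are two of them, or a single one that can follow its own reverse.\<close>
  ultimately have rest: "2 \<le> (\<Sum>g\<in>?O - {f}. vord ?x / eord g)" by linarith
  then have "?O - {f} \<noteq> {}" by (metis not_numeral_le_zero sum.empty)
  then obtain g where g: "g \<in> edges G" "src G g = ?x" "g \<noteq> f" by auto
  show thesis
  proof (cases "?O - {f} = {g}")
    case True
    have "0 < arrows (bar G g) g" using rest g bb[OF g(1)] unfolding True by (simp add: arrows_def)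
    then show thesis using that[of g g] g f off by simp
  next
    case False
    then obtain g' where "g' \<in> edges G" "src G g' = ?x" "g' \<noteq> f" "g' \<noteq> g" using g by blast
    then show thesis using that[of g g'] g f off by simp
  qed
qed

text \<open>
  The stationary flow of the walk that chooses among all non-backtracking continuations with equal probability: out of
  \<open>e\<close> and into \<open>f\<close> it sums to \<open>1 / |G_e|\<close> and \<open>1 / |G_f|\<close>.
\<close>

definition flow :: "'e \<Rightarrow> 'e \<Rightarrow> real" where
  "flow e f = arrows e f / (eord e * k (src G f))"

definition turns :: "('e \<times> 'e) set" where
  "turns = {(e, f). e \<in> edges G \<and> f \<in> edges G \<and> tgt G e = src G f}"

lemma finite_turns: "finite turns"
  by (rule finite_subset[of _ "edges G \<times> edges G"]) (auto simp: turns_def finiteness)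

lemma sum_turns: "(\<Sum>p\<in>turns. h (fst p) (snd p)) =
    (\<Sum>e\<in>edges G. \<Sum>f | f \<in> edges G \<and> src G f = tgt G e. h e f)" (is ?out)
  "(\<Sum>p\<in>turns. h (fst p) (snd p)) =
    (\<Sum>f\<in>edges G. \<Sum>e | e \<in> edges G \<and> tgt G e = src G f. h e f)" (is ?into)
proof -
  have "turns = Sigma (edges G) (\<lambda>e. {f \<in> edges G. src G f = tgt G e})"
    by (auto simp: turns_def)
  then show ?out
    using finiteness(2) by (simp add: sum.Sigma case_prod_unfold)
  have "(\<Sum>p\<in>turns. h (fst p) (snd p)) =
      (\<Sum>p\<in>Sigma (edges G) (\<lambda>f. {e \<in> edges G. tgt G e = src G f}). h (snd p) (fst p))"
    by (rule sum.reindex_bij_witness[of _ prod.swap prod.swap]) (auto simp: turns_def)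
  then show ?into
    using finiteness(2) by (simp add: sum.Sigma case_prod_unfold)
qed

lemma degree_incoming:
  assumes "x \<in> verts G"
  shows "(\<Sum>e | e \<in> edges G \<and> tgt G e = x. vord x / eord e) = gog_degree G x"
proof -
  have bij: "bij_betw (bar G) {e. e \<in> edges G \<and> src G e = x} {e. e \<in> edges G \<and> tgt G e = x}"
    by (rule bij_betwI[where g = "bar G"]) (auto simp: edge_simps)
  have "(\<Sum>e | e \<in> edges G \<and> tgt G e = x. vord x / eord e) =
      (\<Sum>e | e \<in> edges G \<and> src G e = x. vord x / eord (bar G e))"
    by (rule sum.reindex_bij_betw[OF bij, symmetric])
  also have "\<dots> = gog_degree G x"
    unfolding gog_degree_def by (rule sum.cong) (auto simp: edge_simps)
  finally show ?thesis .
qed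

lemma sum_arrows_out:
  assumes e: "e \<in> edges G"
  shows "(\<Sum>f | f \<in> edges G \<and> src G f = tgt G e. arrows e f) = k (tgt G e)"
proof -
  let ?O = "{f. f \<in> edges G \<and> src G f = tgt G e}"
  have "(\<Sum>f\<in>?O. arrows e f) =
      (\<Sum>f\<in>?O. vord (tgt G e) / eord f) - (\<Sum>f\<in>?O. if f = bar G e then 1 else 0)"
    unfolding arrows_def sum_subtractf[symmetric] by (rule sum.cong) auto
  also have "(\<Sum>f\<in>?O. if f = bar G e then 1 else 0) = (1::real)"
    using finiteness(2) edge_simps[OF e] by (simp add: sum.delta)
  also have "(\<Sum>f\<in>?O. vord (tgt G e) / eord f) = gog_degree G (tgt G e)"
    by (simp add: gog_degree_def)
  finally show ?thesis by (simp add: branching_def)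
qed

lemma sum_flow_out:
  assumes e: "e \<in> edges G"
  shows "(\<Sum>f | f \<in> edges G \<and> src G f = tgt G e. flow e f) = 1 / eord e"
proof -
  have "(\<Sum>f | f \<in> edges G \<and> src G f = tgt G e. flow e f) =
      (\<Sum>f | f \<in> edges G \<and> src G f = tgt G e. arrows e f) / (eord e * k (tgt G e))"
    unfolding flow_def sum_divide_distrib by (rule sum.cong) auto
  then show ?thesis
    using k_ge_2[OF edge_simps(2)[OF e]] by (simp add: sum_arrows_out[OF e])
qed

lemma sum_flow_into:
  assumes f: "f \<in> edges G"
  shows "(\<Sum>e | e \<in> edges G \<and> tgt G e = src G f. flow e f) = 1 / eord f"
proof -
  let ?x = "src G f"
  let ?I = "{e. e \<in> edges G \<and> tgt G e = ?x}"
  have x: "?x \<in> verts G" using edge_simps(1) f by blast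
  have "flow e f = (vord ?x / eord e / eord f - (if e = bar G f then 1 / eord f else 0)) / k ?x"
    if "e \<in> ?I" for e
  proof (cases "e = bar G f")
    case True
    then have "f = bar G e" "eord e = eord f" using edge_simps[OF f] by auto
    then show ?thesis using True by (simp add: flow_def arrows_def diff_divide_distrib)
  next
    case False
    then have "f \<noteq> bar G e" using that edge_simps(5) by auto
    then show ?thesis using False by (simp add: flow_def arrows_def mult_ac)
  qed
  then have "(\<Sum>e\<in>?I. flow e f) =
      (\<Sum>e\<in>?I. (vord ?x / eord e / eord f - (if e = bar G f then 1 / eord f else 0)) / k ?x)"
    by (rule sum.cong[OF refl])
  also have "\<dots> = ((\<Sum>e\<in>?I. vord ?x / eord e) / eord f -
      (\<Sum>e\<in>?I. if e = bar G f then 1 / eord f else 0)) / k ?x"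
    by (simp only: sum_divide_distrib[symmetric] sum_subtractf)
  also have "(\<Sum>e\<in>?I. if e = bar G f then 1 / eord f else 0) = 1 / eord f"
    using finiteness(2) edge_simps[OF f] by (simp add: sum.delta)
  also have "((\<Sum>e\<in>?I. vord ?x / eord e) / eord f - 1 / eord f) / k ?x = 1 / eord f"
    unfolding degree_incoming[OF x] using k_ge_2[OF x]
    by (simp add: branching_def flip: diff_divide_distrib)
  finally show ?thesis .
qed

lemma sum_flow_weighted:
  "(\<Sum>p\<in>turns. flow (fst p) (snd p) * u (fst p)) = (\<Sum>e\<in>edges G. u e / eord e)"
  "(\<Sum>p\<in>turns. flow (fst p) (snd p) * u (snd p)) = (\<Sum>e\<in>edges G. u e / eord e)"
proof -
  show "(\<Sum>p\<in>turns. flow (fst p) (snd p) * u (fst p)) = (\<Sum>e\<in>edges G. u e / eord e)"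
    unfolding sum_turns(1)[of "\<lambda>e f. flow e f * u e"] sum_distrib_right[symmetric]
    by (rule sum.cong) (simp_all add: sum_flow_out)
  show "(\<Sum>p\<in>turns. flow (fst p) (snd p) * u (snd p)) = (\<Sum>e\<in>edges G. u e / eord e)"
    unfolding sum_turns(2)[of "\<lambda>e f. flow e f * u f"] sum_distrib_right[symmetric]
    by (rule sum.cong) (simp_all add: sum_flow_into)
qed

lemma turnsD:
  assumes "(e, f) \<in> turns"
  shows "e \<in> edges G" "f \<in> edges G" "tgt G e = src G f" "0 < eord e" "0 < eord f" "0 < k (src G f)"
proof -
  show ef: "e \<in> edges G" "f \<in> edges G" "tgt G e = src G f" using assms by (auto simp: turns_def)
  then show "0 < eord e" "0 < eord f" using order_pos(2) by blast+
  show "0 < k (src G f)" using k_ge_2[OF edge_simps(1)[OF ef(2)]] by linarith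
qed

lemma flow_nonneg: "(e, f) \<in> turns \<Longrightarrow> 0 \<le> flow e f"
  using arrows_nonneg[of f e] turnsD[of e f] by (simp add: flow_def)

lemma flow_pos: "(e, f) \<in> turns \<Longrightarrow> 0 < arrows e f \<Longrightarrow> 0 < flow e f"
  using turnsD[of e f] by (simp add: flow_def)

text \<open>
  A stationary flow cannot leave a set of edges without entering it, so a set closed under following arrows is also
  closed under tracing them back (recurrence of a finite chain with positive stationary measure).
\<close>

lemma closed_under_arrows_backwards:
  assumes closed: "\<And>e f. (e, f) \<in> turns \<Longrightarrow> 0 < arrows e f \<Longrightarrow> P e \<Longrightarrow> P f"
    and ef: "(e, f) \<in> turns" "0 < arrows e f" "P f"
  shows "P e"
proof -
  let ?c = "\<lambda>e. if P e then 1 else (0::real)"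
  let ?d = "\<lambda>p. flow (fst p) (snd p) * (?c (snd p) - ?c (fst p))"
  have nonneg: "0 \<le> ?d p" if p: "p \<in> turns" for p
  proof (cases "0 < arrows (fst p) (snd p)")
    case True
    then have "P (fst p) \<Longrightarrow> P (snd p)" using closed[of "fst p" "snd p"] p by simp
    then have "0 \<le> ?c (snd p) - ?c (fst p)" by simp
    then show ?thesis using flow_nonneg[of "fst p" "snd p"] p by (intro mult_nonneg_nonneg) simp_all
  next
    case False
    have "snd p \<in> edges G" using turnsD(2)[of "fst p" "snd p"] p by simp
    then have "arrows (fst p) (snd p) = 0" using False arrows_nonneg[of "snd p" "fst p"] by linarith
    then show ?thesis by (simp add: flow_def)
  qed
  have zero: "(\<Sum>p\<in>turns. ?d p) = 0"
    using sum_flow_weighted[of ?c] by (simp add: right_diff_distrib sum_subtractf)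
  have "?d (e, f) = 0" by (rule sum_nonneg_0[OF finite_turns nonneg zero ef(1)])
  then show ?thesis using flow_pos[OF ef(1,2)] ef(3) by (simp split: if_splits)
qed

text \<open>
  The part of the series over \<open>f\<close>; a Green function of the transfer operator with source at the centre.
\<close>

definition green :: "real \<Rightarrow> 'e \<Rightarrow> real" where
  "green s f = (\<Sum>n. level_sum s n f)"

context
  fixes s assumes s: "entropy < ereal s"
begin

lemma green_nonneg: "f \<in> edges G \<Longrightarrow> 0 \<le> green s f"
  unfolding green_def by (rule suminf_nonneg[OF summable_level_sum[OF s] level_sum_nonneg])

lemma green_superharmonic:
  assumes f: "f \<in> edges G"
  shows "exp (- s * l f) * (\<Sum>e | e \<in> edges G \<and> tgt G e = src G f. arrows e f * green s e) \<le> green s f"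
proof -
  let ?I = "{e \<in> edges G. tgt G e = src G f}"
  let ?R = "\<lambda>n. exp (- s * l f) * (\<Sum>e\<in>?I. arrows e f * level_sum s n e)"
  \<comment> \<open>Equality holds for positive \<open>n\<close>; at \<open>n = 0\<close> the left-hand side vanishes, while edges at the centre exist.\<close>
  have step: "?R n \<le> level_sum s (Suc n) f" for n
  proof (cases "n = 0")
    case True
    then show ?thesis using level_sum_nonneg by (simp add: level_sum_0)
  next
    case False
    then show ?thesis using level_sum_Suc[OF f] by simp
  qed
  have "?R sums (exp (- s * l f) * (\<Sum>e\<in>?I. arrows e f * green s e))"
    unfolding green_def
    by (intro sums_mult sums_sum summable_sums summable_level_sum[OF s]) auto
  moreover have "(\<lambda>n. level_sum s (Suc n) f) sums green s f"
    using summable_sums[OF summable_level_sum[OF s f]]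
    by (simp add: sums_Suc_iff[of "\<lambda>n. level_sum s n f"] level_sum_0 green_def)
  ultimately show ?thesis by (rule sums_le[OF step])
qed

lemma green_forward:
  assumes "(e, f) \<in> turns" "0 < arrows e f" "0 < green s e"
  shows "0 < green s f"
proof -
  have ef: "e \<in> edges G" "f \<in> edges G" "tgt G e = src G f" using assms by (auto simp: turns_def)
  let ?I = "{e \<in> edges G. tgt G e = src G f}"
  have "arrows e f * green s e \<le> (\<Sum>e\<in>?I. arrows e f * green s e)"
    using ef finiteness(2) arrows_nonneg green_nonneg by (intro member_le_sum) auto
  moreover have "0 < arrows e f * green s e" using assms by simp
  ultimately have "0 < exp (- s * l f) * (\<Sum>e\<in>?I. arrows e f * green s e)" by simp
  then show ?thesis using green_superharmonic[OF ef(2)] by linarith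
qed

text \<open>
  Positivity propagates along arrows in both directions, hence along a zigzag from an edge to its reverse.
\<close>

lemma green_bar:
  assumes f: "f \<in> edges G" and pos: "0 < green s f"
  shows "0 < green s (bar G f)"
proof -
  obtain f1 f2 where f12: "f1 \<in> edges G" "f2 \<in> edges G" "src G f1 = src G f" "src G f2 = src G f"
    "0 < arrows (bar G f) f1" "0 < arrows (bar G f2) f1" "0 < arrows (bar G f2) f"
    using zigzag[OF f] by blast
  have t: "(bar G f2, f) \<in> turns" "(bar G f2, f1) \<in> turns" "(bar G f, f1) \<in> turns"
    using f f12 edge_simps[OF f] edge_simps[OF f12(2)] by (simp_all add: turns_def)
  \<comment> \<open>Recurrence: the set where \<open>green\<close> is positive is closed under following arrows.\<close>
  have backwards: "0 < green s e'" if "(e', f') \<in> turns" "0 < arrows e' f'" "0 < green s f'" for e' f'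
    by (rule closed_under_arrows_backwards[of "\<lambda>e. 0 < green s e", OF _ that]) (rule green_forward)
  have "0 < green s (bar G f2)" by (rule backwards[OF t(1) f12(7) pos])
  then have "0 < green s f1" by (rule green_forward[OF t(2) f12(6)])
  then show ?thesis by (rule backwards[OF t(3) f12(5)])
qed

lemma green_pos_at_base:
  assumes "f \<in> edges G" "src G f = b" shows "0 < green s f"
  unfolding green_def
  by (rule suminf_pos2[OF summable_level_sum[OF s assms(1)] level_sum_nonneg level_sum_1_pos[OF assms]])

text \<open>
  Outward edges exist over every oriented edge of the graph: this holds at the centre and spreads to adjacent vertices.
\<close>

lemma green_pos:
  assumes f: "f \<in> edges G" shows "0 < green s f"
proof -
  have "\<forall>f\<in>edges G. src G f = y \<longrightarrow> 0 < green s f"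
    if "edge_path G x es y" "\<forall>f\<in>edges G. src G f = x \<longrightarrow> 0 < green s f" for x es y
    using that
  proof (induction es arbitrary: x)
    case (Cons e es)
    have e: "e \<in> edges G" "src G e = x" "edge_path G (tgt G e) es y" using Cons.prems by auto
    have pe: "0 < green s e" using Cons.prems e by blast
    have "0 < green s g" if g: "g \<in> edges G" "src G g = tgt G e" for g
    proof (cases "g = bar G e")
      case True
      then show ?thesis using green_bar[OF e(1) pe] by simp
    next
      case False
      have "(e, g) \<in> turns" using e g by (simp add: turns_def)
      from green_forward[OF this arrows_off_diagonal_pos[OF g(1) False] pe] show ?thesis .
    qed
    then show ?case using Cons.IH[OF e(3)] by blast
  qed simp
  moreover have "\<forall>x\<in>verts G. \<forall>y\<in>verts G. \<exists>es. edge_path G x es y"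
    using finite_gog unfolding finite_connected_graph_of_finite_groups_def connected_graph_def by blast
  then obtain es where "edge_path G b es (src G f)"
    using base_verts(2) edge_simps(1)[OF f] by blast
  ultimately show ?thesis using green_pos_at_base f by blast
qed

end

text \<open>
  This would be constantly \<open>1\<close> on all arrows if the uniform walk were the Gibbs measure of the potential \<open>- s * l\<close>.
\<close>

definition gibbs_ratio :: "real \<Rightarrow> 'e \<Rightarrow> 'e \<Rightarrow> real" where
  "gibbs_ratio s e f = k (src G f) * (eord e * green s e) * exp (- s * l f) / (eord f * green s f)"

text \<open>
  Half of the entropy production \<open>\<Sum>x. (k x + 1) * ln (k x) / |G_x|\<close> of the uniform non-backtracking walk, written as a
  sum over edges.
\<close>

definition path_entropy :: real where
  "path_entropy = 1/2 * (\<Sum>f\<in>edges G. ln (k (src G f)) / eord f)"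

context
  fixes s assumes s: "entropy < ereal s"
begin

lemma gibbs_ratio_pos: "(e, f) \<in> turns \<Longrightarrow> 0 < gibbs_ratio s e f"
  using green_pos[OF s] turnsD[of e f] by (simp add: gibbs_ratio_def)

lemma ln_gibbs_ratio:
  assumes "(e, f) \<in> turns"
  shows "ln (gibbs_ratio s e f) =
    ln (k (src G f)) - s * l f + ln (eord e * green s e) - ln (eord f * green s f)"
proof -
  have pos: "0 < k (src G f)" "0 < eord e * green s e" "0 < eord f * green s f"
    using green_pos[OF s] turnsD[OF assms] by simp_all
  show ?thesis unfolding gibbs_ratio_def ln_mult_mult_exp_div[OF pos] by linarith
qed

text \<open>
  The superharmonic inequality for \<open>green\<close>, divided by \<open>|G_f| * green s f\<close>: the flow-average of the ratio is at most \<open>1\<close>.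
\<close>

lemma sum_flow_gibbs_ratio_le:
  assumes f: "f \<in> edges G"
  shows "(\<Sum>e | e \<in> edges G \<and> tgt G e = src G f. flow e f * gibbs_ratio s e f) \<le> 1 / eord f"
proof -
  let ?I = "{e. e \<in> edges G \<and> tgt G e = src G f}"
  have pos: "0 < green s f" "0 < eord f" "0 < k (src G f)"
    using green_pos[OF s f] order_pos(2)[OF f] k_ge_2[OF edge_simps(1)[OF f]] by auto
  have "flow e f * gibbs_ratio s e f = exp (- s * l f) * (arrows e f * green s e) / (eord f * green s f)"
    if "e \<in> ?I" for e
    using pos order_pos(2)[of e] that by (simp add: flow_def gibbs_ratio_def)
  then have "(\<Sum>e\<in>?I. flow e f * gibbs_ratio s e f) =
      exp (- s * l f) * (\<Sum>e\<in>?I. arrows e f * green s e) / (eord f * green s f)"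
    by (simp add: sum_divide_distrib sum_distrib_left)
  also have "\<dots> \<le> green s f / (eord f * green s f)"
    using green_superharmonic[OF s f] pos by (intro divide_right_mono) auto
  also have "\<dots> = 1 / eord f" using pos by simp
  finally show ?thesis .
qed

text \<open>
  Jensen's inequality in integrated form. The logarithm of the ratio consists of \<open>ln (k (src f)) - s * l f\<close> and a coboundary,
  which a stationary flow does not see.
\<close>

lemma sum_gibbs_gap_le:
  "(\<Sum>p\<in>turns. flow (fst p) (snd p) *
      (gibbs_ratio s (fst p) (snd p) - 1 - ln (gibbs_ratio s (fst p) (snd p))))
    \<le> 2 * (s * gog_volume G l - path_entropy)"
proof -
  let ?w = "\<lambda>p. flow (fst p) (snd p)" and ?t = "\<lambda>p. gibbs_ratio s (fst p) (snd p)"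
  have le: "(\<Sum>p\<in>turns. ?w p * ?t p) \<le> (\<Sum>f\<in>edges G. 1 / eord f)"
    unfolding sum_turns(2)[of "\<lambda>e f. flow e f * gibbs_ratio s e f"]
    by (rule sum_mono) (rule sum_flow_gibbs_ratio_le)
  have mass: "(\<Sum>p\<in>turns. ?w p) = (\<Sum>f\<in>edges G. 1 / eord f)"
    using sum_flow_weighted(1)[of "\<lambda>_. 1"] by simp
  have log: "(\<Sum>p\<in>turns. ?w p * ln (?t p)) = 2 * path_entropy - 2 * (s * gog_volume G l)"
  proof -
    let ?u = "\<lambda>e. ln (eord e * green s e)"
    have "(\<Sum>p\<in>turns. ?w p * ln (?t p)) =
        (\<Sum>p\<in>turns. ?w p * ln (k (src G (snd p)))) - s * (\<Sum>p\<in>turns. ?w p * l (snd p))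
        + (\<Sum>p\<in>turns. ?w p * ?u (fst p)) - (\<Sum>p\<in>turns. ?w p * ?u (snd p))"
      unfolding sum_distrib_left sum_subtractf[symmetric] sum.distrib[symmetric]
    proof (rule sum.cong[OF refl])
      fix p assume "p \<in> turns"
      then have "(fst p, snd p) \<in> turns" by simp
      note L = ln_gibbs_ratio[OF this]
      show "?w p * ln (?t p) = ?w p * ln (k (src G (snd p))) - s * (?w p * l (snd p))
          + ?w p * ?u (fst p) - ?w p * ?u (snd p)"
        unfolding L by (simp only: algebra_simps)
    qed
    also have "\<dots> = (\<Sum>f\<in>edges G. ln (k (src G f)) / eord f) - s * (\<Sum>f\<in>edges G. l f / eord f)"
      unfolding sum_flow_weighted(1)[of ?u] sum_flow_weighted(2)[of ?u]
        sum_flow_weighted(2)[of "\<lambda>f. ln (k (src G f))"] sum_flow_weighted(2)[of l] by simp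
    finally show ?thesis by (simp add: path_entropy_def gog_volume_def)
  qed
  have arith: "A - B - C \<le> 2 * (y - x)" if "A \<le> D" "B = D" "C = 2 * x - 2 * y" for A B C D x y :: real
    using that by argo
  have "(\<Sum>p\<in>turns. ?w p * (?t p - 1 - ln (?t p))) =
      (\<Sum>p\<in>turns. ?w p * ?t p) - (\<Sum>p\<in>turns. ?w p) - (\<Sum>p\<in>turns. ?w p * ln (?t p))"
    by (simp only: right_diff_distrib sum_subtractf mult_1_right)
  also have "\<dots> \<le> 2 * (s * gog_volume G l - path_entropy)" by (rule arith[OF le mass log])
  finally show ?thesis .
qed

lemma gibbs_gap_nonneg: "(e, f) \<in> turns \<Longrightarrow> 0 \<le> gibbs_ratio s e f - 1 - ln (gibbs_ratio s e f)"
  using ln_le_minus_one[OF gibbs_ratio_pos] by fastforce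

lemma gibbs_gap_le:
  assumes "(e, f) \<in> turns"
  shows "flow e f * (gibbs_ratio s e f - 1 - ln (gibbs_ratio s e f))
    \<le> 2 * (s * gog_volume G l - path_entropy)"
proof -
  let ?d = "\<lambda>p. flow (fst p) (snd p) *
      (gibbs_ratio s (fst p) (snd p) - 1 - ln (gibbs_ratio s (fst p) (snd p)))"
  have "?d (e, f) \<le> (\<Sum>p\<in>turns. ?d p)"
    by (rule member_le_sum)
      (use assms finite_turns flow_nonneg gibbs_gap_nonneg in \<open>auto intro!: mult_nonneg_nonneg\<close>)
  then have "flow e f * (gibbs_ratio s e f - 1 - ln (gibbs_ratio s e f)) \<le> (\<Sum>p\<in>turns. ?d p)" by simp
  then show ?thesis by (rule order_trans[OF _ sum_gibbs_gap_le])
qed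

lemma path_entropy_le: "path_entropy \<le> s * gog_volume G l"
proof -
  have "0 \<le> (\<Sum>p\<in>turns. flow (fst p) (snd p) *
      (gibbs_ratio s (fst p) (snd p) - 1 - ln (gibbs_ratio s (fst p) (snd p))))"
    by (rule sum_nonneg) (use flow_nonneg gibbs_gap_nonneg in \<open>auto intro!: mult_nonneg_nonneg\<close>)
  then have "0 \<le> 2 * (s * gog_volume G l - path_entropy)"
    by (rule order_trans[OF _ sum_gibbs_gap_le])
  then show ?thesis by simp
qed

end

lemma path_entropy_le_entropy:
  assumes "gog_volume G l = 1" shows "ereal path_entropy \<le> entropy"
proof (rule ccontr)
  assume "\<not> ereal path_entropy \<le> entropy"
  then have "entropy < ereal path_entropy" by simp
  then obtain s where "entropy < ereal s" "s < path_entropy" using ereal_dense2 by fastforce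
  then show False using path_entropy_le[of s] assms by simp
qed

text \<open>
  As \<open>s\<close> decreases to the entropy, all ratios on arrows tend to \<open>1\<close>. The ratio is a quotient of a function of \<open>e\<close> by a function of
  \<open>f\<close>, so a zigzag transfers this to the pair \<open>bar f\<close>, \<open>f\<close>, and the product over both orientations is free of \<open>green\<close>.
\<close>

lemma length_of_minimal_entropy:
  assumes vol: "gog_volume G l = 1" and eq: "entropy = ereal path_entropy" and f: "f \<in> edges G"
  shows "k (src G f) * k (tgt G f) = exp (2 * path_entropy * l f)"
proof -
  \<comment> \<open>Approach the entropy from above, where all series converge.\<close>
  define s where "s n = path_entropy + 1 / real (Suc n)" for n
  have s: "entropy < ereal (s n)" for n by (simp add: eq s_def)
  have s_lim: "s \<longlonglongrightarrow> path_entropy"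
    unfolding s_def using tendsto_add[OF tendsto_const[of path_entropy] LIMSEQ_Suc[OF lim_1_over_n]] by simp
  have lim: "(\<lambda>n. gibbs_ratio (s n) e g) \<longlonglongrightarrow> 1" if eg: "(e, g) \<in> turns" "0 < arrows e g" for e g
  proof (rule tendsto_1_if_gap_tendsto_0)
    show "0 < gibbs_ratio (s n) e g" for n using gibbs_ratio_pos[OF s eg(1)] .
    let ?gap = "\<lambda>n. gibbs_ratio (s n) e g - 1 - ln (gibbs_ratio (s n) e g)"
    have scaled: "flow e g * ?gap n \<le> 2 * (s n - path_entropy)" for n
      using gibbs_gap_le[OF s eg(1), of n] unfolding vol mult_1_right .
    have "?gap n \<le> 2 * (s n - path_entropy) / flow e g" for n
      using scaled[of n] by (simp only: pos_le_divide_eq[OF flow_pos[OF eg]] mult.commute[of _ "flow e g"])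
    moreover have "(\<lambda>n. 2 * (s n - path_entropy) / flow e g) \<longlonglongrightarrow> 2 * (path_entropy - path_entropy) / flow e g"
      using flow_pos[OF eg] by (intro tendsto_intros s_lim) auto
    ultimately show "?gap \<longlonglongrightarrow> 0"
      using gibbs_gap_nonneg[OF s eg(1)]
      by (intro tendsto_sandwich[of "\<lambda>_. 0" ?gap _ "\<lambda>n. 2 * (s n - path_entropy) / flow e g"]) simp_all
  qed
  have diag: "(\<lambda>n. gibbs_ratio (s n) (bar G g) g) \<longlonglongrightarrow> 1" if g: "g \<in> edges G" for g
  proof -
    obtain f1 f2 where f12: "f1 \<in> edges G" "f2 \<in> edges G" "src G f1 = src G g" "src G f2 = src G g"
      "0 < arrows (bar G g) f1" "0 < arrows (bar G f2) f1" "0 < arrows (bar G f2) g"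
      using zigzag[OF g] by blast
    have t: "(bar G f2, g) \<in> turns" "(bar G f2, f1) \<in> turns" "(bar G g, f1) \<in> turns"
      using g f12 edge_simps[OF g] edge_simps[OF f12(2)] by (simp_all add: turns_def)
    have "gibbs_ratio (s n) (bar G g) g =
        gibbs_ratio (s n) (bar G g) f1 * gibbs_ratio (s n) (bar G f2) g / gibbs_ratio (s n) (bar G f2) f1" for n
    proof -
      have pos: "green (s n) h \<noteq> 0" "eord h \<noteq> 0" if "h \<in> edges G" for h
        using green_pos[OF s that, of n] order_pos(2)[OF that] by simp_all
      have "k (src G g) \<noteq> 0" using k_ge_2[OF edge_simps(1)[OF g]] by simp
      then show ?thesis
        using pos[OF g] pos[OF f12(1)] pos[OF edge_simps(3)[OF f12(2)]] f12(3)
        unfolding gibbs_ratio_def by simp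
    qed
    moreover have "(\<lambda>n. gibbs_ratio (s n) (bar G g) f1 * gibbs_ratio (s n) (bar G f2) g /
        gibbs_ratio (s n) (bar G f2) f1) \<longlonglongrightarrow> 1 * 1 / 1"
      using t f12 by (intro tendsto_intros lim) auto
    ultimately show ?thesis by simp
  qed
  note F = edge_simps[OF f]
  have prod: "gibbs_ratio (s n) (bar G f) f * gibbs_ratio (s n) f (bar G f) =
      k (src G f) * k (tgt G f) * exp (- 2 * s n * l f)" for n
  proof -
    have "green (s n) f \<noteq> 0" "green (s n) (bar G f) \<noteq> 0" "eord f \<noteq> 0"
      using green_pos[OF s f, of n] green_pos[OF s F(3), of n] order_pos(2)[OF f] by simp_all
    then show ?thesis
      using F length_bar[OF f] by (simp add: gibbs_ratio_def flip: exp_add)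
  qed
  have "(\<lambda>n. gibbs_ratio (s n) (bar G f) f * gibbs_ratio (s n) f (bar G f)) \<longlonglongrightarrow> 1 * 1"
    by (rule tendsto_mult[OF diag[OF f] diag[OF F(3), unfolded F(5)]])
  then have lim1: "(\<lambda>n. k (src G f) * k (tgt G f) * exp (- 2 * s n * l f)) \<longlonglongrightarrow> 1"
    unfolding prod by simp
  have lim2: "(\<lambda>n. k (src G f) * k (tgt G f) * exp (- 2 * s n * l f)) \<longlonglongrightarrow>
      k (src G f) * k (tgt G f) * exp (- 2 * path_entropy * l f)"
    by (intro tendsto_intros s_lim)
  have "k (src G f) * k (tgt G f) * exp (- (2 * path_entropy * l f)) = 1"
    using LIMSEQ_unique[OF lim2 lim1] by simp
  then show ?thesis by (simp add: exp_minus divide_simps)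
qed

section \<open>The minimizing length\<close>

lemma path_entropy_eq: "path_entropy = 1/2 * (\<Sum>x\<in>verts G. gog_degree G x * ln (k x) / vord x)"
proof -
  have "(\<Sum>f\<in>edges G. ln (k (src G f)) / eord f) =
      (\<Sum>x\<in>verts G. \<Sum>f\<in>{f \<in> edges G. src G f = x}. ln (k (src G f)) / eord f)"
    by (rule sum.group[symmetric]) (use finiteness(1,2) edge_simps(1) in auto)
  also have "\<dots> = (\<Sum>x\<in>verts G. gog_degree G x * ln (k x) / vord x)"
  proof (rule sum.cong[OF refl])
    fix x assume "x \<in> verts G"
    then have "vord x \<noteq> 0" using order_pos(1)[of x] by simp
    then show "(\<Sum>f\<in>{f \<in> edges G. src G f = x}. ln (k (src G f)) / eord f) =
        gog_degree G x * ln (k x) / vord x"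
      unfolding gog_degree_def sum_distrib_right sum_divide_distrib by (intro sum.cong) auto
  qed
  finally show ?thesis by (simp add: path_entropy_def)
qed

lemma ln_k_pos: "x \<in> verts G \<Longrightarrow> 0 < ln (k x)"
  using k_ge_2[of x] by simp

lemma path_entropy_pos: "0 < path_entropy"
proof -
  have "0 < (\<Sum>f\<in>edges G. ln (k (src G f)) / eord f)"
    by (rule sum_pos)
      (use finiteness(2) edges_nonempty ln_k_pos[OF edge_simps(1)] order_pos(2) in auto)
  then show ?thesis by (simp add: path_entropy_def)
qed

lemma sum_ln_k_tgt: "(\<Sum>f\<in>edges G. ln (k (tgt G f)) / eord f) = 2 * path_entropy"
proof -
  have "bij_betw (bar G) (edges G) (edges G)"
    by (rule bij_betwI[where g = "bar G"]) (auto simp: edge_simps)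
  then have "(\<Sum>f\<in>edges G. ln (k (tgt G f)) / eord f) =
      (\<Sum>f\<in>edges G. ln (k (tgt G (bar G f))) / eord (bar G f))"
    by (rule sum.reindex_bij_betw[symmetric])
  also have "\<dots> = (\<Sum>f\<in>edges G. ln (k (src G f)) / eord f)"
    by (rule sum.cong) (auto simp: edge_simps)
  finally show ?thesis by (simp add: path_entropy_def)
qed

text \<open>
  The only candidate left by \<open>length_of_minimal_entropy\<close>; the factor makes the volume one.
\<close>

definition log_length :: "'e \<Rightarrow> real" where
  "log_length e = 1 / (2 * path_entropy) * ln (k (src G e) * k (tgt G e))"

lemma normalized_log_length: "normalized G log_length"
proof -
  have "length_function G log_length"
    unfolding length_function_def
  proof (intro ballI conjI)
    fix e assume e: "e \<in> edges G"
    have "1 < k (src G e) * k (tgt G e)"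
      using k_ge_2 edge_simps(1,2)[OF e] by (intro less_1_mult) force+
    then show "0 < log_length e" using path_entropy_pos by (simp add: log_length_def)
    show "log_length (bar G e) = log_length e" by (simp add: log_length_def edge_simps e mult.commute)
  qed
  moreover have "gog_volume G log_length = 1"
  proof -
    have "log_length e / eord e =
        (ln (k (src G e)) / eord e + ln (k (tgt G e)) / eord e) / (2 * path_entropy)"
      if e: "e \<in> edges G" for e
    proof -
      have "0 < k (src G e)" "0 < k (tgt G e)"
        using k_ge_2[OF edge_simps(1)[OF e]] k_ge_2[OF edge_simps(2)[OF e]] by auto
      then have "ln (k (src G e) * k (tgt G e)) = ln (k (src G e)) + ln (k (tgt G e))"
        by (rule ln_mult_pos)
      then show ?thesis by (simp add: log_length_def add_divide_distrib mult.commute)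
    qed
    then have "(\<Sum>e\<in>edges G. log_length e / eord e) =
        ((\<Sum>e\<in>edges G. ln (k (src G e)) / eord e) + (\<Sum>e\<in>edges G. ln (k (tgt G e)) / eord e))
          / (2 * path_entropy)"
      by (simp add: sum.distrib flip: sum_divide_distrib)
    also have "(\<Sum>e\<in>edges G. ln (k (src G e)) / eord e) = 2 * path_entropy"
      by (simp add: path_entropy_def)
    also have "(2 * path_entropy + (\<Sum>e\<in>edges G. ln (k (tgt G e)) / eord e)) / (2 * path_entropy) = 2"
      unfolding sum_ln_k_tgt using path_entropy_pos by simp
    finally show ?thesis by (simp add: gog_volume_def)
  qed
  ultimately show ?thesis by (simp add: normalized_def)
qed

text \<open>
  For this length, weighting an edge by the square root of \<open>k\<close> at its end gives an eigenvector with eigenvalue one at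
  \<open>s = path_entropy\<close>, so the weighted level sums are constant in the level and for larger \<open>s\<close> they decay geometrically.
\<close>

lemma entropy_log_length:
  assumes l: "\<And>e. e \<in> edges G \<Longrightarrow> l e = log_length e"
  shows "entropy \<le> ereal path_entropy"
proof -
  let ?h = path_entropy
  \<comment> \<open>Pairing of the level sums with the eigenvector; the recursion makes it constant.\<close>
  define F where "F n = (\<Sum>f\<in>edges G. level_sum ?h n f * sqrt (k (tgt G f)))" for n
  have weight: "exp (- ?h * l f) * sqrt (k (tgt G f)) = 1 / sqrt (k (src G f))" if f: "f \<in> edges G" for f
  proof -
    have k: "0 < k (src G f)" "0 < k (tgt G f)"
      using k_ge_2[OF edge_simps(1)[OF f]] k_ge_2[OF edge_simps(2)[OF f]] by auto
    then have p: "0 < k (src G f) * k (tgt G f)" by simp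
    have "- ?h * l f = - ln (sqrt (k (src G f) * k (tgt G f)))"
      using path_entropy_pos p by (simp add: l[OF f] log_length_def ln_sqrt)
    then have "exp (- ?h * l f) = inverse (sqrt (k (src G f) * k (tgt G f)))"
      using p by (simp only: exp_minus exp_ln real_sqrt_gt_0_iff)
    moreover have "inverse (sqrt (k (src G f) * k (tgt G f))) * sqrt (k (tgt G f)) = 1 / sqrt (k (src G f))"
      using k by (simp add: real_sqrt_mult field_simps)
    ultimately show ?thesis by (simp only:)
  qed
  have F_Suc: "F (Suc n) = F n" if n: "0 < n" for n
  proof -
    let ?a = "\<lambda>e f. arrows e f * level_sum ?h n e / sqrt (k (src G f))"
    have "F (Suc n) = (\<Sum>f\<in>edges G. \<Sum>e | e \<in> edges G \<and> tgt G e = src G f. ?a e f)"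
      unfolding F_def
    proof (rule sum.cong[OF refl])
      fix f assume f: "f \<in> edges G"
      have "level_sum ?h (Suc n) f * sqrt (k (tgt G f)) =
          (exp (- ?h * l f) * sqrt (k (tgt G f))) *
            (\<Sum>e | e \<in> edges G \<and> tgt G e = src G f. arrows e f * level_sum ?h n e)"
        unfolding level_sum_Suc[OF f n] by (simp only: mult_ac)
      then show "level_sum ?h (Suc n) f * sqrt (k (tgt G f)) =
          (\<Sum>e | e \<in> edges G \<and> tgt G e = src G f. ?a e f)"
        unfolding weight[OF f] by (simp add: sum_divide_distrib)
    qed
    also have "\<dots> = (\<Sum>e\<in>edges G. \<Sum>f | f \<in> edges G \<and> src G f = tgt G e. ?a e f)"
      unfolding sum_turns(1)[symmetric] sum_turns(2)[symmetric] ..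
    also have "\<dots> = F n"
      unfolding F_def
    proof (rule sum.cong[OF refl])
      fix e assume e: "e \<in> edges G"
      have "(\<Sum>f | f \<in> edges G \<and> src G f = tgt G e. ?a e f) =
          (\<Sum>f | f \<in> edges G \<and> src G f = tgt G e. arrows e f) * (level_sum ?h n e / sqrt (k (tgt G e)))"
        unfolding sum_distrib_right by (intro sum.cong) auto
      also have "\<dots> = level_sum ?h n e * (k (tgt G e) / sqrt (k (tgt G e)))"
        unfolding sum_arrows_out[OF e] by simp
      also have "k (tgt G e) / sqrt (k (tgt G e)) = sqrt (k (tgt G e))"
        using k_ge_2[OF edge_simps(2)[OF e]] by (simp add: real_div_sqrt)
      finally show "(\<Sum>f | f \<in> edges G \<and> src G f = tgt G e. ?a e f) = level_sum ?h n e * sqrt (k (tgt G e))" .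
    qed
    finally show ?thesis .
  qed
  have F_const: "F (Suc n) = F 1" for n
    by (induction n) (simp_all add: F_Suc)
  have level_le: "level_sum ?h (Suc n) f \<le> F 1" if f: "f \<in> edges G" for n f
  proof -
    have "1 \<le> sqrt (k (tgt G f))" using k_ge_2[OF edge_simps(2)[OF f]] by simp
    from mult_left_mono[OF this level_sum_nonneg]
    have "level_sum ?h (Suc n) f \<le> level_sum ?h (Suc n) f * sqrt (k (tgt G f))" by simp
    also have "\<dots> \<le> F (Suc n)" unfolding F_def
    proof (rule member_le_sum[OF f _ finiteness(2)])
      fix g assume "g \<in> edges G - {f}"
      then have "0 \<le> sqrt (k (tgt G g))" using k_ge_2[OF edge_simps(2)[of g]] by simp
      then show "0 \<le> level_sum ?h (Suc n) g * sqrt (k (tgt G g))"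
        using level_sum_nonneg by (intro mult_nonneg_nonneg)
    qed
    also have "F (Suc n) = F 1" by (rule F_const)
    finally show ?thesis .
  qed
  have "entropy \<le> ereal s" if s: "?h < s" for s
  proof (rule entropy_le)
    show "0 < s" using s path_entropy_pos by simp
    fix f assume f: "f \<in> edges G"
    define q where "q = exp (- (s - ?h) * lmin)"
    have bound: "level_sum s n f \<le> q ^ n * level_sum ?h n f" for n
      unfolding level_sum_def sum_distrib_left
    proof (rule sum_mono)
      fix E assume E: "E \<in> level n f"
      then have "E \<in> edges T" "cover_depth (tgt T E) = n"
        using tree.outward_edge by (auto simp: level_def)
      then have "lmin * n \<le> end_height E"
        using tree.depth_le_height[OF tree.edge_facts(2), of E] by simp
      then have "(s - ?h) * (lmin * n) \<le> (s - ?h) * end_height E" using s by (intro mult_left_mono) auto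
      then have "exp (- s * end_height E) \<le> exp (real n * (- (s - ?h) * lmin) + - ?h * end_height E)"
        by (simp add: algebra_simps)
      then show "exp (- s * end_height E) \<le> q ^ n * exp (- ?h * end_height E)"
        by (simp only: exp_add q_def exp_of_nat_mult)
    qed
    have q: "0 < q" "q < 1" using s tree.lmin_pos by (simp_all add: q_def mult_neg_pos)
    have "summable (\<lambda>n. level_sum s (Suc n) f)"
    proof (rule summable_comparison_test')
      show "summable (\<lambda>n. F 1 * q * q ^ n)"
        using q by (intro summable_mult summable_geometric) simp
      fix n :: nat
      have "level_sum s (Suc n) f \<le> q ^ Suc n * F 1"
      proof (rule order_trans[OF bound[of "Suc n"] mult_left_mono[OF level_le[OF f]]])
        show "0 \<le> q ^ Suc n" using q by simp
      qed
      then show "norm (level_sum s (Suc n) f) \<le> F 1 * q * q ^ n"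
        using level_sum_nonneg by (simp add: mult_ac)
    qed
    then show "summable (\<lambda>n. level_sum s n f)"
      using summable_Suc_iff[of "\<lambda>n. level_sum s n f"] by simp
  qed
  then show ?thesis
    using ereal_dense2[of "ereal ?h" entropy] by (fastforce simp: not_less[symmetric])
qed

end

section \<open>Minimal volume entropy\<close>

theorem proposition9:
  fixes G :: "('v, 'e, 'g, 'h) gog"
    and a :: 'v
    and v :: "'v \<times> ('v, 'e, 'g) letter list set"
  assumes "finite_connected_graph_of_finite_groups G"
    and "\<forall>x\<in>verts G. gog_degree G x \<ge> 3"
    and "a \<in> verts G"
    and "v \<in> verts (universal_cover G a)"
  shows "(\<exists>!d. \<exists>l. minimizes_entropy G a v l \<and> d = length_dist G l) \<and>
    (\<forall>l. minimizes_entropy G a v l \<longrightarrow>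
       (\<exists>c>0. \<forall>e\<in>edges G. l e = c * ln (branching G (src G e) * branching G (tgt G e)))) \<and>
    min_entropy G a v =
      ereal (1/2 * (\<Sum>x\<in>verts G. gog_degree G x * ln (branching G x) / real (order (vgrp G x))))"
proof -
  obtain b w0 where v: "v = (b, vcoset G a b w0)" and w0: "gpath G a w0 b"
    using assms(4) by (auto simp: universal_cover_def)
  have cover: "weighted_cover G a b w0 l" if "normalized G l" for l
    by unfold_locales
      (use assms(1,2) w0 that in
        \<open>auto simp: normalized_def finite_connected_graph_of_finite_groups_def\<close>)
  \<comment> \<open>The bound and the candidate depend on the graph of groups alone, so any length gives access to them.\<close>
  interpret unit: weighted_cover G a b w0 "\<lambda>_. 1"
    by unfold_locales
      (use assms(1,2) w0 in
        \<open>auto simp: finite_connected_graph_of_finite_groups_def length_function_def\<close>)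
  have v': "v = unit.cover_vert b w0" by (simp add: v unit.cover_vert_def)
  let ?h = "unit.path_entropy" and ?l = "unit.log_length"
  have h_pos: "0 < ?h" by (rule unit.path_entropy_pos)
  have norm: "normalized G ?l" by (rule unit.normalized_log_length)
  have lower: "ereal ?h \<le> volume_entropy G a v l" if "normalized G l" for l
    using weighted_cover.path_entropy_le_entropy[OF cover[OF that]] that
    by (simp add: v' normalized_def)
  have "volume_entropy G a v ?l \<le> ereal ?h"
    using weighted_cover.entropy_log_length[OF cover[OF norm]] by (simp add: v')
  with lower[OF norm] have attained: "volume_entropy G a v ?l = ereal ?h" by simp
  have minimizer: "minimizes_entropy G a v ?l"
    using norm lower attained by (simp add: minimizes_entropy_def)
  have unique: "l e = ?l e" if l: "minimizes_entropy G a v l" and e: "e \<in> edges G" for l e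
  proof -
    have n: "normalized G l" and "volume_entropy G a v l \<le> volume_entropy G a v ?l"
      using l norm by (auto simp: minimizes_entropy_def)
    then have ent: "volume_entropy G a v l = ereal ?h" using lower[OF n] attained by simp
    have "unit.k (src G e) * unit.k (tgt G e) = exp (2 * ?h * l e)"
      using weighted_cover.length_of_minimal_entropy[OF cover[OF n] _ _ e] n ent
      by (simp add: v' normalized_def)
    then show ?thesis using h_pos by (simp add: unit.log_length_def)
  qed
  have "\<exists>!d. \<exists>l. minimizes_entropy G a v l \<and> d = length_dist G l"
  proof (rule ex1I[of _ "length_dist G ?l"])
    show "\<exists>l. minimizes_entropy G a v l \<and> length_dist G ?l = length_dist G l"
      using minimizer by blast
    fix d assume "\<exists>l. minimizes_entropy G a v l \<and> d = length_dist G l"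
    then show "d = length_dist G ?l" using length_dist_cong unique by metis
  qed
  moreover have "\<exists>c>0. \<forall>e\<in>edges G. l e = c * ln (branching G (src G e) * branching G (tgt G e))"
    if "minimizes_entropy G a v l" for l
    using unique[OF that] h_pos
    by (intro exI[of _ "1 / (2 * ?h)"]) (simp add: unit.log_length_def)
  moreover have "min_entropy G a v = ereal ?h"
    unfolding min_entropy_def
  proof (rule antisym)
    show "(INF l\<in>{l. normalized G l}. volume_entropy G a v l) \<le> ereal ?h"
      unfolding attained[symmetric] using norm by (intro INF_lower) simp
    show "ereal ?h \<le> (INF l\<in>{l. normalized G l}. volume_entropy G a v l)"
      using lower by (intro INF_greatest) simp
  qed
  ultimately show ?thesis
    unfolding unit.path_entropy_eq by (intro conjI allI impI)
qed

end
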